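(* Let $X_1,X_2,\dots$ be i.i.d. with density $p$ as described in the context, $h\in\mathfrak{R}$, and let $a_n\to\infty$. Define $t=t(n)$ by $m(t)=a_n$ and assume $$\lim_{n\to\infty}\frac{\psi(t)^2}{\sqrt{n\psi'(t)}}=0 .$$ Let $P_{a_n}$ be the conditional distribution of $X_1$ given $S_1^n=X_1+\dots+X_n=na_n$, and let $G_{a_n}$ be the probability measure with density $g_{a_n}=\pi^{a_n}$. Then the total variation norm between $P_{a_n}$ and $G_{a_n}$ tends to $0$, i.e. $$\lim_{n\to\infty}\ \sup_{C\in\mathcal{B}(\mathbb{R})}\left|P_{a_n}(C)-G_{a_n}(C)\right|=0 .$$
   Context: Density: $p$ is a uniformly bounded probability density, $p(x)=c\exp(-(g(x)-q(x)))$ for $x\in\mathbb{R}_+$ (and $p=0$ on negative reals), with $c>0$ a normalizing constant. The function $g$ is positive, $g(x)/x\to\infty$ as $x\to\infty$, and $h:=g'$. There is a constant $\vartheta>0$ such that for all large $x$, $\sup_{|v-x|<\vartheta x}|q(v)|\le 1/\sqrt{x h(x)}$. Regularity classes: $l\in R_0$ if $l(x)=\exp\left(\int_1^x\frac{\epsilon(u)}{u}du\right)$ for $x\ge1$, where $\epsilon$ is twice differentiable and $\epsilon(x)\to0$ as $x\to\infty$. For $\beta>0$, $h\in R_\beta$ if for $x$ large enough $h(x)=x^\beta l(x)$ with $l\in R_0$ whose function $\epsilon$ satisfies $\limsup_{x\to\infty}x|\epsilon'(x)|<\infty$ and $\limsup_{x\to\infty}x^2|\epsilon''(x)|<\infty$.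 A function $l\in R_0$ belongs to $\widetilde{R_0}$ if $l(x)\to\infty$ as $x\to\infty$, $\lim_{x\to\infty}\frac{x\epsilon'(x)}{\epsilon(x)}=0$, $\lim_{x\to\infty}\frac{x^2\epsilon''(x)}{\epsilon(x)}=0$, and $\liminf_{x\to\infty}x^\eta\epsilon(x)>0$ for some $\eta\in(0,1/4)$. $h\in R_\infty$ if $h$ is increasing and strictly monotone and its inverse $\psi$ belongs to $\widetilde{R_0}$. Here $\psi(u):=h^{\leftarrow}(u):=\inf\{x:h(x)\ge u\}$ (this notation is used for all $h$). $\mathfrak{R}:=R_\beta\cup R_\infty$ (any $\beta>0$). $\Phi(t)=\int_0^\infty e^{tx}p(x)\,dx$; $m(t)=\frac{d}{dt}\log\Phi(t)$. The tilted density is $\pi^{a}(x)=\frac{e^{tx}p(x)}{\Phi(t)}$ with $t$ the unique solution of $m(t)=a$. $\mathcal{B}(\mathbb{R})$ is the Borel $\sigma$-field. *)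

theory Defs
  imports "HOL-Probability.Probability"
begin

section \<open>Regularity classes\<close>

text \<open>
  \<open>karamata_rep l e e1 e2\<close>: the function \<open>l\<close> is of the form
  \<open>l x = exp (integral {1..x} (\<lambda>u. e u / u))\<close> on \<open>[1, \<infinity>)\<close>, where \<open>e\<close> vanishes at infinity and has
  first and second derivatives \<open>e1\<close>, \<open>e2\<close> (one-sided at the endpoint 1). On \<open>[1, \<infinity>)\<close> the functions
  \<open>e\<close>, \<open>e1\<close>, \<open>e2\<close> are determined by \<open>l\<close>.
\<close>

definition karamata_rep ::
    "(real \<Rightarrow> real) \<Rightarrow> (real \<Rightarrow> real) \<Rightarrow> (real \<Rightarrow> real) \<Rightarrow> (real \<Rightarrow> real) \<Rightarrow> bool" where
  "karamata_rep l e e1 e2 \<longleftrightarrow>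
     (\<forall>x\<ge>1. (e has_real_derivative e1 x) (at x within {1..})) \<and>
     (\<forall>x\<ge>1. (e1 has_real_derivative e2 x) (at x within {1..})) \<and>
     (e \<longlongrightarrow> 0) at_top \<and>
     (\<forall>x\<ge>1. l x = exp (integral {1..x} (\<lambda>u. e u / u)))"

definition R_reg :: "real \<Rightarrow> (real \<Rightarrow> real) set" where
  "R_reg \<beta> = {h. \<exists>l e e1 e2. karamata_rep l e e1 e2 \<and>
     (\<forall>\<^sub>F x in at_top. h x = x powr \<beta> * l x) \<and>
     Limsup at_top (\<lambda>x. ereal (x * \<bar>e1 x\<bar>)) < \<infinity> \<and>
     Limsup at_top (\<lambda>x. ereal (x\<^sup>2 * \<bar>e2 x\<bar>)) < \<infinity>}"

definition R_zero_tilde :: "(real \<Rightarrow> real) set" where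
  "R_zero_tilde = {l. \<exists>e e1 e2. karamata_rep l e e1 e2 \<and>
     filterlim l at_top at_top \<and>
     ((\<lambda>x. x * e1 x / e x) \<longlongrightarrow> 0) at_top \<and>
     ((\<lambda>x. x\<^sup>2 * e2 x / e x) \<longlongrightarrow> 0) at_top \<and>
     (\<exists>\<eta>. 0 < \<eta> \<and> \<eta> < 1/4 \<and> Liminf at_top (\<lambda>x. ereal (x powr \<eta> * e x)) > 0)}"

definition gen_inverse :: "(real \<Rightarrow> real) \<Rightarrow> real \<Rightarrow> real" where
  "gen_inverse h u = Inf {x. 0 < x \<and> u \<le> h x}"

definition R_infinity :: "(real \<Rightarrow> real) set" where
  "R_infinity = {h. strict_mono_on {0<..} h \<and> gen_inverse h \<in> R_zero_tilde}"

definition R_class :: "(real \<Rightarrow> real) set" where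
  "R_class = (\<Union>\<beta>\<in>{0<..}. R_reg \<beta>) \<union> R_infinity"


section \<open>Exponential tilting\<close>

definition mgf :: "(real \<Rightarrow> real) \<Rightarrow> real \<Rightarrow> real" where
  "mgf p t = (LINT x:{0..}|lborel. exp (t * x) * p x)"

definition tilted_mean :: "(real \<Rightarrow> real) \<Rightarrow> real \<Rightarrow> real" where
  "tilted_mean p t = deriv (\<lambda>s. ln (mgf p s)) t"

definition tilted_density :: "(real \<Rightarrow> real) \<Rightarrow> real \<Rightarrow> real \<Rightarrow> real" where
  "tilted_density p a x =
     (let t = (THE t. tilted_mean p t = a) in exp (t * x) * p x / mgf p t)"


section \<open>Conditional distributions\<close>

definition regular_conditional_distribution ::
    "'w measure \<Rightarrow> ('w \<Rightarrow> real) \<Rightarrow> ('w \<Rightarrow> real) \<Rightarrow> (real \<Rightarrow> real measure) \<Rightarrow> bool" where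
  "regular_conditional_distribution M X S \<kappa> \<longleftrightarrow>
     \<kappa> \<in> borel \<rightarrow>\<^sub>M prob_algebra borel \<and>
     (\<forall>C\<in>sets borel. \<forall>D\<in>sets borel.
        measure M {w \<in> space M. X w \<in> C \<and> S w \<in> D} =
          (LINT s:D|distr M borel S. measure (\<kappa> s) C))"

text \<open>
  A regular conditional distribution is only unique up to null sets of conditioning values, so
  evaluating it at one prescribed value requires selecting a version. When \<open>X\<^sub>1, \<dots>, X\<^sub>n\<close>
  (\<open>n \<ge> 2\<close>) are i.i.d. with a bounded density \<open>p\<close> that is positive on the positive half-line
  and zero on the negative one, the density formula
  \<open>x \<mapsto> p x * f\<^bsub>n-1\<^esub> (s - x) / f\<^sub>n s\<close>, with \<open>f\<^sub>k\<close> the \<open>k\<close>-fold convolution of \<open>p\<close>, gives for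
  \<open>s > 0\<close> a version for which the probability of every Borel set depends continuously on \<open>s\<close>.
  As the law of the sum charges every nonempty open subset of the positive half-line, that
  version is the only continuous one there.
\<close>

definition continuous_conditional_distribution ::
    "'w measure \<Rightarrow> ('w \<Rightarrow> real) \<Rightarrow> ('w \<Rightarrow> real) \<Rightarrow> (real \<Rightarrow> real measure) \<Rightarrow> bool" where
  "continuous_conditional_distribution M X S \<kappa> \<longleftrightarrow>
     regular_conditional_distribution M X S \<kappa> \<and>
     (\<forall>C\<in>sets borel. continuous_on {0<..} (\<lambda>s. measure (\<kappa> s) C))"

end

(*
  Write pi_t for the tilted density e^(t x) p(x) / Phi(t) with mean a = m(t), and f^(k) for k-fold
  convolution powers.  Tilting commutes with convolution, so the conditional density of X_1 given
  S_n = n a is pi_t(x) pi_t^(n-1)(n a - x) / pi_t^(n)(n a), and it suffices that the last quotient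
  is close to 1.

  Beyond some x0 the density p is exp(-g) up to a bounded factor, and g is convex because h is
  eventually increasing.  Hence, for large t, pi_t lies below C' e^(-|x - x*| / (K w)) / w and above
  1 / (C' w) on an interval of length w, where x* is the mode of exp(t x - g(x)), w is the width of
  the level set within 1 of the maximum, and C', K do not depend on t.  So all standardised tilted
  densities lie below one envelope C e^(-kappa |y|).

  For standardised densities below a fixed envelope the local limit theorem is uniform: near 0 the
  characteristic function phi is controlled by the third moment, away from 0 it is bounded by some
  rho < 1, and |phi|^2 is integrable by Plancherel's inequality; Fourier inversion then yields
  |f^(n-1)(-y) / f^(n)(0) - 1| <= e_n (1 + |y|) with e_n -> 0.  Integrating this against the
  tilted density bounds the total variation distance by 2 e_n.
*)

theory Submission
  imports Defs "HOL-Real_Asymp.Real_Asymp"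
begin

section \<open>Convolution powers of bounded densities\<close>

text \<open>The tilt \<open>t n\<close> moves to infinity, so the density changes with
  \<open>n\<close> and a local limit theorem for one fixed density says nothing here; every estimate
  may see the density only through the pair (C, \<kappa>) of its envelope. The bound \<rho> < 1 away
  from 0 therefore has to be quantitative, and it is extracted from Plancherel's inequality, which
  involves only C. The linear factor 1 + |y| appears because the two inversion integrals are
  subtracted before being estimated: a common power of phi multiplies e^(iuy) - phi(u), which is at
  most (1 + |y|) |u|. The extra |u| gains an order 1/sqrt(m), so the numerator needs no expansion of
  its own; the Gaussian comparison is made only at 0, to keep the denominator away from 0, and the
  linear growth is harmless since standardised densities have first absolute moment at most 1.
  Convexity of g is available only beyond x0. Below x0 the tilted density is dominated through the
  bound of p and the monotonicity of e^(t x). At least three convolution factors are always present,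
  because the pointwise inversion formula is proved from three factors on.\<close>

locale bounded_density =
  fixes f :: "real \<Rightarrow> real" and B :: real
  assumes measurable [measurable]: "f \<in> borel_measurable borel"
    and nonneg: "0 \<le> f x"
    and bounded: "f x \<le> B"
    and total: "(LINT x|lborel. f x) = 1"
begin

lemma integrable: "integrable lborel f"
  using total not_integrable_integral_eq by fastforce

lemma real_distribution: "real_distribution (density lborel (\<lambda>x. ennreal (f x)))"
proof -
  have "(\<integral>\<^sup>+x. ennreal (f x) \<partial>lborel) = 1"
    using nn_integral_eq_integral[OF integrable] nonneg total by simp
  then show ?thesis
    by (auto simp: real_distribution_def real_distribution_axioms_def emeasure_density
        intro!: prob_spaceI)
qed

lemma integral_density:
  fixes g :: "real \<Rightarrow> 'b::{banach, second_countable_topology}"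
  assumes "g \<in> borel_measurable borel"
  shows "(LINT x|density lborel (\<lambda>x. ennreal (f x)). g x) = (LINT x|lborel. f x *\<^sub>R g x)"
  using assms by (intro Bochner_Integration.integral_density) (auto simp: nonneg)

lemma char_eq: "char (density lborel (\<lambda>x. ennreal (f x))) u = (CLINT x|lborel. f x * iexp (u * x))"
  unfolding char_def by (subst integral_density) (auto simp: scaleR_conv_of_real)

lemma bound_nonneg: "0 \<le> B"
  using nonneg[of 0] bounded[of 0] by simp

lemma integrable_mult_bounded:
  fixes g :: "real \<Rightarrow> real"
  assumes "integrable lborel g"
  shows "integrable lborel (\<lambda>x. f (y - x) * g x)"
proof (rule Bochner_Integration.integrable_bound)
  show "integrable lborel (\<lambda>x. B * g x)"
    using assms by simp
  show "AE x in lborel. norm (f (y - x) * g x) \<le> norm (B * g x)"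
    using nonneg bounded bound_nonneg by (auto simp: abs_mult intro!: mult_right_mono)
qed (use assms in auto)

end

definition conv :: "(real \<Rightarrow> real) \<Rightarrow> (real \<Rightarrow> real) \<Rightarrow> real \<Rightarrow> real" where
  "conv f g y = (LINT x|lborel. f (y - x) * g x)"

text \<open>\<open>conv_pow f k\<close> is the convolution of \<open>k + 1\<close> copies of \<open>f\<close>.\<close>

primrec conv_pow :: "(real \<Rightarrow> real) \<Rightarrow> nat \<Rightarrow> real \<Rightarrow> real" where
  "conv_pow f 0 = f"
| "conv_pow f (Suc k) = conv (conv_pow f k) f"

lemma conv_measurable:
  assumes [measurable]: "f \<in> borel_measurable borel" "g \<in> borel_measurable borel"
  shows "conv f g \<in> borel_measurable borel"
  unfolding conv_def[abs_def] by measurable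

lemma ennreal_conv:
  assumes "bounded_density f B" "bounded_density g C"
  shows "ennreal (conv f g y) = (\<integral>\<^sup>+x. ennreal (f (y - x)) * ennreal (g x) \<partial>lborel)"
proof -
  interpret f: bounded_density f B by fact
  interpret g: bounded_density g C by fact
  show ?thesis
    unfolding conv_def
    by (subst nn_integral_eq_integral[symmetric])
       (auto simp: f.integrable_mult_bounded g.integrable f.nonneg g.nonneg ennreal_mult)
qed

lemma density_conv:
  assumes "bounded_density f B" "bounded_density g C"
  shows "density lborel (\<lambda>y. ennreal (conv f g y)) =
    (density lborel (\<lambda>x. ennreal (f x)) \<star> density lborel (\<lambda>x. ennreal (g x)))"
proof -
  interpret f: bounded_density f B by fact
  interpret g: bounded_density g C by fact
  interpret F: real_distribution "density lborel (\<lambda>x. ennreal (f x))" by (rule f.real_distribution)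
  interpret G: real_distribution "density lborel (\<lambda>x. ennreal (g x))" by (rule g.real_distribution)
  show ?thesis
    unfolding ennreal_conv[OF assms]
    by (rule convolution_density[symmetric]) (auto intro: F.finite_measure_axioms G.finite_measure_axioms)
qed

text \<open>The second factor has total mass 1, so averaging preserves the bound of the first. Hence
  all convolution powers of \<open>f\<close> share the bound of \<open>f\<close>.\<close>

lemma bounded_density_conv:
  assumes "bounded_density f B" "bounded_density g C"
  shows "bounded_density (conv f g) B"
proof -
  interpret f: bounded_density f B by fact
  interpret g: bounded_density g C by fact
  interpret F: real_distribution "density lborel (\<lambda>x. ennreal (f x))" by (rule f.real_distribution)
  interpret G: real_distribution "density lborel (\<lambda>x. ennreal (g x))" by (rule g.real_distribution)
  have [measurable]: "conv f g \<in> borel_measurable borel"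
    by (rule conv_measurable) auto
  have nonneg: "0 \<le> conv f g y" for y
    unfolding conv_def by (intro integral_nonneg_AE AE_I2 mult_nonneg_nonneg f.nonneg g.nonneg)
  have "prob_space (density lborel (\<lambda>y. ennreal (conv f g y)))"
    unfolding ennreal_conv[OF assms]
    by (rule prob_space_convolution_density)
      (auto intro: f.nonneg g.nonneg F.prob_space_axioms G.prob_space_axioms)
  then have "(\<integral>\<^sup>+y. ennreal (conv f g y) \<partial>lborel) = 1"
    using prob_space.emeasure_space_1 by (fastforce simp: emeasure_density)
  then have "(LINT y|lborel. conv f g y) = 1"
    using nonneg by (subst integral_eq_nn_integral) auto
  moreover have "conv f g y \<le> B" for y
  proof -
    have "conv f g y \<le> (LINT x|lborel. B * g x)"
      unfolding conv_def using g.integrable f.bounded g.nonneg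
      by (intro integral_mono f.integrable_mult_bounded) (auto intro: mult_right_mono)
    then show ?thesis
      using g.total by simp
  qed
  ultimately show ?thesis
    using nonneg by unfold_locales auto
qed

section \<open>Characteristic functions of convolutions and reflections\<close>

lemma char_convolution:
  assumes "real_distribution M" "real_distribution N"
  shows "char (M \<star> N) u = char M u * char N u"
proof -
  interpret M: real_distribution M by fact
  interpret N: real_distribution N by fact
  interpret P: pair_prob_space M N ..
  have [measurable_cong]: "sets (M \<Otimes>\<^sub>M N) = sets (borel \<Otimes>\<^sub>M borel)"
    by (intro sets_pair_measure_cong) auto
  have "char (M \<star> N) u = (CLINT z|M \<Otimes>\<^sub>M N. iexp (u * (fst z + snd z)))"
    unfolding char_def convolution_def
    by (subst integral_distr) (auto simp: split_beta)
  also have "\<dots> = (CLINT x|M. CLINT y|N. iexp (u * (fst (x, y) + snd (x, y))))"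
    by (rule P.integral_fst'[symmetric])
       (auto intro!: P.integrable_const_bound[where B=1])
  also have "\<dots> = (CLINT x|M. iexp (u * x) * char N u)"
    unfolding char_def by (simp add: distrib_left exp_add)
  finally show ?thesis
    by (simp add: char_def)
qed

lemma char_conv:
  assumes "bounded_density f B" "bounded_density g C"
  shows "char (density lborel (\<lambda>x. ennreal (conv f g x))) u =
    char (density lborel (\<lambda>x. ennreal (f x))) u * char (density lborel (\<lambda>x. ennreal (g x))) u"
  unfolding density_conv[OF assms]
  using assms by (intro char_convolution bounded_density.real_distribution)

lemma bounded_density_conv_pow:
  "bounded_density f B \<Longrightarrow> bounded_density (conv_pow f k) B"
  by (induction k) (auto intro: bounded_density_conv)

lemma char_conv_pow:
  assumes "bounded_density f B"
  shows "char (density lborel (\<lambda>x. ennreal (conv_pow f k x))) u =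
    char (density lborel (\<lambda>x. ennreal (f x))) u ^ Suc k"
  by (induction k) (auto simp: char_conv[OF bounded_density_conv_pow[OF assms] assms])

lemma bounded_density_reflect:
  assumes "bounded_density f B"
  shows "bounded_density (\<lambda>x. f (- x)) B"
proof -
  interpret bounded_density f B by fact
  show ?thesis
    using lborel_integral_real_affine[of "-1" f 0] total
    by unfold_locales (auto simp: nonneg bounded)
qed

lemma char_reflect:
  assumes "bounded_density f B"
  shows "char (density lborel (\<lambda>x. ennreal (f (- x)))) u = cnj (char (density lborel (\<lambda>x. ennreal (f x))) u)"
proof -
  have "char (density lborel (\<lambda>x. ennreal (f (- x)))) u = (CLINT x|lborel. f (- x) * iexp (u * x))"
    by (rule bounded_density.char_eq[OF bounded_density_reflect[OF assms]])
  also have "\<dots> = (CLINT x|lborel. cnj (f x * iexp (u * x)))"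
    using lborel_integral_real_affine[of "-1" "\<lambda>x. f (- x) * iexp (u * x)" 0]
    by (simp add: exp_cnj)
  finally show ?thesis
    unfolding bounded_density.char_eq[OF assms]
    by (rule trans) (rule integral_bounded_linear'[OF bounded_linear_cnj bounded_linear_cnj], simp)
qed

text \<open>Plancherel's inequality: the autocorrelation of \<open>f\<close> has transform \<open>\<bar>\<phi>\<bar>\<^sup>2\<close>, and integrating
  that against a centred Gaussian of small variance bounds its integral by \<open>2 \<pi> B\<close>.\<close>

lemma gaussian_plancherel:
  assumes "bounded_density f B" and "0 < r"
  defines "\<phi> \<equiv> char (density lborel (\<lambda>x. ennreal (f x)))"
  shows "(\<integral>\<^sup>+u. ennreal ((cmod (\<phi> u))\<^sup>2 * exp (- (u / r)\<^sup>2 / 2)) \<partial>lborel) \<le> ennreal (2 * pi * B)"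
proof -
  interpret f: bounded_density f B by fact
  define h where "h = conv f (\<lambda>x. f (- x))"
  have "bounded_density h B"
    unfolding h_def by (rule bounded_density_conv[OF assms(1) bounded_density_reflect[OF assms(1)]])
  then interpret h: bounded_density h B .
  define H where "H = density lborel (\<lambda>x. ennreal (h x))"
  interpret H: real_distribution H unfolding H_def by (rule h.real_distribution)
  define N where "N = density lborel (\<lambda>x. ennreal (std_normal_density x))"
  interpret N: real_distribution N unfolding N_def by (rule real_dist_normal_dist)
  interpret P: pair_prob_space H N ..
  have setsHN[measurable_cong]: "sets (H \<Otimes>\<^sub>M N) = sets (borel \<Otimes>\<^sub>M borel)"
    by (intro sets_pair_measure_cong) auto
  have \<phi>_meas[measurable]: "\<phi> \<in> borel_measurable borel"
    unfolding \<phi>_def by (rule real_distribution.char_measurable[OF f.real_distribution])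
  have charH: "char H u = complex_of_real ((cmod (\<phi> u))\<^sup>2)" for u
    unfolding H_def h_def \<phi>_def complex_norm_square
    by (simp add: char_conv[OF assms(1) bounded_density_reflect[OF assms(1)]] char_reflect[OF assms(1)])
  have le1: "cmod (\<phi> u) \<le> 1" for u
    unfolding \<phi>_def by (rule real_distribution.cmod_char_le_1[OF f.real_distribution])
  \<comment> \<open>Parseval by Fubini: integrating the kernel \<open>iexp (r * u * x)\<close> first
    over \<open>H\<close> gives the left side, first over \<open>N\<close> the right side.\<close>
  have eq: "complex_of_real (LINT u|N. (cmod (\<phi> (r * u)))\<^sup>2) = complex_of_real (LINT x|H. exp (- (r * x)\<^sup>2 / 2))"
  proof -
    have "complex_of_real (LINT u|N. (cmod (\<phi> (r * u)))\<^sup>2) = (CLINT u|N. char H (r * u))"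
      by (simp add: charH del: of_real_power)
    also have "\<dots> = (CLINT u|N. CLINT x|H. iexp (r * u * x))"
      by (simp add: char_def)
    also have "\<dots> = (CLINT x|H. CLINT u|N. iexp (r * u * x))"
      by (rule P.Fubini_integral) (auto intro!: P.integrable_const_bound[where B=1] simp: split_beta)
    also have "\<dots> = (CLINT x|H. char N (r * x))"
      by (simp add: char_def mult_ac)
    also have "\<dots> = complex_of_real (LINT x|H. exp (- (r * x)\<^sup>2 / 2))"
      by (simp add: N_def char_std_normal_distribution)
    finally show ?thesis .
  qed
  have gauss: "(LINT x|lborel. exp (- (r * x)\<^sup>2 / 2)) = sqrt (2 * pi) / r"
  proof -
    have 1: "(LINT x|lborel. std_normal_density x) = 1"
      using integral_std_normal_moment_even[of 0] by simp
    have "(LINT x|lborel. std_normal_density x) = \<bar>r\<bar> *\<^sub>R (LINT x|lborel. std_normal_density (0 + r * x))"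
      using \<open>0 < r\<close> by (intro lborel_integral_real_affine) auto
    also have "\<dots> = r / sqrt (2 * pi) * (LINT x|lborel. exp (- (r * x)\<^sup>2 / 2))"
      using \<open>0 < r\<close> by (simp add: std_normal_density_def)
    finally show ?thesis
      using 1 \<open>0 < r\<close> by (simp add: field_simps)
  qed
  have gauss_int: "integrable lborel (\<lambda>x. exp (- (r * x)\<^sup>2 / 2))"
    using gauss \<open>0 < r\<close> not_integrable_integral_eq by fastforce
  have "(LINT u|N. (cmod (\<phi> (r * u)))\<^sup>2) = (LINT x|lborel. h x * exp (- (r * x)\<^sup>2 / 2))"
    using eq by (simp add: H_def h.integral_density)
  also have "\<dots> \<le> (LINT x|lborel. B * exp (- (r * x)\<^sup>2 / 2))"
  proof (rule integral_mono)
    show "integrable lborel (\<lambda>x. h x * exp (- (r * x)\<^sup>2 / 2))"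
      by (rule Bochner_Integration.integrable_bound[OF h.integrable])
         (auto simp: h.nonneg mult_left_le)
  qed (use gauss_int h.bounded in \<open>auto intro: mult_right_mono\<close>)
  also have "\<dots> = B * sqrt (2 * pi) / r"
    unfolding integral_mult_right_zero gauss by simp
  finally have "(LINT u|N. (cmod (\<phi> (r * u)))\<^sup>2) \<le> B * sqrt (2 * pi) / r" .
  then have "(\<integral>\<^sup>+u. ennreal ((cmod (\<phi> (r * u)))\<^sup>2) \<partial>N) \<le> ennreal (B * sqrt (2 * pi) / r)"
    by (subst nn_integral_eq_integral)
       (auto intro!: N.integrable_const_bound[where B=1] ennreal_leI simp: le1 power_le_one)
  then have *: "(\<integral>\<^sup>+u. ennreal (std_normal_density u * (cmod (\<phi> (r * u)))\<^sup>2) \<partial>lborel) \<le> ennreal (B * sqrt (2 * pi) / r)"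
    unfolding N_def by (subst (asm) nn_integral_density) (auto simp: ennreal_mult normal_density_nonneg)
  have "(\<integral>\<^sup>+u. ennreal ((cmod (\<phi> u))\<^sup>2 * exp (- (u / r)\<^sup>2 / 2)) \<partial>lborel)
     = ennreal r * (\<integral>\<^sup>+u. ennreal ((cmod (\<phi> (r * u)))\<^sup>2 * exp (- u\<^sup>2 / 2)) \<partial>lborel)"
    using \<open>0 < r\<close> by (subst nn_integral_real_affine[where c=r and t=0]) auto
  also have "\<dots> = ennreal r * (\<integral>\<^sup>+u. ennreal (sqrt (2 * pi)) * ennreal (std_normal_density u * (cmod (\<phi> (r * u)))\<^sup>2) \<partial>lborel)"
    by (intro arg_cong[where f="\<lambda>x. ennreal r * x"] nn_integral_cong)
       (simp add: ennreal_mult[symmetric] normal_density_nonneg std_normal_density_def field_simps)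
  also have "\<dots> = ennreal r * (ennreal (sqrt (2 * pi)) * (\<integral>\<^sup>+u. ennreal (std_normal_density u * (cmod (\<phi> (r * u)))\<^sup>2) \<partial>lborel))"
    by (subst nn_integral_cmult) auto
  also have "\<dots> \<le> ennreal r * (ennreal (sqrt (2 * pi)) * ennreal (B * sqrt (2 * pi) / r))"
    by (intro mult_left_mono *) auto
  also have "\<dots> = ennreal (r * (sqrt (2 * pi) * (B * sqrt (2 * pi) / r)))"
    using \<open>0 < r\<close> f.bound_nonneg by (simp add: ennreal_mult[symmetric])
  also have "r * (sqrt (2 * pi) * (B * sqrt (2 * pi) / r)) = 2 * pi * B"
    using \<open>0 < r\<close> by (simp add: field_simps)
  finally show ?thesis .
qed

text \<open>The Gaussian bound does not depend on \<open>r\<close>. Along r = 1, 2, ... the weight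
  tends to 1 pointwise, and Fatou's lemma carries the bound to the limit.\<close>

lemma plancherel:
  assumes "bounded_density f B"
  defines "\<phi> \<equiv> char (density lborel (\<lambda>x. ennreal (f x)))"
  shows "integrable lborel (\<lambda>u. (cmod (\<phi> u))\<^sup>2)" and "(LINT u|lborel. (cmod (\<phi> u))\<^sup>2) \<le> 2 * pi * B"
proof -
  interpret f: bounded_density f B by fact
  have \<phi>_meas[measurable]: "\<phi> \<in> borel_measurable borel"
    unfolding \<phi>_def by (rule real_distribution.char_measurable[OF f.real_distribution])
  let ?g = "\<lambda>n u. ennreal ((cmod (\<phi> u))\<^sup>2 * exp (- (u / real (Suc n))\<^sup>2 / 2))"
  have lim: "(\<lambda>n. ?g n u) \<longlonglongrightarrow> ennreal ((cmod (\<phi> u))\<^sup>2)" for u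
  proof -
    have "(\<lambda>n. u / real (Suc n)) \<longlonglongrightarrow> 0"
      by (rule LIMSEQ_Suc[of "\<lambda>n. u / real n"]) (rule lim_const_over_n)
    then have "(\<lambda>n. (cmod (\<phi> u))\<^sup>2 * exp (- (u / real (Suc n))\<^sup>2 / 2)) \<longlonglongrightarrow> (cmod (\<phi> u))\<^sup>2 * exp (- 0\<^sup>2 / 2)"
      by (intro tendsto_intros) auto
    then show ?thesis
      by (intro tendsto_ennrealI) simp
  qed
  have "(\<integral>\<^sup>+u. ennreal ((cmod (\<phi> u))\<^sup>2) \<partial>lborel) = (\<integral>\<^sup>+u. liminf (\<lambda>n. ?g n u) \<partial>lborel)"
    using lim_imp_Liminf[OF _ lim] by simp
  also have "\<dots> \<le> liminf (\<lambda>n. \<integral>\<^sup>+u. ?g n u \<partial>lborel)"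
    by (rule nn_integral_liminf) auto
  also have "\<dots> \<le> liminf (\<lambda>n. ennreal (2 * pi * B))"
    using gaussian_plancherel[OF assms(1)] unfolding \<phi>_def
    by (intro Liminf_mono always_eventually) auto
  finally have *: "(\<integral>\<^sup>+u. ennreal ((cmod (\<phi> u))\<^sup>2) \<partial>lborel) \<le> ennreal (2 * pi * B)"
    by (simp add: Liminf_const)
  show int: "integrable lborel (\<lambda>u. (cmod (\<phi> u))\<^sup>2)"
    using * le_less_trans[OF *] by (intro integrableI_nonneg) auto
  show "(LINT u|lborel. (cmod (\<phi> u))\<^sup>2) \<le> 2 * pi * B"
    using * f.bound_nonneg by (subst (asm) nn_integral_eq_integral[OF int]) (auto simp: ennreal_le_iff)
qed

section \<open>Fourier inversion\<close>

lemma (in pair_sigma_finite) integrable_fst_times_snd: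
  fixes f :: "'a \<Rightarrow> real" and g :: "'b \<Rightarrow> real"
  assumes "integrable M1 f" "integrable M2 g"
  shows "integrable (M1 \<Otimes>\<^sub>M M2) (\<lambda>(x, y). f x * g y)"
  using assms by (intro Fubini_integrable) (auto simp: abs_mult)

text \<open>The Fourier inversion integral. Taking the real part yields a real function without
  first showing that the integral is real.\<close>

definition inverse_char :: "(real \<Rightarrow> complex) \<Rightarrow> real \<Rightarrow> real" where
  "inverse_char \<phi> y = Re (CLINT u|lborel. iexp (- (u * y)) * \<phi> u) / (2 * pi)"

lemma isCont_iexp_integral:
  assumes "integrable lborel \<phi>"
  shows "isCont (\<lambda>y. CLINT u|lborel. iexp (- (u * y)) * \<phi> u) y"
  unfolding continuous_at_sequentially
proof safe
  fix X assume X: "X \<longlonglongrightarrow> y"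
  have [measurable]: "\<phi> \<in> borel_measurable borel"
    using assms by (simp add: integrable_iff_bounded)
  show "((\<lambda>y. CLINT u|lborel. iexp (- (u * y)) * \<phi> u) \<circ> X) \<longlonglongrightarrow> (CLINT u|lborel. iexp (- (u * y)) * \<phi> u)"
    unfolding comp_def using assms
    by (intro integral_dominated_convergence[where w="\<lambda>u. cmod (\<phi> u)"] AE_I2 tendsto_intros X)
       (auto simp: norm_mult)
qed

lemma isCont_inverse_char: "integrable lborel \<phi> \<Longrightarrow> isCont (inverse_char \<phi>) y"
  unfolding inverse_char_def[abs_def] by (intro isCont_divide isCont_Re isCont_iexp_integral continuous_const) auto

lemma inverse_char_measurable:
  "integrable lborel \<phi> \<Longrightarrow> inverse_char \<phi> \<in> borel_measurable borel"
  by (intro borel_measurable_continuous_onI continuous_at_imp_continuous_on ballI isCont_inverse_char)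

text \<open>The right-hand side is the kernel of Levy's inversion formula; seeing it as an integral
  over \<open>{a..b}\<close> is what lets Fubini produce a density.\<close>

lemma integral_iexp_Icc:
  assumes "a \<le> b" and "t \<noteq> 0"
  shows "(CLINT y|lborel. indicator {a..b} y * iexp (- (t * y))) =
    (iexp (- (t * a)) - iexp (- (t * b))) / (\<i> * t)"
proof -
  have "(CLINT y|lborel. indicator {a..b} y *\<^sub>R iexp (- (t * y))) =
      - (iexp (- (t * b)) / (\<i> * t)) - - (iexp (- (t * a)) / (\<i> * t))"
  proof (rule integral_FTC_Icc)
    fix y
    have "((\<lambda>z. - (exp (\<i> * - (t * z)) / (\<i> * t))) has_field_derivative exp (\<i> * - (t * complex_of_real y))) (at (of_real y))"
      using assms by (auto intro!: derivative_eq_intros simp: field_simps)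
    from has_vector_derivative_real_field[OF this]
    show "((\<lambda>y. - (iexp (- (t * y)) / (\<i> * t))) has_vector_derivative iexp (- (t * y))) (at y within {a..b})"
      by simp
  qed (use assms in \<open>auto intro!: continuous_intros\<close>)
  then show ?thesis
    by (simp add: scaleR_conv_of_real of_real_indicator diff_divide_distrib)
qed

text \<open>Levy's formula is a limit of truncated integrals. Its kernel is bounded by
  \<open>b - a\<close>, so integrability of \<open>char M\<close> removes the truncation by
  dominated convergence, and Fubini then moves the integral over \<open>{a..b}\<close> to the
  outside.\<close>

lemma levy_inversion_integrable:
  assumes "real_distribution M" and int: "integrable lborel (char M)"
    and "a \<le> b" and "measure M {a} = 0" "measure M {b} = 0"
  shows "measure M {a<..b} = (LINT y|lborel. indicator {a..b} y * inverse_char (char M) y)"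
proof -
  interpret real_distribution M by fact
  have [measurable]: "char M \<in> borel_measurable borel"
    by simp
  define F where "F = (\<lambda>t. (iexp (- (t * a)) - iexp (- (t * b))) / (\<i> * complex_of_real t))"
  have [measurable]: "F \<in> borel_measurable borel"
    unfolding F_def by measurable
  have F_le: "cmod (F t) \<le> b - a" if "t \<noteq> 0" for t
    using Levy_Inversion_aux2[of "- b" "- a" t] \<open>a \<le> b\<close> that by (simp add: F_def)
  have AE0: "AE t in lborel. t \<noteq> (0::real)"
    by (rule AE_lborel_singleton)
  have "(\<lambda>n. CLINT t|lborel. indicat_real {- real n<..<real n} t *\<^sub>R (F t * char M t)) \<longlonglongrightarrow> (CLINT t|lborel. F t * char M t)"
  proof (rule integral_dominated_convergence[where w="\<lambda>t. (b - a) * cmod (char M t)"])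
    show "integrable lborel (\<lambda>t. (b - a) * cmod (char M t))"
      using int by simp
    show "AE t in lborel. (\<lambda>n. indicat_real {- real n<..<real n} t *\<^sub>R (F t * char M t)) \<longlonglongrightarrow> F t * char M t"
    proof (rule AE_I2)
      fix t :: real
      obtain N where N: "\<bar>t\<bar> < real N" using reals_Archimedean2 by blast
      have "\<forall>\<^sub>F n in sequentially. indicat_real {- real n<..<real n} t *\<^sub>R (F t * char M t) = F t * char M t"
        using eventually_ge_at_top[of N] by eventually_elim (use N in \<open>auto simp: indicator_def\<close>)
      then show "(\<lambda>n. indicat_real {- real n<..<real n} t *\<^sub>R (F t * char M t)) \<longlonglongrightarrow> F t * char M t"
        by (rule tendsto_eventually)
    qed
    show "AE t in lborel. norm (indicat_real {- real n<..<real n} t *\<^sub>R (F t * char M t)) \<le> (b - a) * cmod (char M t)" for n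
      using AE0
    proof eventually_elim
      case (elim t)
      have "cmod (F t) * cmod (char M t) \<le> (b - a) * cmod (char M t)"
        using F_le[OF elim] by (rule mult_right_mono) simp
      then show ?case
        using \<open>a \<le> b\<close> by (auto simp: norm_mult indicator_def)
    qed
  qed auto
  then have "(\<lambda>T::nat. CLBINT t=ereal (- real T)..ereal (real T). F t * char M t) \<longlonglongrightarrow> (CLINT t|lborel. F t * char M t)"
    by (simp add: interval_lebesgue_integral_def set_lebesgue_integral_def)
  then have "(\<lambda>T::nat. 1 / (2 * pi) * (CLBINT t=ereal (- real T)..ereal (real T). F t * char M t)) \<longlonglongrightarrow> 1 / (2 * pi) * (CLINT t|lborel. F t * char M t)"
    by (intro tendsto_intros)
  moreover have "(\<lambda>T::nat. 1 / (2 * pi) * (CLBINT t=ereal (- real T)..ereal (real T). F t * char M t)) \<longlonglongrightarrow> complex_of_real (measure M {a<..b})"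
    using Levy_Inversion[OF \<open>a \<le> b\<close> assms(4,5)] by (simp add: F_def)
  ultimately have "complex_of_real (measure M {a<..b}) = 1 / (2 * pi) * (CLINT t|lborel. F t * char M t)"
    by (rule LIMSEQ_unique[rotated])
  also have "(CLINT t|lborel. F t * char M t) = (CLINT t|lborel. CLINT y|lborel. indicator {a..b} y * iexp (- (t * y)) * char M t)"
  proof (rule integral_cong_AE)
    show "AE t in lborel. F t * char M t = (CLINT y|lborel. indicator {a..b} y * iexp (- (t * y)) * char M t)"
      using AE0
    proof eventually_elim
      case (elim t)
      show ?case
        by (simp only: F_def integral_mult_left_zero integral_iexp_Icc[OF \<open>a \<le> b\<close> elim])
    qed
  qed measurable
  also have "\<dots> = (CLINT y|lborel. CLINT t|lborel. indicator {a..b} y * iexp (- (t * y)) * char M t)"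
  proof (rule lborel_pair.Fubini_integral)
    have "integrable (lborel \<Otimes>\<^sub>M lborel) (\<lambda>(y, t). indicat_real {a..b} y * cmod (char M t))"
      using int \<open>a \<le> b\<close>
      by (intro lborel_pair.integrable_fst_times_snd integrable_real_indicator) (auto simp: emeasure_lborel_Icc)
    then show "integrable (lborel \<Otimes>\<^sub>M lborel) (\<lambda>(y, t). indicator {a..b} y * iexp (- (t * y)) * char M t)"
      by (rule Bochner_Integration.integrable_bound) (auto simp: norm_mult indicator_def)
  qed
  also have "\<dots> = (CLINT y|lborel. indicator {a..b} y * (CLINT t|lborel. iexp (- (t * y)) * char M t))"
    by (simp add: mult.assoc)
  finally have *: "complex_of_real (measure M {a<..b}) = complex_of_real (1 / (2 * pi)) * \<dots>"
    by simp
  have "integrable lborel (\<lambda>y. indicator {a..b} y * (CLINT t|lborel. iexp (- (t * y)) * char M t))"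
    using borel_integrable_compact[OF compact_Icc continuous_at_imp_continuous_on, of a b "\<lambda>y. CLINT t|lborel. iexp (- (t * y)) * char M t"]
      isCont_iexp_integral[OF int]
    by (simp add: scaleR_conv_of_real of_real_indicator)
  from integral_Re[OF this]
  have "Re (CLINT y|lborel. indicator {a..b} y * (CLINT t|lborel. iexp (- (t * y)) * char M t)) =
      (LINT y|lborel. Re (indicator {a..b} y * (CLINT t|lborel. iexp (- (t * y)) * char M t)))"
    by (rule sym)
  also have "\<dots> = (LINT y|lborel. 2 * pi * (indicator {a..b} y * inverse_char (char M) y))"
    by (intro Bochner_Integration.integral_cong refl) (simp add: inverse_char_def indicator_def)
  finally have "Re (CLINT y|lborel. indicator {a..b} y * (CLINT t|lborel. iexp (- (t * y)) * char M t)) =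
      2 * pi * (LINT y|lborel. indicator {a..b} y * inverse_char (char M) y)"
    by (simp only: integral_mult_right_zero)
  then show ?thesis
    using arg_cong[OF *, of Re] by (simp only: times_complex.sel Re_complex_of_real Im_complex_of_real) simp
qed

text \<open>Levy inversion makes the laws with densities \<open>f\<close> and
  \<open>inverse_char \<phi>\<close> agree on half-open intervals, which generate the Borel sets;
  densities of equal measures agree almost everywhere.\<close>

lemma inverse_char_AE:
  assumes "bounded_density f B"
  defines "\<phi> \<equiv> char (density lborel (\<lambda>x. ennreal (f x)))"
  assumes int: "integrable lborel \<phi>"
  shows "AE y in lborel. f y = inverse_char \<phi> y"
proof -
  interpret f: bounded_density f B by fact
  define M where "M = density lborel (\<lambda>x. ennreal (f x))"
  interpret real_distribution M unfolding M_def by (rule f.real_distribution)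
  have [measurable]: "inverse_char \<phi> \<in> borel_measurable borel"
    by (rule inverse_char_measurable[OF int])
  define r where "r = inverse_char \<phi>"
  have [measurable]: "r \<in> borel_measurable borel" by (simp add: r_def)
  have r_cont: "isCont r y" for y
    unfolding r_def by (rule isCont_inverse_char[OF int])
  have single: "measure M {x} = 0" for x
  proof -
    have "AE y in lborel. y \<in> {x} \<longrightarrow> ennreal (f y) = 0"
      using AE_lborel_singleton[of x] by eventually_elim simp
    then show ?thesis
      unfolding M_def by (intro measure_eq_0_null_sets) (subst null_sets_density_iff; simp)
  qed
  have meas: "measure M {a<..b} = (LINT y|lborel. indicator {a..b} y * r y)" if "a \<le> b" for a b
    unfolding r_def \<phi>_def M_def[symmetric]
    using levy_inversion_integrable[OF real_distribution_axioms _ that single single] int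
    by (simp add: \<phi>_def M_def)
  have int_r: "integrable lborel (\<lambda>y. indicator {a..b} y * r y)" for a b
    using borel_integrable_compact[OF compact_Icc continuous_at_imp_continuous_on, of a b r] r_cont
    by (simp add: indicator_def if_distrib cong: if_cong)
  \<comment> \<open>\<open>ennreal\<close> would cut off negative values of \<open>r\<close>, so its
    sign must be settled first. By continuity a negative value would give some short interval
    negative mass.\<close>
  have r_nonneg: "0 \<le> r y" for y
  proof (rule ccontr)
    assume "\<not> 0 \<le> r y"
    then have "r y < 0" by simp
    have "\<forall>\<^sub>F x in at y. r x < r y / 2"
      using r_cont[of y] \<open>r y < 0\<close> by (intro order_tendstoD(2)[where y="r y"]) (auto simp: isCont_def)
    then obtain d where "d > 0" and d: "\<And>x. x \<noteq> y \<Longrightarrow> dist x y < d \<Longrightarrow> r x < r y / 2"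
      unfolding eventually_at by auto
    have "0 \<le> measure M {y<..y + d/2}" by simp
    also have "\<dots> = (LINT x|lborel. indicator {y..y + d/2} x * r x)"
      using \<open>d > 0\<close> by (intro meas) auto
    also have "\<dots> \<le> (LINT x|lborel. indicator {y..y + d/2} x * (r y / 2))"
    proof (rule integral_mono[OF int_r])
      fix x
      show "indicator {y..y + d/2} x * r x \<le> indicator {y..y + d/2} x * (r y / 2)"
        using d[of x] \<open>d > 0\<close> \<open>r y < 0\<close> by (cases "x = y") (auto simp: indicator_def dist_real_def)
    qed (intro integrable_mult_left integrable_real_indicator; use \<open>d > 0\<close> in \<open>simp add: emeasure_lborel_Icc\<close>)
    also have "\<dots> = d / 2 * (r y / 2)"
      using \<open>d > 0\<close> by simp
    also have "\<dots> < 0"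
      using \<open>d > 0\<close> \<open>r y < 0\<close> by (simp add: mult_pos_neg)
    finally show False by simp
  qed
  have eq: "emeasure M {a<..b} = emeasure (density lborel (\<lambda>x. ennreal (r x))) {a<..b}" for a b
  proof (cases "a \<le> b")
    case True
    have "emeasure (density lborel (\<lambda>x. ennreal (r x))) {a<..b} = (\<integral>\<^sup>+x. ennreal (r x) * indicator {a<..b} x \<partial>lborel)"
      by (simp add: emeasure_density)
    also have "\<dots> = (\<integral>\<^sup>+x. ennreal (indicator {a..b} x * r x) \<partial>lborel)"
      using AE_lborel_singleton[of a] by (intro nn_integral_cong_AE) (auto simp: indicator_def)
    also have "\<dots> = ennreal (measure M {a<..b})"
      by (simp add: meas[OF True] nn_integral_eq_integral[OF int_r] r_nonneg)
    finally show ?thesis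
      by (simp add: emeasure_eq_measure)
  qed simp
  have "M = density lborel (\<lambda>x. ennreal (r x))"
  proof (rule measure_eqI_generator_eq[where \<Omega>=UNIV])
    show "X \<in> range (\<lambda>(a, b). {a<..b::real}) \<Longrightarrow> emeasure M X = emeasure (density lborel (\<lambda>x. ennreal (r x))) X" for X
      by (auto simp: eq)
  next
    show "(\<Union>i. {- real (i::nat)<..real i}) = UNIV"
      by (rule UN_Ioc_eq_UNIV)
  qed (auto simp: borel_sigma_sets_Ioc Int_stable_def emeasure_eq_measure)
  then have "AE x in lborel. ennreal (f x) = ennreal (r x)"
    unfolding M_def by (intro sigma_finite_measure.density_unique) (auto intro: lborel.sigma_finite_measure_axioms)
  then show ?thesis
    by eventually_elim (simp add: f.nonneg r_nonneg r_def[symmetric])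
qed

text \<open>One more convolution factor upgrades the almost everywhere inversion formula to a pointwise one.\<close>

lemma conv_pow_inverse_char:
  assumes "bounded_density f B" and "2 \<le> k"
  defines "\<phi> \<equiv> char (density lborel (\<lambda>x. ennreal (f x)))"
  shows "integrable lborel (\<lambda>u. \<phi> u ^ k)"
    and "conv_pow f k y = inverse_char (\<lambda>u. \<phi> u ^ Suc k) y"
proof -
  interpret f: bounded_density f B by fact
  interpret M: real_distribution "density lborel (\<lambda>x. ennreal (f x))" by (rule f.real_distribution)
  have [measurable]: "\<phi> \<in> borel_measurable borel"
    unfolding \<phi>_def by (rule M.char_measurable)
  have le1: "cmod (\<phi> u) \<le> 1" for u
    unfolding \<phi>_def by (rule M.cmod_char_le_1)
  have intk: "integrable lborel (\<lambda>u. \<phi> u ^ j)" if "2 \<le> j" for j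
  proof (rule Bochner_Integration.integrable_bound)
    show "integrable lborel (\<lambda>u. (cmod (\<phi> u))\<^sup>2)"
      unfolding \<phi>_def by (rule plancherel(1)[OF assms(1)])
    show "AE u in lborel. norm (\<phi> u ^ j) \<le> norm ((cmod (\<phi> u))\<^sup>2)"
      using power_decreasing[OF that _ le1] by (simp add: norm_power)
  qed measurable
  then show "integrable lborel (\<lambda>u. \<phi> u ^ k)"
    using assms(2) by simp
  \<comment> \<open>\<open>conv_pow f j\<close> has j + 1 = k \<ge> 2 factors, enough for an
    integrable transform and hence the almost everywhere formula; the last factor is convolved in
    below, where null sets no longer matter.\<close>
  obtain j where k: "k = Suc j" and "1 \<le> j"
    using assms(2) by (cases k) auto
  define I where "I = (\<lambda>y. CLINT u|lborel. iexp (- (u * y)) * \<phi> u ^ Suc j)"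
  have intj: "integrable lborel (\<lambda>u. \<phi> u ^ Suc j)"
    using \<open>1 \<le> j\<close> by (intro intk) simp
  have I_cont: "isCont I y" for y
    unfolding I_def by (rule isCont_iexp_integral[OF intj])
  then have [measurable]: "I \<in> borel_measurable borel"
    by (intro borel_measurable_continuous_onI continuous_at_imp_continuous_on) auto
  interpret g: bounded_density "conv_pow f j" B
    by (rule bounded_density_conv_pow[OF assms(1)])
  have charj: "char (density lborel (\<lambda>x. ennreal (conv_pow f j x))) = (\<lambda>u. \<phi> u ^ Suc j)"
    unfolding \<phi>_def by (rule ext) (rule char_conv_pow[OF assms(1)])
  have "AE x in lborel. conv_pow f j x = inverse_char (\<lambda>u. \<phi> u ^ Suc j) x"
    using inverse_char_AE[OF g.bounded_density_axioms] intj unfolding charj .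
  then have AE: "AE x in lborel. conv_pow f j x = Re (I x) / (2 * pi)"
    by (simp add: inverse_char_def I_def)
  have "AE x in lborel. conv_pow f j (y + -1 * x) = Re (I (y + -1 * x)) / (2 * pi)"
    by (rule AE_borel_affine[OF _ _ AE]) auto
  then have AE': "AE x in lborel. conv_pow f j (y - x) = Re (I (y - x)) / (2 * pi)"
    by simp
  have int2: "integrable (lborel \<Otimes>\<^sub>M lborel) (\<lambda>(x, u). complex_of_real (f x) * (iexp (- (u * (y - x))) * \<phi> u ^ Suc j))"
  proof (rule Bochner_Integration.integrable_bound)
    show "integrable (lborel \<Otimes>\<^sub>M lborel) (\<lambda>(x, u). f x * cmod (\<phi> u ^ Suc j))"
      using f.integrable intj by (intro lborel_pair.integrable_fst_times_snd) auto
  qed (auto simp: norm_mult f.nonneg)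
  have "(CLINT x|lborel. complex_of_real (f x) * I (y - x)) =
      (CLINT x|lborel. CLINT u|lborel. complex_of_real (f x) * (iexp (- (u * (y - x))) * \<phi> u ^ Suc j))"
    unfolding I_def by (intro Bochner_Integration.integral_cong refl) (rule integral_mult_right_zero[symmetric])
  also have "\<dots> = (CLINT u|lborel. CLINT x|lborel. complex_of_real (f x) * (iexp (- (u * (y - x))) * \<phi> u ^ Suc j))"
    by (rule lborel_pair.Fubini_integral[OF int2, symmetric])
  also have "\<dots> = (CLINT u|lborel. CLINT x|lborel. (complex_of_real (f x) * iexp (u * x)) * (iexp (- (u * y)) * \<phi> u ^ Suc j))"
    by (intro Bochner_Integration.integral_cong refl)
       (simp add: right_diff_distrib exp_diff exp_minus field_simps)
  also have "\<dots> = (CLINT u|lborel. iexp (- (u * y)) * \<phi> u ^ Suc k)"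
    unfolding integral_mult_left_zero \<phi>_def f.char_eq[symmetric] k
    by (intro Bochner_Integration.integral_cong refl) (simp add: mult_ac)
  finally have eq: "(CLINT x|lborel. complex_of_real (f x) * I (y - x)) = (CLINT u|lborel. iexp (- (u * y)) * \<phi> u ^ Suc k)" .
  have "integrable lborel (\<lambda>x. complex_of_real (f x) * I (y - x))"
    using lborel_pair.integrable_fst'[OF int2] unfolding I_def
    by (simp add: integral_mult_right_zero)
  from integral_Re[OF this]
  have "(LINT x|lborel. f x * Re (I (y - x))) = Re (CLINT u|lborel. iexp (- (u * y)) * \<phi> u ^ Suc k)"
    by (simp add: eq)
  moreover have "conv_pow f k y = (LINT x|lborel. f x * Re (I (y - x)) / (2 * pi))"
    unfolding k conv_pow.simps conv_def using AE'
    by (intro integral_cong_AE) (auto elim!: eventually_mono)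
  ultimately show "conv_pow f k y = inverse_char (\<lambda>u. \<phi> u ^ Suc k) y"
    by (simp add: inverse_char_def)
qed

section \<open>Characteristic functions of standardised densities\<close>

lemma integrable_power_exp:
  fixes \<kappa> :: real
  assumes "0 < \<kappa>"
  shows "integrable lborel (\<lambda>x. \<bar>x\<bar> ^ k * exp (- \<kappa> * \<bar>x\<bar>))"
proof -
  have 1: "integrable lborel (\<lambda>x::real. indicator {0..} x * (x ^ k * exp (- x)))"
  proof (rule integrableI_nonneg)
    have "(\<integral>\<^sup>+x. ennreal (indicator {0..} x * (x ^ k * exp (- x))) \<partial>lborel) =
        (\<integral>\<^sup>+x. ennreal (x ^ k * exp (- x)) * indicator {0..} x \<partial>lborel)"
      by (intro nn_integral_cong) (auto simp: indicator_def)
    also have "\<dots> < \<infinity>"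
      by (simp add: nn_intergal_power_times_exp_Ici)
    finally show "(\<integral>\<^sup>+x. ennreal (indicator {0..} x * (x ^ k * exp (- x))) \<partial>lborel) < \<infinity>" .
  qed (auto simp: indicator_def)
  have 2: "integrable lborel (\<lambda>x::real. indicator {0..} (- x) * ((- x) ^ k * exp x))"
    using lborel_integrable_real_affine[OF 1, of "-1" 0] by simp
  have "integrable lborel (\<lambda>x::real. \<bar>x\<bar> ^ k * exp (- \<bar>x\<bar>))"
  proof (rule Bochner_Integration.integrable_bound[OF Bochner_Integration.integrable_add[OF 1 2]])
    have "norm (\<bar>x\<bar> ^ k * exp (- \<bar>x\<bar>)) \<le>
        norm (indicator {0..} x * (x ^ k * exp (- x)) + indicator {0..} (- x) * ((- x) ^ k * exp x))" for x :: real
      by (cases x "0::real" rule: linorder_cases) (auto simp: abs_mult power_abs abs_of_neg)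
    then show "AE x in (lborel :: real measure). norm (\<bar>x\<bar> ^ k * exp (- \<bar>x\<bar>)) \<le>
        norm (indicator {0..} x * (x ^ k * exp (- x)) + indicator {0..} (- x) * ((- x) ^ k * exp x))"
      by (rule AE_I2)
  qed measurable
  from lborel_integrable_real_affine[OF this, of \<kappa> 0]
  have "integrable lborel (\<lambda>x. (1 / \<kappa> ^ k) * (\<bar>\<kappa> * x\<bar> ^ k * exp (- \<bar>\<kappa> * x\<bar>)))"
    using assms by (intro integrable_mult_right) simp
  then show ?thesis
    using assms by (simp add: abs_mult power_mult_distrib mult.assoc)
qed

lemma integrable_power_gauss:
  fixes b :: real
  assumes "0 < b"
  shows "integrable lborel (\<lambda>x. \<bar>x\<bar> ^ k * exp (- b * x\<^sup>2))"
proof (rule Bochner_Integration.integrable_bound)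
  show "integrable lborel (\<lambda>x::real. exp b * (\<bar>x\<bar> ^ k * exp (- b * \<bar>x\<bar>)))"
    by (intro integrable_mult_right integrable_power_exp assms)
  have "exp (- b * x\<^sup>2) \<le> exp b * exp (- b * \<bar>x\<bar>)" for x
  proof -
    have "0 \<le> (\<bar>x\<bar> - 1/2)\<^sup>2" by simp
    then have "\<bar>x\<bar> \<le> 1 + x\<^sup>2" by (simp add: power2_diff power_divide)
    then have "b * \<bar>x\<bar> \<le> b * (1 + x\<^sup>2)"
      using assms by (intro mult_left_mono) auto
    then show ?thesis
      by (simp add: algebra_simps flip: exp_add)
  qed
  then have "\<bar>x\<bar> ^ k * exp (- b * x\<^sup>2) \<le> \<bar>x\<bar> ^ k * (exp b * exp (- b * \<bar>x\<bar>))" for x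
    by (intro mult_left_mono) auto
  then show "AE x in lborel. norm (\<bar>x\<bar> ^ k * exp (- b * x\<^sup>2)) \<le> norm (exp b * (\<bar>x\<bar> ^ k * exp (- b * \<bar>x\<bar>)))"
    by (simp add: abs_mult mult_ac)
qed measurable

lemma integral_power_gauss_scale:
  fixes n :: real
  assumes "0 < n"
  shows "(LINT u|lborel. \<bar>u\<bar> ^ k * exp (- b * (n * u\<^sup>2))) =
    (LINT u|lborel. \<bar>u\<bar> ^ k * exp (- b * u\<^sup>2)) / sqrt n ^ Suc k"
proof -
  have "(LINT u|lborel. \<bar>u\<bar> ^ k * exp (- b * u\<^sup>2)) =
      \<bar>sqrt n\<bar> *\<^sub>R (LINT u|lborel. \<bar>0 + sqrt n * u\<bar> ^ k * exp (- b * (0 + sqrt n * u)\<^sup>2))"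
    using assms by (intro lborel_integral_real_affine) simp
  also have "\<dots> = sqrt n * (LINT u|lborel. sqrt n ^ k * (\<bar>u\<bar> ^ k * exp (- b * (n * u\<^sup>2))))"
    using assms by (simp add: abs_mult power_mult_distrib mult_ac)
  also have "\<dots> = sqrt n ^ Suc k * (LINT u|lborel. \<bar>u\<bar> ^ k * exp (- b * (n * u\<^sup>2)))"
    by simp
  finally show ?thesis
    using assms by (simp add: field_simps)
qed

section \<open>Elementary inequalities for trigonometric functions, exponentials and powers\<close>

lemma abs_sin_mult_le: "\<bar>sin (real k * x)\<bar> \<le> real k * \<bar>sin x\<bar>"
proof (induction k)
  case (Suc k)
  have "\<bar>sin (real (Suc k) * x)\<bar> = \<bar>sin (real k * x) * cos x + cos (real k * x) * sin x\<bar>"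
    by (simp only: sin_add[symmetric]) (simp add: distrib_right add.commute)
  also have "\<dots> \<le> \<bar>sin (real k * x)\<bar> * \<bar>cos x\<bar> + \<bar>cos (real k * x)\<bar> * \<bar>sin x\<bar>"
    by (metis abs_mult abs_triangle_ineq)
  also have "\<dots> \<le> \<bar>sin (real k * x)\<bar> * 1 + 1 * \<bar>sin x\<bar>"
    by (intro add_mono mult_mono) auto
  finally show ?case
    using Suc.IH by (simp add: distrib_right)
qed simp

text \<open>The half-angle formula reduces this to the sine inequality. Integrated against a
  density, it carries closeness of the characteristic function to modulus 1 from u to k u.\<close>

lemma one_minus_cos_mult_le: "1 - cos (real k * x) \<le> (real k)\<^sup>2 * (1 - cos x)"
proof -
  have cos_eq: "1 - cos y = 2 * (sin (y / 2))\<^sup>2" for y :: real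
    using cos_double_sin[of "y / 2"] by simp
  have "(sin (real k * (x / 2)))\<^sup>2 \<le> (real k * \<bar>sin (x / 2)\<bar>)\<^sup>2"
    using power_mono[OF abs_sin_mult_le[of k "x / 2"] abs_ge_zero, of 2] by simp
  then show ?thesis
    by (simp add: cos_eq power_mult_distrib)
qed

lemma exp_minus_approx:
  fixes z :: real
  assumes "0 \<le> z"
  shows "\<bar>exp (- z) - (1 - z)\<bar> \<le> z\<^sup>2"
proof -
  have "1 - z \<le> exp (- z)"
    using exp_ge_add_one_self[of "- z"] by simp
  moreover have "exp (- z) \<le> 1 - z + z\<^sup>2"
  proof -
    have "1 \<le> 1 + z ^ 3" using assms by simp
    also have "\<dots> = (1 + z) * (1 - z + z\<^sup>2)" by (simp add: algebra_simps power2_eq_square power3_eq_cube)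
    also have "\<dots> \<le> exp z * (1 - z + z\<^sup>2)"
    proof (rule mult_right_mono)
      have "0 \<le> (z - 1/2)\<^sup>2" by simp
      then show "0 \<le> 1 - z + z\<^sup>2" by (simp add: power2_diff power_divide)
    qed (use exp_ge_add_one_self[of z] in simp)
    finally show ?thesis
      by (simp add: exp_minus field_simps)
  qed
  ultimately show ?thesis by simp
qed

text \<open>The telescoping bound for the unit disc, rescaled to radius \<open>r\<close>. Keeping
  \<open>r ^ k\<close> matters: it becomes the Gaussian decay in the comparison near 0.\<close>

lemma norm_power_diff_le:
  fixes z w :: complex
  assumes "norm z \<le> r" "norm w \<le> r"
  shows "norm (z ^ Suc k - w ^ Suc k) \<le> real (Suc k) * r ^ k * norm (z - w)"
proof (cases "r = 0")
  case False
  then have "0 < r"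
    using assms(1) norm_ge_zero[of z] by linarith
  have "norm ((z / r) ^ Suc k - (w / r) ^ Suc k) \<le> real (Suc k) * norm (z / r - w / r)"
    using assms \<open>0 < r\<close> by (intro norm_power_diff) (auto simp: norm_divide)
  also have "norm ((z / r) ^ Suc k - (w / r) ^ Suc k) = norm (z ^ Suc k - w ^ Suc k) / r ^ Suc k"
    using \<open>0 < r\<close> by (simp only: power_divide diff_divide_distrib[symmetric] norm_divide norm_power) simp
  also have "norm (z / r - w / r) = norm (z - w) / r"
    using \<open>0 < r\<close> by (simp only: diff_divide_distrib[symmetric] norm_divide) simp
  finally show ?thesis
    using \<open>0 < r\<close> by (simp add: field_simps)
qed (use assms in auto)

lemma cmod_iexp_diff_le: "cmod (iexp a - iexp b) \<le> \<bar>a - b\<bar>"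
proof -
  have "iexp a - iexp b = iexp b * (iexp (a - b) - 1)"
    by (simp add: right_diff_distrib exp_diff field_simps)
  then show ?thesis
    using iexp_approx1[of "a - b" 0] by (simp add: norm_mult)
qed

text \<open>The envelope constant \<open>C\<close> doubles as the uniform bound, so Plancherel's
  inequality too is controlled by the envelope.\<close>

locale standard_density = bounded_density f C
  for f :: "real \<Rightarrow> real" and C \<kappa> :: real +
  assumes envelope: "f x \<le> C * exp (- \<kappa> * \<bar>x\<bar>)"
    and rate_pos: "0 < \<kappa>"
    and mean: "(LINT x|lborel. f x * x) = 0"
    and variance: "(LINT x|lborel. f x * x\<^sup>2) = 1"
begin

abbreviation \<phi> :: "real \<Rightarrow> complex" where
  "\<phi> \<equiv> char (density lborel (\<lambda>x. ennreal (f x)))"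

sublocale M: real_distribution "density lborel (\<lambda>x. ennreal (f x))"
  by (rule real_distribution)

lemma integrable_abs_moment: "integrable lborel (\<lambda>x. f x * \<bar>x\<bar> ^ k)"
proof (rule Bochner_Integration.integrable_bound)
  show "integrable lborel (\<lambda>x::real. C * (\<bar>x\<bar> ^ k * exp (- \<kappa> * \<bar>x\<bar>)))"
    by (intro integrable_mult_right integrable_power_exp rate_pos)
  have "f x * \<bar>x\<bar> ^ k \<le> C * exp (- \<kappa> * \<bar>x\<bar>) * \<bar>x\<bar> ^ k" for x
    by (intro mult_right_mono envelope) simp
  then show "AE x in lborel. norm (f x * \<bar>x\<bar> ^ k) \<le> norm (C * (\<bar>x\<bar> ^ k * exp (- \<kappa> * \<bar>x\<bar>)))"
    using bound_nonneg by (auto simp: abs_mult nonneg mult_ac)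
qed measurable

lemma integrable_moment: "integrable lborel (\<lambda>x. f x * x ^ k)"
  by (rule Bochner_Integration.integrable_bound[OF integrable_abs_moment[of k]])
     (auto simp: abs_mult power_abs)

text \<open>Follows from |x| \<le> (1 + x^2) / 2 and unit variance. The value 1 becomes the
  Lipschitz constant of \<open>\<phi>\<close> and, added to the total mass, the factor 2 in the
  final estimate.\<close>

lemma abs_mean_le: "(LINT x|lborel. f x * \<bar>x\<bar>) \<le> 1"
proof -
  have "(LINT x|lborel. f x * \<bar>x\<bar>) \<le> (LINT x|lborel. f x * (1 / 2) + f x * x ^ 2 * (1 / 2))"
  proof (intro integral_mono)
    show "f x * \<bar>x\<bar> \<le> f x * (1 / 2) + f x * x ^ 2 * (1 / 2)" for x
    proof -
      have "0 \<le> (\<bar>x\<bar> - 1)\<^sup>2" by simp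
      then have "\<bar>x\<bar> \<le> 1 / 2 + x\<^sup>2 * (1 / 2)" by (simp add: power2_diff)
      then have "f x * \<bar>x\<bar> \<le> f x * (1 / 2 + x\<^sup>2 * (1 / 2))"
        by (intro mult_left_mono nonneg)
      then show ?thesis by (simp add: algebra_simps)
    qed
  qed (use integrable_abs_moment[of 1] integrable_moment[of 2] integrable in auto)
  also have "\<dots> = (LINT x|lborel. f x * (1 / 2)) + (LINT x|lborel. f x * x ^ 2 * (1 / 2))"
    using integrable_moment[of 2] integrable by (intro Bochner_Integration.integral_add) auto
  finally show ?thesis
    by (simp only: integral_mult_left_zero total variance)
qed

lemma integrable_f_iexp: "integrable lborel (\<lambda>x. complex_of_real (f x) * iexp (u * x))"
  by (rule Bochner_Integration.integrable_bound[OF integrable]) (auto simp: norm_mult nonneg)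

lemma char_lipschitz: "cmod (\<phi> u - \<phi> v) \<le> \<bar>u - v\<bar>"
proof -
  have "\<phi> u - \<phi> v = (CLINT x|lborel. f x * iexp (u * x) - f x * iexp (v * x))"
    unfolding char_eq by (intro Bochner_Integration.integral_diff[symmetric] integrable_f_iexp)
  also have "cmod \<dots> \<le> (LINT x|lborel. f x * \<bar>x\<bar> ^ 1 * \<bar>u - v\<bar>)"
  proof (rule Bochner_Integration.integral_norm_bound_integral)
    show "norm (f x * iexp (u * x) - f x * iexp (v * x)) \<le> f x * \<bar>x\<bar> ^ 1 * \<bar>u - v\<bar>" for x
    proof -
      have "norm (f x * iexp (u * x) - f x * iexp (v * x)) = f x * cmod (iexp (u * x) - iexp (v * x))"
        by (simp only: right_diff_distrib[symmetric] norm_mult norm_of_real abs_of_nonneg[OF nonneg])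
      also have "\<dots> \<le> f x * \<bar>u * x - v * x\<bar>"
        by (intro mult_left_mono cmod_iexp_diff_le nonneg)
      finally show ?thesis
        by (simp only: left_diff_distrib[symmetric] abs_mult) (simp add: mult_ac)
    qed
  qed (intro Bochner_Integration.integrable_diff integrable_f_iexp integrable_mult_left integrable_abs_moment)+
  also have "\<dots> = (LINT x|lborel. f x * \<bar>x\<bar>) * \<bar>u - v\<bar>"
    by simp
  also have "\<dots> \<le> 1 * \<bar>u - v\<bar>"
    by (intro mult_right_mono abs_mean_le) simp
  finally show ?thesis by simp
qed

text \<open>Rotating by the argument \<alpha> of \<open>\<phi> u\<close> turns its modulus into the
  integral of \<open>f x * cos (u * x - \<alpha>)\<close>. Rotating
  \<open>\<phi> (real k * u)\<close> by k \<alpha> gives a real part below its modulus, so the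
  cosine inequality can be integrated.\<close>

lemma one_minus_cmod_char_mult_le: "1 - cmod (\<phi> (real k * u)) \<le> (real k)\<^sup>2 * (1 - cmod (\<phi> u))"
proof -
  define \<alpha> where "\<alpha> = Arg (\<phi> u)"
  have int_cos: "integrable lborel (\<lambda>x. f x * cos (a * x - b))" for a b
    by (rule Bochner_Integration.integrable_bound[OF integrable])
       (auto simp: abs_mult nonneg intro!: AE_I2 mult_left_le)
  have rotate: "Re (iexp (- b) * \<phi> a) = (LINT x|lborel. f x * cos (a * x - b))" for a b
  proof -
    have "iexp (- b) * \<phi> a = (CLINT x|lborel. iexp (- b) * (f x * iexp (a * x)))"
      unfolding char_eq by simp
    also have "Re \<dots> = (LINT x|lborel. Re (iexp (- b) * (f x * iexp (a * x))))"
      by (intro integral_Re[symmetric] integrable_mult_right integrable_f_iexp)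
    also have "\<dots> = (LINT x|lborel. f x * cos (a * x - b))"
      by (intro Bochner_Integration.integral_cong refl)
         (simp add: Re_exp Im_exp cos_diff algebra_simps)
    finally show ?thesis .
  qed
  define c where "c = cmod (\<phi> u)"
  have polar: "\<phi> u = c * iexp \<alpha>"
    using rcis_cmod_Arg[of "\<phi> u"] by (simp add: rcis_def cis_conv_exp \<alpha>_def c_def)
  have "iexp (- \<alpha>) * \<phi> u = c"
    unfolding polar by (simp add: exp_minus)
  then have 1: "cmod (\<phi> u) = (LINT x|lborel. f x * cos (u * x - \<alpha>))"
    using rotate[of \<alpha> u] by (simp add: c_def)
  have 2: "(LINT x|lborel. f x * cos (real k * u * x - real k * \<alpha>)) \<le> cmod (\<phi> (real k * u))"
    unfolding rotate[symmetric]
    using complex_Re_le_cmod[of "iexp (- (real k * \<alpha>)) * \<phi> (real k * u)"] by (simp add: norm_mult)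
  have one_minus: "(LINT x|lborel. f x * (1 - cos (a * x - b))) = 1 - (LINT x|lborel. f x * cos (a * x - b))" for a b
    using Bochner_Integration.integral_diff[OF integrable int_cos[of a b]] total
    by (simp add: right_diff_distrib)
  have "1 - cmod (\<phi> (real k * u)) \<le> (LINT x|lborel. f x * (1 - cos (real k * u * x - real k * \<alpha>)))"
    using 2 by (simp add: one_minus)
  also have "\<dots> \<le> (LINT x|lborel. (real k)\<^sup>2 * (f x * (1 - cos (u * x - \<alpha>))))"
  proof (rule integral_mono)
    show "integrable lborel (\<lambda>x. f x * (1 - cos (real k * u * x - real k * \<alpha>)))"
      "integrable lborel (\<lambda>x. (real k)\<^sup>2 * (f x * (1 - cos (u * x - \<alpha>))))"
      using int_cos integrable by (auto simp: right_diff_distrib)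
    show "f x * (1 - cos (real k * u * x - real k * \<alpha>)) \<le> (real k)\<^sup>2 * (f x * (1 - cos (u * x - \<alpha>)))" for x
      using mult_left_mono[OF one_minus_cos_mult_le[of k "u * x - \<alpha>"] nonneg[of x]]
      by (simp add: right_diff_distrib mult_ac)
  qed
  also have "\<dots> = (real k)\<^sup>2 * (1 - cmod (\<phi> u))"
    by (simp add: one_minus 1)
  finally show ?thesis .
qed

text \<open>If \<open>\<bar>\<phi> u\<bar>\<close> were close to 1, then \<open>\<bar>\<phi>\<bar>\<close> would stay away from 0 around many multiples of \<open>u\<close>,
  which contradicts Plancherel's inequality.\<close>

lemma cmod_char_away:
  assumes "0 < \<delta>" "\<delta> \<le> 1" and N: "64 * pi * C < real N * \<delta>" and u: "\<delta> \<le> \<bar>u\<bar>"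
  shows "cmod (\<phi> u) \<le> 1 - 1 / (2 * (real N)\<^sup>2)"
proof (rule ccontr)
  assume "\<not> ?thesis"
  then have *: "1 - cmod (\<phi> u) < 1 / (2 * (real N)\<^sup>2)" by simp
  have "0 < real N * \<delta>"
    using N bound_nonneg by (intro le_less_trans[OF _ N]) auto
  then have "0 < real N"
    using \<open>0 < \<delta>\<close> by (simp add: zero_less_mult_iff)
  \<comment> \<open>Small enough for two purposes: the 1-Lipschitz function \<open>\<phi>\<close>
    loses at most 1/4 on each \<open>J k\<close>, and the intervals, whose centres are at least
    \<delta> apart, stay disjoint.\<close>
  define r where "r = \<delta> / 4"
  define J where "J k = {real k * u - r..real k * u + r}" for k
  have large: "1 / 4 \<le> cmod (\<phi> v)" if "k \<in> {1..N}" "v \<in> J k" for k v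
  proof -
    have "1 - cmod (\<phi> (real k * u)) \<le> (real k)\<^sup>2 * (1 - cmod (\<phi> u))"
      by (rule one_minus_cmod_char_mult_le)
    also have "\<dots> \<le> (real N)\<^sup>2 * (1 - cmod (\<phi> u))"
      using that M.cmod_char_le_1[of u] by (intro mult_right_mono power_mono) auto
    also have "\<dots> \<le> (real N)\<^sup>2 * (1 / (2 * (real N)\<^sup>2))"
      using * by (intro mult_left_mono) auto
    also have "\<dots> = 1 / 2"
      using \<open>0 < real N\<close> by simp
    finally have "1 / 2 \<le> cmod (\<phi> (real k * u))" by simp
    moreover have "cmod (\<phi> (real k * u)) - cmod (\<phi> v) \<le> \<bar>real k * u - v\<bar>"
      using norm_triangle_ineq2 char_lipschitz order_trans by blast
    moreover have "\<bar>real k * u - v\<bar> \<le> 1 / 4"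
    proof -
      have "real k * u - \<delta> / 4 \<le> v" "v \<le> real k * u + \<delta> / 4"
        using that(2) by (auto simp: J_def r_def)
      then show ?thesis
        using \<open>\<delta> \<le> 1\<close> by linarith
    qed
    ultimately show ?thesis by linarith
  qed
  have disj: "k = l" if "v \<in> J k" "v \<in> J l" for k l v
  proof (rule ccontr)
    assume "k \<noteq> l"
    then have "1 \<le> \<bar>real k - real l\<bar>"
      by linarith
    then have "1 * \<bar>u\<bar> \<le> \<bar>real k - real l\<bar> * \<bar>u\<bar>"
      by (rule mult_right_mono) simp
    also have "\<dots> = \<bar>real k * u - real l * u\<bar>"
      by (simp add: left_diff_distrib flip: abs_mult)
    also have "\<dots> \<le> 2 * r"
      using that by (auto simp: J_def)
    finally show False
      using u \<open>0 < \<delta>\<close> by (simp add: r_def)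
  qed
  have le: "(\<Sum>k=1..N. indicator (J k) v * (1 / 16)) \<le> (cmod (\<phi> v))\<^sup>2" for v
  proof (cases "\<exists>k\<in>{1..N}. v \<in> J k")
    case True
    then obtain k where k: "k \<in> {1..N}" "v \<in> J k" by blast
    have "(\<Sum>l=1..N. indicator (J l) v * (1 / 16)) = (\<Sum>l=1..N. if l = k then 1 / 16 else (0::real))"
      using disj k(2) by (intro sum.cong) (auto simp: indicator_def)
    also have "\<dots> = (1 / 4)\<^sup>2"
      using k(1) by (simp add: power2_eq_square)
    also have "\<dots> \<le> (cmod (\<phi> v))\<^sup>2"
      using large[OF k] by (intro power_mono) auto
    finally show ?thesis .
  next
    case False
    then have "(\<Sum>k=1..N. indicator (J k) v * (1 / 16)) = (0::real)"
      by (intro sum.neutral) (auto simp: indicator_def)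
    then show ?thesis by simp
  qed
  have Jint: "integrable lborel (\<lambda>v. indicat_real (J k) v * (1 / 16))" for k
    unfolding J_def by (intro integrable_mult_left integrable_real_indicator) (auto simp: emeasure_lborel_Icc_eq)
  \<comment> \<open>N disjoint intervals of length \<delta>/2, each with squared modulus at least
    1/16, contribute N \<delta> / 32. Comparison with the Plancherel bound 2 pi C explains the
    constant 64 pi C.\<close>
  have "real N * (2 * r / 16) = (\<Sum>k=1..N. LINT v|lborel. indicator (J k) v * (1 / 16))"
    using \<open>0 < \<delta>\<close> by (simp add: J_def r_def)
  also have "\<dots> = (LINT v|lborel. (\<Sum>k=1..N. indicator (J k) v * (1 / 16)))"
    by (rule Bochner_Integration.integral_sum[symmetric]) (rule Jint)
  also have "\<dots> \<le> (LINT v|lborel. (cmod (\<phi> v))\<^sup>2)"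
    by (intro integral_mono Bochner_Integration.integrable_sum Jint plancherel(1)[OF bounded_density_axioms] le)
  also have "\<dots> \<le> 2 * pi * C"
    by (rule plancherel(2)[OF bounded_density_axioms])
  finally show False
    using N by (simp add: r_def)
qed

end

lemma integral_gauss_half: "(LINT u|lborel. exp (- (1 / 2) * u\<^sup>2)) = sqrt (2 * pi)"
proof -
  have "1 = (LINT x|lborel. std_normal_density x)"
    using integral_std_normal_moment_even[of 0] by simp
  also have "\<dots> = (LINT x|lborel. 1 / sqrt (2 * pi) * exp (- (1 / 2) * x\<^sup>2))"
    by (simp add: std_normal_density_def)
  finally show ?thesis
    unfolding integral_mult_right_zero by (simp add: field_simps)
qed

lemma two_pi_abs_le_cmod:
  assumes "2 * pi * d = Re z"
  shows "2 * pi * \<bar>d\<bar> \<le> cmod z"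
proof -
  have "2 * pi * \<bar>d\<bar> = \<bar>Re z\<bar>"
    by (simp add: abs_mult flip: assms)
  then show ?thesis
    using abs_Re_le_cmod[of z] by simp
qed

section \<open>Behaviour of the characteristic function near the origin\<close>

context standard_density
begin

text \<open>An upper bound for the third absolute moment that mentions only \<open>C\<close> and
  \<open>\<kappa>\<close>; outside the locale it is one number valid for all densities under the
  envelope.\<close>

definition third :: real where
  "third = C * (LINT x|lborel. \<bar>x\<bar> ^ 3 * exp (- \<kappa> * \<bar>x\<bar>))"

lemma third_nonneg: "0 \<le> third"
  unfolding third_def by (intro mult_nonneg_nonneg bound_nonneg integral_nonneg_AE AE_I2) auto

lemma third_moment_le: "(LINT x|lborel. f x * \<bar>x\<bar> ^ 3) \<le> third"
proof -
  have "(LINT x|lborel. f x * \<bar>x\<bar> ^ 3) \<le> (LINT x|lborel. C * (\<bar>x\<bar> ^ 3 * exp (- \<kappa> * \<bar>x\<bar>)))"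
  proof (intro integral_mono integrable_abs_moment integrable_mult_right integrable_power_exp rate_pos)
    show "f x * \<bar>x\<bar> ^ 3 \<le> C * (\<bar>x\<bar> ^ 3 * exp (- \<kappa> * \<bar>x\<bar>))" for x
      using mult_right_mono[OF envelope[of x], of "\<bar>x\<bar> ^ 3"] by (simp add: mult_ac)
  qed
  then show ?thesis
    by (simp add: third_def)
qed

lemma char_taylor: "cmod (\<phi> u - (1 - u\<^sup>2 / 2)) \<le> \<bar>u\<bar> ^ 3 * third / 6"
proof -
  let ?M = "density lborel (\<lambda>x. ennreal (f x))"
  have int_iff: "integrable ?M g \<longleftrightarrow> integrable lborel (\<lambda>x. f x * g x)"
    if "g \<in> borel_measurable borel" for g :: "real \<Rightarrow> real"
    using that by (subst integrable_density) (auto simp: nonneg)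
  have int_eq: "(LINT x|?M. g x) = (LINT x|lborel. f x * g x)"
    if "g \<in> borel_measurable borel" for g :: "real \<Rightarrow> real"
    using that by (subst integral_density) auto
  have int3: "integrable ?M (\<lambda>x. \<bar>x\<bar> ^ 3)"
    using integrable_abs_moment[of 3] by (simp add: int_iff)
  have "cmod (\<phi> u - (1 - u\<^sup>2 * 1 / 2)) \<le> (u\<^sup>2 / 6) * (LINT x|?M. min (6 * x\<^sup>2) (\<bar>u\<bar> * \<bar>x\<bar> ^ 3))"
    using integrable_moment[of 1] integrable_moment[of 2] mean variance
    by (intro M.char_approx3) (auto simp: int_iff int_eq)
  also have "\<dots> \<le> (u\<^sup>2 / 6) * (LINT x|?M. \<bar>u\<bar> * \<bar>x\<bar> ^ 3)"
    using int3
    by (intro mult_left_mono integral_mono integrable_mult_right)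
       (auto intro!: Bochner_Integration.integrable_bound[OF integrable_mult_right[OF int3, of "\<bar>u\<bar>"]])
  also have "\<dots> = \<bar>u\<bar> ^ 3 / 6 * (LINT x|lborel. f x * \<bar>x\<bar> ^ 3)"
    by (simp add: int_eq power3_eq_cube power2_eq_square flip: abs_mult)
  also have "\<dots> \<le> \<bar>u\<bar> ^ 3 / 6 * third"
    by (intro mult_left_mono third_moment_le) auto
  finally show ?thesis by simp
qed

lemma char_gauss:
  assumes "\<bar>u\<bar> \<le> 1"
  shows "cmod (\<phi> u - exp (- (1 / 2) * u\<^sup>2)) \<le> (third + 1) * \<bar>u\<bar> ^ 3"
proof -
  have "\<bar>exp (- (u\<^sup>2 / 2)) - (1 - u\<^sup>2 / 2)\<bar> \<le> (u\<^sup>2 / 2)\<^sup>2"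
    by (rule exp_minus_approx) simp
  also have "\<dots> = \<bar>u\<bar> ^ 4 / 4"
    by (simp add: power_divide flip: power_mult)
  also have "\<dots> \<le> \<bar>u\<bar> ^ 3 / 4"
    using power_decreasing[of 3 4 "\<bar>u\<bar>"] assms by simp
  finally have "cmod (complex_of_real (exp (- (1 / 2) * u\<^sup>2) - (1 - u\<^sup>2 / 2))) \<le> \<bar>u\<bar> ^ 3 / 4"
    by (simp only: norm_of_real) simp
  moreover have "cmod (\<phi> u - exp (- (1 / 2) * u\<^sup>2)) \<le> cmod (\<phi> u - (1 - u\<^sup>2 / 2))
      + cmod (complex_of_real (exp (- (1 / 2) * u\<^sup>2) - (1 - u\<^sup>2 / 2)))"
    using norm_triangle_ineq4[of "\<phi> u - (1 - u\<^sup>2 / 2)" "complex_of_real (exp (- (1 / 2) * u\<^sup>2) - (1 - u\<^sup>2 / 2))"]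
    by (simp add: algebra_simps)
  ultimately have "cmod (\<phi> u - exp (- (1 / 2) * u\<^sup>2)) \<le> \<bar>u\<bar> ^ 3 * third / 6 + \<bar>u\<bar> ^ 3 / 4"
    using char_taylor[of u] by linarith
  also have "\<dots> = (third / 6 + 1 / 4) * \<bar>u\<bar> ^ 3"
    by (simp add: algebra_simps)
  also have "\<dots> \<le> (third + 1) * \<bar>u\<bar> ^ 3"
    using third_nonneg by (intro mult_right_mono) auto
  finally show ?thesis .
qed

text \<open>In this range the cubic Taylor error is at most u^2 / 6, which leaves 1 - u^2 / 3 and
  hence less than the exponential with rate 1/4.\<close>

lemma cmod_char_near:
  assumes "\<bar>u\<bar> \<le> 1 / (third + 1)"
  shows "cmod (\<phi> u) \<le> exp (- (1 / 4) * u\<^sup>2)"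
proof -
  have u: "\<bar>u\<bar> * (third + 1) \<le> 1"
    using assms third_nonneg by (simp add: field_simps)
  then have "\<bar>u\<bar> * third \<le> 1" "\<bar>u\<bar> \<le> 1"
    using third_nonneg by (auto simp: distrib_left intro: order_trans[rotated] add_increasing add_increasing2)
  then have "u\<^sup>2 \<le> 1"
    by (simp add: abs_square_le_1)
  have "cmod (\<phi> u) \<le> cmod (complex_of_real (1 - u\<^sup>2 / 2)) + cmod (\<phi> u - (1 - u\<^sup>2 / 2))"
    using norm_triangle_sub[of "\<phi> u" "complex_of_real (1 - u\<^sup>2 / 2)"] by simp
  also have "\<dots> \<le> (1 - u\<^sup>2 / 2) + \<bar>u\<bar> ^ 3 * third / 6"
    using \<open>u\<^sup>2 \<le> 1\<close> char_taylor[of u] by (simp only: norm_of_real)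
  also have "\<bar>u\<bar> ^ 3 * third = u\<^sup>2 * (\<bar>u\<bar> * third)"
    by (simp add: power3_eq_cube power2_eq_square flip: abs_mult)
  also have "(1 - u\<^sup>2 / 2) + u\<^sup>2 * (\<bar>u\<bar> * third) / 6 \<le> (1 - u\<^sup>2 / 2) + u\<^sup>2 * 1 / 6"
    using \<open>\<bar>u\<bar> * third \<le> 1\<close> by (intro add_left_mono divide_right_mono mult_left_mono) auto
  also have "\<dots> \<le> 1 + - (1 / 4) * u\<^sup>2"
    by simp
  also have "\<dots> \<le> exp (- (1 / 4) * u\<^sup>2)"
    by (rule exp_ge_add_one_self)
  finally show ?thesis .
qed

section \<open>Local limit estimates from a bound near the origin and a bound away from it\<close>

context
  fixes \<delta> \<rho> :: real
  assumes \<delta>: "0 < \<delta>" "\<delta> \<le> 1"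
    and near: "\<And>u. \<bar>u\<bar> \<le> \<delta> \<Longrightarrow> cmod (\<phi> u) \<le> exp (- (1 / 4) * u\<^sup>2)"
    and away: "\<And>u. \<delta> \<le> \<bar>u\<bar> \<Longrightarrow> cmod (\<phi> u) \<le> \<rho>"
begin

lemma rho_nonneg: "0 \<le> \<rho>"
  using away[of 1] \<delta> norm_ge_zero[of "\<phi> 1"] by (simp del: norm_ge_zero)

lemma near_power: "\<bar>u\<bar> \<le> \<delta> \<Longrightarrow> cmod (\<phi> u) ^ k \<le> exp (- (1 / 4) * (real k * u\<^sup>2))"
  using power_mono[OF near[of u], of k] by (simp add: mult_ac flip: exp_of_nat_mult)

text \<open>Two factors are held back so that the geometric rate still multiplies an integrable
  function.\<close>

lemma away_power: "\<delta> \<le> \<bar>u\<bar> \<Longrightarrow> cmod (\<phi> u) ^ (k + 2) \<le> \<rho> ^ k * (cmod (\<phi> u))\<^sup>2"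
  unfolding power_add by (intro mult_right_mono power_mono away) auto

text \<open>The difference of the inversion integrals has integrand
  \<open>\<phi> u ^ Suc m * (iexp (u * y) - \<phi> u)\<close>. Both terms in the bracket equal 1 at
  u = 0 and are Lipschitz, which gives (1 + |y|) |u|; under Gaussian decay this integrates to order
  1/m, against order 1/sqrt(m) for the value at 0.\<close>

lemma conv_pow_increment:
  assumes "2 \<le> m"
  shows "\<bar>conv_pow f m (- y) - conv_pow f (Suc m) 0\<bar> \<le>
    (1 + \<bar>y\<bar>) * ((LINT u|lborel. \<bar>u\<bar> ^ 1 * exp (- (1 / 4) * u\<^sup>2)) / real (Suc m) + 4 * pi * C * \<rho> ^ (m - 1))"
proof -
  have [measurable]: "\<phi> \<in> borel_measurable borel" by simp
  let ?G = "\<lambda>u. \<bar>u\<bar> ^ 1 * exp (- (1 / 4) * (real (Suc m) * u\<^sup>2))"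
  have int1: "integrable lborel (\<lambda>u. iexp (- (u * - y)) * \<phi> u ^ Suc m)"
    using conv_pow_inverse_char(1)[OF bounded_density_axioms, of "Suc m"] assms
    by (rule_tac Bochner_Integration.integrable_bound) (auto simp: norm_mult)
  have int2: "integrable lborel (\<lambda>u. iexp (- (u * 0)) * \<phi> u ^ Suc (Suc m))"
    using conv_pow_inverse_char(1)[OF bounded_density_axioms, of "Suc (Suc m)"] assms by simp
  have intG: "integrable lborel ?G"
    using integrable_power_gauss[of "1 / 4 * real (Suc m)" 1] by (simp add: mult.assoc)
  have intP: "integrable lborel (\<lambda>u. (cmod (\<phi> u))\<^sup>2)"
    by (rule plancherel(1)[OF bounded_density_axioms])
  have "2 * pi * (conv_pow f m (- y) - conv_pow f (Suc m) 0) =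
      Re ((CLINT u|lborel. iexp (- (u * - y)) * \<phi> u ^ Suc m) - (CLINT u|lborel. iexp (- (u * 0)) * \<phi> u ^ Suc (Suc m)))"
    using assms conv_pow_inverse_char(2)[OF bounded_density_axioms, of m "- y"]
      conv_pow_inverse_char(2)[OF bounded_density_axioms, of "Suc m" 0]
    by (simp add: inverse_char_def right_diff_distrib del: conv_pow.simps power_Suc)
  then have "2 * pi * \<bar>conv_pow f m (- y) - conv_pow f (Suc m) 0\<bar> \<le>
      cmod ((CLINT u|lborel. iexp (- (u * - y)) * \<phi> u ^ Suc m) - (CLINT u|lborel. iexp (- (u * 0)) * \<phi> u ^ Suc (Suc m)))"
    by (rule two_pi_abs_le_cmod)
  also have "\<dots> = cmod (CLINT u|lborel. iexp (- (u * - y)) * \<phi> u ^ Suc m - iexp (- (u * 0)) * \<phi> u ^ Suc (Suc m))"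
    by (simp only: Bochner_Integration.integral_diff[OF int1 int2])
  also have "\<dots> \<le> (LINT u|lborel. (1 + \<bar>y\<bar>) * ?G u + 2 * \<rho> ^ (m - 1) * (cmod (\<phi> u))\<^sup>2)"
  proof (rule Bochner_Integration.integral_norm_bound_integral)
    fix u
    have eq: "iexp (- (u * - y)) * \<phi> u ^ Suc m - iexp (- (u * 0)) * \<phi> u ^ Suc (Suc m) = \<phi> u ^ Suc m * (iexp (u * y) - \<phi> u)"
      by (simp add: algebra_simps)
    have "norm (iexp (- (u * - y)) * \<phi> u ^ Suc m - iexp (- (u * 0)) * \<phi> u ^ Suc (Suc m)) =
        cmod (\<phi> u) ^ Suc m * cmod (iexp (u * y) - \<phi> u)"
      unfolding eq by (simp only: norm_mult norm_power)
    also have "\<dots> \<le> (1 + \<bar>y\<bar>) * ?G u + 2 * \<rho> ^ (m - 1) * (cmod (\<phi> u))\<^sup>2"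
    proof (cases "\<bar>u\<bar> \<le> \<delta>")
      case True
      have "cmod (iexp (u * y) - \<phi> u) \<le> cmod (iexp (u * y) - iexp 0) + cmod (\<phi> 0 - \<phi> u)"
        using norm_triangle_ineq[of "iexp (u * y) - iexp 0" "\<phi> 0 - \<phi> u"] M.char_zero by simp
      also have "\<dots> \<le> \<bar>u * y - 0\<bar> + \<bar>0 - u\<bar>"
        by (intro add_mono cmod_iexp_diff_le char_lipschitz)
      also have "\<dots> = (1 + \<bar>y\<bar>) * \<bar>u\<bar>"
        by (simp add: algebra_simps abs_mult)
      finally have "cmod (\<phi> u) ^ Suc m * cmod (iexp (u * y) - \<phi> u) \<le>
          exp (- (1 / 4) * (real (Suc m) * u\<^sup>2)) * ((1 + \<bar>y\<bar>) * \<bar>u\<bar>)"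
        using True by (intro mult_mono near_power) auto
      also have "\<dots> = (1 + \<bar>y\<bar>) * ?G u"
        by simp
      also have "\<dots> \<le> (1 + \<bar>y\<bar>) * ?G u + 2 * \<rho> ^ (m - 1) * (cmod (\<phi> u))\<^sup>2"
        using rho_nonneg by simp
      finally show ?thesis .
    next
      case False
      have "cmod (\<phi> u) ^ Suc m * cmod (iexp (u * y) - \<phi> u) \<le> \<rho> ^ (m - 1) * (cmod (\<phi> u))\<^sup>2 * (1 + 1)"
      proof (intro mult_mono)
        show "cmod (\<phi> u) ^ Suc m \<le> \<rho> ^ (m - 1) * (cmod (\<phi> u))\<^sup>2"
          using away_power[of u "m - 1"] False assms by (simp add: Suc_diff_Suc numeral_2_eq_2)
        show "cmod (iexp (u * y) - \<phi> u) \<le> 1 + 1"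
          using norm_triangle_ineq4[of "iexp (u * y)" "\<phi> u"] M.cmod_char_le_1[of u] by (simp add: norm_exp_i_times)
      qed (use rho_nonneg in auto)
      also have "\<dots> \<le> (1 + \<bar>y\<bar>) * ?G u + 2 * \<rho> ^ (m - 1) * (cmod (\<phi> u))\<^sup>2"
        by simp
      finally show ?thesis .
    qed
    finally show "norm (iexp (- (u * - y)) * \<phi> u ^ Suc m - iexp (- (u * 0)) * \<phi> u ^ Suc (Suc m)) \<le>
      (1 + \<bar>y\<bar>) * ?G u + 2 * \<rho> ^ (m - 1) * (cmod (\<phi> u))\<^sup>2" .
  qed (use int1 int2 intG intP in \<open>auto simp del: power_Suc power_one_right mult_zero_right\<close>)
  also have "\<dots> = (LINT u|lborel. (1 + \<bar>y\<bar>) * ?G u) + (LINT u|lborel. 2 * \<rho> ^ (m - 1) * (cmod (\<phi> u))\<^sup>2)"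
    using intG intP by (intro Bochner_Integration.integral_add integrable_mult_right)
  also have "\<dots> = (1 + \<bar>y\<bar>) * (LINT u|lborel. ?G u) + 2 * \<rho> ^ (m - 1) * (LINT u|lborel. (cmod (\<phi> u))\<^sup>2)"
    by (simp only: integral_mult_right_zero)
  also have "\<dots> \<le> (1 + \<bar>y\<bar>) * (LINT u|lborel. ?G u) + 2 * \<rho> ^ (m - 1) * (2 * pi * C)"
    using rho_nonneg by (intro add_left_mono mult_left_mono plancherel(2)[OF bounded_density_axioms]) auto
  also have "(LINT u|lborel. ?G u) = (LINT u|lborel. \<bar>u\<bar> ^ 1 * exp (- (1 / 4) * u\<^sup>2)) / real (Suc m)"
    by (subst integral_power_gauss_scale) (auto simp: power2_eq_square)
  finally have *: "2 * pi * \<bar>conv_pow f m (- y) - conv_pow f (Suc m) 0\<bar> \<le>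
    (1 + \<bar>y\<bar>) * ((LINT u|lborel. \<bar>u\<bar> ^ 1 * exp (- (1 / 4) * u\<^sup>2)) / real (Suc m)) + 4 * pi * C * \<rho> ^ (m - 1)"
    by (simp add: mult_ac)
  have "1 * \<bar>conv_pow f m (- y) - conv_pow f (Suc m) 0\<bar> \<le> 2 * pi * \<bar>conv_pow f m (- y) - conv_pow f (Suc m) 0\<bar>"
    using pi_gt3 by (intro mult_right_mono) auto
  also note *
  also have "4 * pi * C * \<rho> ^ (m - 1) \<le> (1 + \<bar>y\<bar>) * (4 * pi * C * \<rho> ^ (m - 1))"
    using rho_nonneg bound_nonneg by (simp add: distrib_right)
  finally show ?thesis
    by (simp add: distrib_left)
qed

text \<open>The reference value is the inversion integral at 0 of the (m+2)-th power of the standard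
  Gaussian transform. Near 0 the power difference costs a factor m + 2 times |u|^3, integrating to
  order 1/m; away from 0 both powers are geometrically small and are bounded separately. The later
  use is a lower bound for the value at 0.\<close>

lemma conv_pow_at_zero:
  assumes "2 \<le> m"
  shows "\<bar>conv_pow f (Suc m) 0 - 1 / sqrt (2 * pi * real (m + 2))\<bar> \<le>
    (real (m + 2) * (third + 1)) * (LINT u|lborel. \<bar>u\<bar> ^ 3 * exp (- (1 / 4) * u\<^sup>2)) / (real (Suc m))\<^sup>2
    + 2 * pi * C * \<rho> ^ m + exp (- \<delta>\<^sup>2 / 2) ^ Suc m * sqrt (2 * pi)"
proof -
  have [measurable]: "\<phi> \<in> borel_measurable borel" by simp
  let ?n = "real (m + 2)"
  let ?G = "\<lambda>u. \<bar>u\<bar> ^ 3 * exp (- (1 / 4) * (real (Suc m) * u\<^sup>2))"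
  let ?H = "\<lambda>u. exp (- (1 / 2) * (?n * u\<^sup>2))"
  let ?H1 = "\<lambda>u::real. exp (- (1 / 2) * u\<^sup>2)"
  have intI: "integrable lborel (\<lambda>u. \<phi> u ^ (m + 2))"
    using conv_pow_inverse_char(1)[OF bounded_density_axioms, of "m + 2"] by simp
  have intG: "integrable lborel ?G"
    using integrable_power_gauss[of "1 / 4 * real (Suc m)" 3] by (simp add: mult.assoc)
  have intH: "integrable lborel ?H"
    using integrable_power_gauss[of "1 / 2 * ?n" 0] by (simp add: mult.assoc)
  have intH1: "integrable lborel ?H1"
    using integrable_power_gauss[of "1 / 2" 0] by simp
  have intP: "integrable lborel (\<lambda>u. (cmod (\<phi> u))\<^sup>2)"
    by (rule plancherel(1)[OF bounded_density_axioms])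
  have "(LINT u|lborel. ?H u) = sqrt (2 * pi) / sqrt ?n"
    using integral_power_gauss_scale[of ?n 0 "1 / 2"] integral_gauss_half by simp
  also have "\<dots> = (2 * pi / sqrt (2 * pi)) / sqrt ?n"
    by (simp only: real_div_sqrt mult_nonneg_nonneg zero_le_numeral pi_ge_zero)
  also have "\<dots> = 2 * pi * (1 / sqrt (2 * pi * ?n))"
    by (simp only: real_sqrt_mult[of "2 * pi"]) simp
  finally have H: "(CLINT u|lborel. complex_of_real (?H u)) = complex_of_real (2 * pi * (1 / sqrt (2 * pi * ?n)))"
    by (simp only: integral_complex_of_real)
  have "2 * pi * (conv_pow f (Suc m) 0 - 1 / sqrt (2 * pi * ?n)) =
      Re ((CLINT u|lborel. \<phi> u ^ (m + 2)) - (CLINT u|lborel. complex_of_real (?H u)))"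
    unfolding H using assms      conv_pow_inverse_char(2)[OF bounded_density_axioms, of "Suc m" 0]
    by (simp add: inverse_char_def right_diff_distrib del: conv_pow.simps power_Suc)
  then have "2 * pi * \<bar>conv_pow f (Suc m) 0 - 1 / sqrt (2 * pi * ?n)\<bar> \<le>
      cmod ((CLINT u|lborel. \<phi> u ^ (m + 2)) - (CLINT u|lborel. complex_of_real (?H u)))"
    by (rule two_pi_abs_le_cmod)
  also have "\<dots> = cmod (CLINT u|lborel. \<phi> u ^ (m + 2) - complex_of_real (?H u))"
    using intI intH by (subst Bochner_Integration.integral_diff) auto
  also have "\<dots> \<le> (LINT u|lborel. ?n * (third + 1) * ?G u + (\<rho> ^ m * (cmod (\<phi> u))\<^sup>2 + exp (- \<delta>\<^sup>2 / 2) ^ Suc m * ?H1 u))"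
  proof (rule Bochner_Integration.integral_norm_bound_integral)
    fix u
    have third_G: "0 \<le> ?n * (third + 1) * ?G u"
      using third_nonneg by (intro mult_nonneg_nonneg) auto
    have H_pow: "complex_of_real (?H u) = complex_of_real (?H1 u) ^ Suc (Suc m)"
      by (simp add: algebra_simps flip: exp_of_nat_mult of_real_power power_Suc)
    show "norm (\<phi> u ^ (m + 2) - complex_of_real (?H u)) \<le>
        ?n * (third + 1) * ?G u + (\<rho> ^ m * (cmod (\<phi> u))\<^sup>2 + exp (- \<delta>\<^sup>2 / 2) ^ Suc m * ?H1 u)"
    proof (cases "\<bar>u\<bar> \<le> \<delta>")
      case True
      have "norm (\<phi> u ^ Suc (Suc m) - complex_of_real (?H1 u) ^ Suc (Suc m)) \<le>
          real (Suc (Suc m)) * exp (- (1 / 4) * u\<^sup>2) ^ Suc m * norm (\<phi> u - complex_of_real (?H1 u))"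
        using True by (intro norm_power_diff_le near) auto
      also have "\<dots> \<le> real (Suc (Suc m)) * exp (- (1 / 4) * u\<^sup>2) ^ Suc m * ((third + 1) * \<bar>u\<bar> ^ 3)"
        using True \<delta> by (intro mult_left_mono char_gauss) auto
      also have "\<dots> = ?n * (third + 1) * ?G u"
        by (simp add: mult_ac flip: exp_of_nat_mult power_Suc)
      also have "\<dots> \<le> ?n * (third + 1) * ?G u + (\<rho> ^ m * (cmod (\<phi> u))\<^sup>2 + exp (- \<delta>\<^sup>2 / 2) ^ Suc m * ?H1 u)"
        using rho_nonneg by (simp del: power_Suc)
      finally show ?thesis
        unfolding H_pow by simp
    next
      case False
      have "norm (\<phi> u ^ (m + 2) - complex_of_real (?H u)) \<le> cmod (\<phi> u) ^ (m + 2) + norm (complex_of_real (?H u))"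
        by (rule order_trans[OF norm_triangle_ineq4]) (simp add: norm_power norm_mult)
      also have "\<dots> \<le> \<rho> ^ m * (cmod (\<phi> u))\<^sup>2 + exp (- \<delta>\<^sup>2 / 2) ^ Suc m * ?H1 u"
      proof (rule add_mono)
        show "cmod (\<phi> u) ^ (m + 2) \<le> \<rho> ^ m * (cmod (\<phi> u))\<^sup>2"
          using False by (intro away_power) simp
        have "\<delta>\<^sup>2 \<le> u\<^sup>2"
          using False \<delta> power_mono[of \<delta> "\<bar>u\<bar>" 2] by simp
        then have "?H1 u ^ Suc m * ?H1 u \<le> exp (- \<delta>\<^sup>2 / 2) ^ Suc m * ?H1 u"
          by (intro mult_right_mono power_mono) auto
        then show "norm (complex_of_real (?H u)) \<le> exp (- \<delta>\<^sup>2 / 2) ^ Suc m * ?H1 u"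
          unfolding H_pow by (simp add: norm_power norm_mult mult_ac)
      qed
      also have "\<dots> \<le> ?n * (third + 1) * ?G u + \<dots>"
        using third_G by simp
      finally show ?thesis .
    qed
  qed (use intI intH intG intP intH1 in \<open>auto simp del: power_Suc\<close>)
  also have "\<dots> = (LINT u|lborel. ?n * (third + 1) * ?G u) + ((LINT u|lborel. \<rho> ^ m * (cmod (\<phi> u))\<^sup>2) + (LINT u|lborel. exp (- \<delta>\<^sup>2 / 2) ^ Suc m * ?H1 u))"
    using intG intP intH1
    by (simp only: Bochner_Integration.integral_add Bochner_Integration.integrable_add integrable_mult_right)
  also have "\<dots> = ?n * (third + 1) * (LINT u|lborel. ?G u) + (\<rho> ^ m * (LINT u|lborel. (cmod (\<phi> u))\<^sup>2) + exp (- \<delta>\<^sup>2 / 2) ^ Suc m * sqrt (2 * pi))"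
    by (simp only: integral_mult_right_zero integral_gauss_half)
  also have "\<dots> \<le> ?n * (third + 1) * (LINT u|lborel. ?G u) + (\<rho> ^ m * (2 * pi * C) + exp (- \<delta>\<^sup>2 / 2) ^ Suc m * sqrt (2 * pi))"
    using rho_nonneg by (intro add_mono mult_left_mono plancherel(2)[OF bounded_density_axioms] order_refl) auto
  also have "(LINT u|lborel. ?G u) = (LINT u|lborel. \<bar>u\<bar> ^ 3 * exp (- (1 / 4) * u\<^sup>2)) / (real (Suc m))\<^sup>2"
  proof -
    have "sqrt (real (Suc m)) ^ Suc 3 = ((sqrt (real (Suc m)))\<^sup>2)\<^sup>2"
      by (simp flip: power_mult add: numeral_eq_Suc)
    then have "sqrt (real (Suc m)) ^ Suc 3 = (real (Suc m))\<^sup>2"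
      by (simp del: power_Suc)
    then show ?thesis
      by (subst integral_power_gauss_scale) (auto simp del: power_Suc)
  qed
  finally have *: "2 * pi * \<bar>conv_pow f (Suc m) 0 - 1 / sqrt (2 * pi * ?n)\<bar> \<le>
      ?n * (third + 1) * ((LINT u|lborel. \<bar>u\<bar> ^ 3 * exp (- (1 / 4) * u\<^sup>2)) / (real (Suc m))\<^sup>2)
      + (\<rho> ^ m * (2 * pi * C) + exp (- \<delta>\<^sup>2 / 2) ^ Suc m * sqrt (2 * pi))" .
  have "1 * \<bar>conv_pow f (Suc m) 0 - 1 / sqrt (2 * pi * ?n)\<bar> \<le> 2 * pi * \<bar>conv_pow f (Suc m) 0 - 1 / sqrt (2 * pi * ?n)\<bar>"
    using pi_gt3 by (intro mult_right_mono) auto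
  also note *
  finally show ?thesis
    by (simp add: mult_ac del: power_Suc)
qed

end

end

section \<open>A uniform local limit theorem\<close>

text \<open>The rates below only depend on the envelope, so the error term is uniform over all
  standardised densities below it.\<close>

lemma conv_pow_ratio_uniform:
  "\<exists>e. e \<longlonglongrightarrow> 0 \<and> (\<forall>\<^sub>F m in sequentially. \<forall>f. standard_density f C \<kappa> \<longrightarrow>
     0 < conv_pow f (Suc m) 0 \<and>
     (\<forall>y. \<bar>conv_pow f m (- y) / conv_pow f (Suc m) 0 - 1\<bar> \<le> e m * (1 + \<bar>y\<bar>)))"
\<comment> \<open>Without such a density the claim is vacuous. With one, \<open>third_nonneg\<close>
  becomes available, although the constant itself does not involve the density.\<close>
proof (cases "\<exists>f. standard_density f C \<kappa>")
  case True
  then obtain f0 where f0: "standard_density f0 C \<kappa>" by blast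
  define th where "th = standard_density.third C \<kappa>"
  have "0 \<le> th"
    unfolding th_def by (rule standard_density.third_nonneg[OF f0])
  \<comment> \<open>The radius of \<open>cmod_char_near\<close>. The choices of \<open>N\<close> and
    \<open>\<rho>\<close> that follow are dictated by \<open>cmod_char_away\<close> for this
    radius.\<close>
  define \<delta> where "\<delta> = 1 / (th + 1)"
  have \<delta>: "0 < \<delta>" "\<delta> \<le> 1"
    using \<open>0 \<le> th\<close> by (auto simp: \<delta>_def)
  obtain N :: nat where "64 * pi * C / \<delta> < real N"
    using reals_Archimedean2 by blast
  then have "64 * pi * C / \<delta> < real (Suc N)"
    by simp
  then have N: "64 * pi * C < real (Suc N) * \<delta>"
    using \<delta>(1) by (simp add: pos_divide_less_eq)
  define \<rho> where "\<rho> = 1 - 1 / (2 * (real (Suc N))\<^sup>2)"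
  have "0 < 1 - 1 / (2 * X)" "1 - 1 / (2 * X) < 1" if "1 \<le> X" for X :: real
    using that by (auto simp: field_simps)
  from this[of "(real (Suc N))\<^sup>2"] have \<rho>: "0 < \<rho>" "\<rho> < 1"
    by (auto simp: \<rho>_def)
  define q where "q = exp (- \<delta>\<^sup>2 / 2)"
  have q: "0 < q" "q < 1"
    using \<delta> by (auto simp: q_def)
  define G1 :: real where "G1 = (LINT u|lborel. \<bar>u\<bar> ^ 1 * exp (- (1 / 4) * u\<^sup>2))"
  define G3 :: real where "G3 = (LINT u|lborel. \<bar>u\<bar> ^ 3 * exp (- (1 / 4) * u\<^sup>2))"
  define L where "L m = 1 / sqrt (2 * pi * real (m + 2))" for m
  \<comment> \<open>Writing \<open>\<rho> ^ m / \<rho>\<close> for \<open>\<rho> ^ (m - 1)\<close>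
    keeps truncated subtraction out of the limit.\<close>
  define a where "a m = G1 / real (Suc m) + 4 * pi * C * (\<rho> ^ m / \<rho>)" for m
  define b where "b m = (real (m + 2) * (th + 1)) * G3 / (real (Suc m))\<^sup>2 + 2 * pi * C * \<rho> ^ m + q ^ Suc m * sqrt (2 * pi)" for m
  have L_pos: "0 < L m" for m
    by (simp add: L_def)
  have geom: "(\<lambda>m. x ^ m * sqrt (2 * pi * real (m + 2))) \<longlonglongrightarrow> 0" if "0 < x" "x < 1" for x :: real
    using that by real_asymp
  have a_lim: "(\<lambda>m. a m / L m) \<longlonglongrightarrow> 0"
  proof -
    have "(\<lambda>m. G1 * (sqrt (2 * pi * real (m + 2)) / real (Suc m)) + (4 * pi * C / \<rho>) * (\<rho> ^ m * sqrt (2 * pi * real (m + 2)))) \<longlonglongrightarrow> G1 * 0 + (4 * pi * C / \<rho>) * 0"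
      by (intro tendsto_add tendsto_mult tendsto_const geom \<rho>) real_asymp
    then show ?thesis
      by (simp add: a_def L_def field_simps)
  qed
  have b_lim: "(\<lambda>m. b m / L m) \<longlonglongrightarrow> 0"
  proof -
    have "(\<lambda>m. ((th + 1) * G3) * (real (m + 2) * sqrt (2 * pi * real (m + 2)) / (real (Suc m))\<^sup>2)
        + (2 * pi * C) * (\<rho> ^ m * sqrt (2 * pi * real (m + 2)))
        + (q * sqrt (2 * pi)) * (q ^ m * sqrt (2 * pi * real (m + 2)))) \<longlonglongrightarrow> ((th + 1) * G3) * 0 + (2 * pi * C) * 0 + (q * sqrt (2 * pi)) * 0"
      by (intro tendsto_add tendsto_mult tendsto_const geom \<rho> q) real_asymp
    moreover have "(n * v * G / d + B * r + z * p * w) / (1 / S) = (v * G) * (n * S / d) + B * (r * S) + (z * w) * (p * S)"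
      for n v G d B r z p w S :: real
      by (simp add: algebra_simps)
    ultimately show ?thesis
      by (simp only: b_def L_def power_Suc mult_zero_right add_0_right)
  qed
  have ev: "\<forall>\<^sub>F m in sequentially. b m / L m < 1 / 2"
    using order_tendstoD(2)[OF b_lim, of "1 / 2"] by simp
  show ?thesis
  \<comment> \<open>The factor 2 arises since the value at 0 exceeds \<open>L m / 2\<close> as soon
    as \<open>b m / L m < 1 / 2\<close>.\<close>
  proof (intro exI[of _ "\<lambda>m. 2 * (a m / L m)"] conjI)
    show "(\<lambda>m. 2 * (a m / L m)) \<longlonglongrightarrow> 0"
      using tendsto_mult[OF tendsto_const a_lim, of 2] by simp
    show "\<forall>\<^sub>F m in sequentially. \<forall>f. standard_density f C \<kappa> \<longrightarrow>
     0 < conv_pow f (Suc m) 0 \<and>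
     (\<forall>y. \<bar>conv_pow f m (- y) / conv_pow f (Suc m) 0 - 1\<bar> \<le> 2 * (a m / L m) * (1 + \<bar>y\<bar>))"
      using ev eventually_ge_at_top[of 2]
    proof (eventually_elim, intro allI impI)
      fix m f assume m: "b m / L m < 1 / 2" "2 \<le> m" and f: "standard_density f C \<kappa>"
      interpret f: standard_density f C \<kappa> by (rule f)
      have near: "cmod (f.\<phi> u) \<le> exp (- (1 / 4) * u\<^sup>2)" if "\<bar>u\<bar> \<le> \<delta>" for u
        using that unfolding \<delta>_def th_def by (rule f.cmod_char_near)
      have away: "cmod (f.\<phi> u) \<le> \<rho>" if "\<delta> \<le> \<bar>u\<bar>" for u
        unfolding \<rho>_def by (rule f.cmod_char_away[OF \<delta> N that])
      have inc: "\<bar>conv_pow f m (- y) - conv_pow f (Suc m) 0\<bar> \<le> (1 + \<bar>y\<bar>) * a m" for y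
      proof -
        have "\<rho> ^ m / \<rho> = \<rho> ^ (m - 1)"
          using m(2) \<rho> by (cases m) auto
        then show ?thesis
          using f.conv_pow_increment[OF \<delta> near away m(2), of y] unfolding a_def G1_def by simp
      qed
      have "\<bar>conv_pow f (Suc m) 0 - L m\<bar> \<le> b m"
        using f.conv_pow_at_zero[OF \<delta> near away m(2)]
        unfolding b_def G3_def th_def q_def L_def .
      moreover have "b m < L m / 2"
        using m(1) L_pos[of m] by (simp add: field_simps)
      ultimately have J: "L m / 2 < conv_pow f (Suc m) 0"
        by linarith
      then have J_pos: "0 < conv_pow f (Suc m) 0"
        using L_pos[of m] by linarith
      have "\<bar>conv_pow f m (- y) / conv_pow f (Suc m) 0 - 1\<bar> \<le> 2 * (a m / L m) * (1 + \<bar>y\<bar>)" for y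
      proof -
        have "\<bar>conv_pow f m (- y) / conv_pow f (Suc m) 0 - 1\<bar> = \<bar>conv_pow f m (- y) - conv_pow f (Suc m) 0\<bar> / conv_pow f (Suc m) 0"
        proof -
          have "u / J - 1 = (u - J) / J" if "0 < J" for u J :: real
            using that by (simp add: diff_divide_distrib)
          then show ?thesis
            using J_pos by (simp only: abs_divide abs_of_pos)
        qed
        also have "\<dots> \<le> (1 + \<bar>y\<bar>) * a m / (L m / 2)"
          using J L_pos[of m] inc[of y] order_trans[OF abs_ge_zero inc[of y]]
          by (intro frac_le) auto
        finally show ?thesis
          by (simp add: field_simps)
      qed
      with J_pos show "0 < conv_pow f (Suc m) 0 \<and>
        (\<forall>y. \<bar>conv_pow f m (- y) / conv_pow f (Suc m) 0 - 1\<bar> \<le> 2 * (a m / L m) * (1 + \<bar>y\<bar>))"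
        by blast
    qed
  qed
qed (auto intro!: exI[of _ "\<lambda>_. 0"])

section \<open>Convolution powers under tilting and affine substitution\<close>

lemma conv_pow_tilt:
  "conv_pow (\<lambda>x. exp (t * x) * f x / c) k y = exp (t * y) * conv_pow f k y / c ^ Suc k"
proof (induction k arbitrary: y)
  case (Suc k)
  have "conv_pow (\<lambda>x. exp (t * x) * f x / c) (Suc k) y =
      (LINT x|lborel. (exp (t * y) / c ^ Suc (Suc k)) * (conv_pow f k (y - x) * f x))"
    by (auto simp: conv_def Suc.IH right_diff_distrib exp_diff intro!: Bochner_Integration.integral_cong)
  then show ?case
    unfolding integral_mult_right_zero by (simp add: conv_def)
qed simp

text \<open>Each of the \<open>Suc k\<close> factors contributes one shift \<open>a\<close>, whereas
  the scale leaves a single Jacobian \<open>s\<close>.\<close>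

lemma conv_pow_affine:
  fixes s :: real
  assumes "0 < s"
  shows "conv_pow (\<lambda>y. s * f (a + s * y)) k y = s * conv_pow f k (real (Suc k) * a + s * y)"
proof (induction k arbitrary: y)
  case (Suc k)
  let ?y = "real (Suc (Suc k)) * a + s * y"
  have "s * conv_pow f (Suc k) ?y = s * (\<bar>s\<bar> *\<^sub>R (LINT x|lborel. conv_pow f k (?y - (a + s * x)) * f (a + s * x)))"
    unfolding conv_pow.simps conv_def
    using assms by (intro arg_cong[where f="\<lambda>z. s * z"] lborel_integral_real_affine) simp
  also have "\<dots> = (LINT x|lborel. s * s * (conv_pow f k (?y - (a + s * x)) * f (a + s * x)))"
    unfolding integral_mult_right_zero using assms by simp
  also have "\<dots> = conv_pow (\<lambda>y. s * f (a + s * y)) (Suc k) y"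
    unfolding conv_pow.simps conv_def Suc.IH
    by (intro Bochner_Integration.integral_cong refl) (simp add: algebra_simps)
  finally show ?case ..
qed simp

section \<open>Standardisation of peaked densities\<close>

text \<open>The floor on a unit interval keeps the total mass above 1/A, the envelope bounds the
  moments, and the resulting bound \<open>A\<^sup>2\<close> on the normalised density keeps the
  variance from degenerating. All three depend on \<open>A\<close> and \<open>K\<close> only, so
  \<open>C\<close> and \<open>\<kappa>\<close> can be chosen before \<open>G\<close> and
  \<open>b\<close>.\<close>

lemma standardise_density:
  fixes A K :: real
  assumes "0 < A" "0 < K"
  shows "\<exists>C \<kappa>. \<forall>G b. G \<in> borel_measurable borel \<longrightarrow> (\<forall>z. 0 \<le> G z) \<longrightarrow> (\<forall>z. G z \<le> A * exp (- \<bar>z\<bar> / K)) \<longrightarrow>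
    (\<forall>z\<in>{b..b + 1}. 1 / A \<le> G z) \<longrightarrow>
    (\<exists>\<mu> \<sigma>. 0 < \<sigma> \<and> standard_density (\<lambda>y. \<sigma> * G (\<mu> + \<sigma> * y) / (LINT z|lborel. G z)) C \<kappa>)"
proof -
  define M where "M k = (LINT z|lborel. \<bar>z\<bar> ^ k * exp (- (1 / K) * \<bar>z\<bar>))" for k
  \<comment> \<open>A density bounded by \<open>A\<^sup>2\<close> puts at most 2 \<epsilon> A^2 =
    1/2 of its mass within \<epsilon> of its mean, so its variance is at least
    \<open>\<epsilon>\<^sup>2 / 2\<close>.\<close>
  define \<epsilon> where "\<epsilon> = 1 / (4 * A\<^sup>2)"
  \<comment> \<open>The factors are the largest possible \<sigma>, the height of the normalised
    envelope, and the price of recentring at a mean of size at most \<open>A\<^sup>2 * M 1\<close>.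
    The rate \<open>\<kappa>\<close> uses \<sigma> \<ge> \<epsilon> / 2.\<close>
  define C where "C = sqrt (A\<^sup>2 * M 2) * (A\<^sup>2 * exp (A\<^sup>2 * M 1 / K))"
  define \<kappa> where "\<kappa> = \<epsilon> / 2 / K"
  have "0 < \<epsilon>" "0 < \<kappa>"
    using assms by (auto simp: \<epsilon>_def \<kappa>_def)
  have int_env: "integrable lborel (\<lambda>z. \<bar>z\<bar> ^ k * exp (- (1 / K) * \<bar>z\<bar>))" for k
    using assms by (intro integrable_power_exp) auto
  have M_nonneg: "0 \<le> M k" for k
    unfolding M_def by (intro integral_nonneg_AE AE_I2) auto
  show ?thesis
  proof (rule exI[of _ C], rule exI[of _ \<kappa>], intro allI impI)
    fix G :: "real \<Rightarrow> real" and b :: real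
    assume [measurable]: "G \<in> borel_measurable borel"
      and G_nonneg: "\<forall>z. 0 \<le> G z" and G_le: "\<forall>z. G z \<le> A * exp (- \<bar>z\<bar> / K)"
      and G_ge: "\<forall>z\<in>{b..b + 1}. 1 / A \<le> G z"
    define I where "I = (LINT z|lborel. G z)"
    have int_G: "integrable lborel G"
    proof (rule Bochner_Integration.integrable_bound[OF integrable_mult_right[OF int_env[of 0], of A]])
      show "AE z in lborel. norm (G z) \<le> norm (A * (\<bar>z\<bar> ^ 0 * exp (- (1 / K) * \<bar>z\<bar>)))"
        using G_nonneg G_le \<open>0 < A\<close> by (auto simp: abs_mult)
    qed measurable
    have "1 / A = (LINT z|lborel. indicator {b..b + 1} z * (1 / A))"
      by simp
    also have "\<dots> \<le> I"
      unfolding I_def using G_nonneg G_ge int_G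
      by (intro integral_mono integrable_mult_left integrable_real_indicator) (auto simp: indicator_def)
    finally have I: "1 / A \<le> I" .
    then have "0 < I"
      using \<open>0 < A\<close> by (intro less_le_trans[OF _ I]) auto
    define p where "p = (\<lambda>z. G z / I)"
    have [measurable]: "p \<in> borel_measurable borel"
      unfolding p_def by measurable
    have p_nonneg: "0 \<le> p z" for z
      using G_nonneg \<open>0 < I\<close> by (simp add: p_def)
    have p_le: "p z \<le> A\<^sup>2 * exp (- (1 / K) * \<bar>z\<bar>)" for z
    proof -
      have "p z \<le> G z / (1 / A)"
        unfolding p_def using G_nonneg I \<open>0 < A\<close> \<open>0 < I\<close> by (intro divide_left_mono) auto
      also have "\<dots> \<le> A * exp (- \<bar>z\<bar> / K) / (1 / A)"
        using G_le \<open>0 < A\<close> by (intro divide_right_mono) auto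
      finally show ?thesis
        by (simp add: power2_eq_square mult_ac)
    qed
    have p_le_A: "p z \<le> A\<^sup>2" for z
      using \<open>0 < K\<close> by (intro order_trans[OF p_le] mult_left_le) auto
    have int_p_abs: "integrable lborel (\<lambda>z. \<bar>z\<bar> ^ k * p z)" for k
    proof (rule Bochner_Integration.integrable_bound[OF integrable_mult_right[OF int_env[of k], of "A\<^sup>2"]])
      show "AE z in lborel. norm (\<bar>z\<bar> ^ k * p z) \<le> norm (A\<^sup>2 * (\<bar>z\<bar> ^ k * exp (- (1 / K) * \<bar>z\<bar>)))"
        using mult_left_mono[OF p_le, of "\<bar>_\<bar> ^ k"] p_nonneg by (auto simp: abs_mult mult_ac)
    qed measurable
    have int_p: "integrable lborel (\<lambda>z. z ^ k * p z)" for k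
      by (rule Bochner_Integration.integrable_bound[OF int_p_abs[of k]]) (auto simp: abs_mult power_abs)
    have moment_le: "(LINT z|lborel. \<bar>z\<bar> ^ k * p z) \<le> A\<^sup>2 * M k" for k
    proof -
      have "(LINT z|lborel. \<bar>z\<bar> ^ k * p z) \<le> (LINT z|lborel. A\<^sup>2 * (\<bar>z\<bar> ^ k * exp (- (1 / K) * \<bar>z\<bar>)))"
        using mult_left_mono[OF p_le, of "\<bar>_\<bar> ^ k"]
        by (intro integral_mono int_p_abs integrable_mult_right int_env) (auto simp: mult_ac)
      then show ?thesis
        unfolding M_def by simp
    qed
    have p_total: "(LINT z|lborel. p z) = 1"
      using \<open>0 < I\<close> by (simp add: p_def I_def[symmetric])
    have int_p0: "integrable lborel p"
      using int_p[of 0] by simp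
    define \<mu> where "\<mu> = (LINT z|lborel. z * p z)"
    have "\<bar>\<mu>\<bar> \<le> (LINT z|lborel. \<bar>z\<bar> ^ 1 * p z)"
      unfolding \<mu>_def using int_p_abs[of 1] p_nonneg
      by (intro order_trans[OF integral_abs_bound] integral_mono_AE') (auto simp: abs_mult)
    also have "\<dots> \<le> A\<^sup>2 * M 1"
      by (rule moment_le)
    finally have \<mu>_le: "\<bar>\<mu>\<bar> \<le> A\<^sup>2 * M 1" .
    define v where "v = (LINT z|lborel. (z - \<mu>)\<^sup>2 * p z)"
    have sq: "(z - \<mu>)\<^sup>2 * p z = z ^ 2 * p z + ((- 2 * \<mu>) * (z ^ 1 * p z) + \<mu>\<^sup>2 * p z)" for z
      by (simp add: power2_diff algebra_simps)
    have int_sq: "integrable lborel (\<lambda>z. (z - \<mu>)\<^sup>2 * p z)"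
      unfolding sq by (intro Bochner_Integration.integrable_add integrable_mult_right int_p int_p0)
    have "v = (LINT z|lborel. z ^ 2 * p z) + ((- 2 * \<mu>) * (LINT z|lborel. z ^ 1 * p z) + \<mu>\<^sup>2 * (LINT z|lborel. p z))"
      unfolding v_def sq
      by (simp only: Bochner_Integration.integral_add Bochner_Integration.integrable_add integrable_mult_right int_p int_p0
          integral_mult_right_zero)
    also have "\<dots> = (LINT z|lborel. z ^ 2 * p z) - \<mu>\<^sup>2"
      by (simp add: p_total \<mu>_def[symmetric] power2_eq_square)
    also have "\<dots> \<le> A\<^sup>2 * M 2"
      using moment_le[of 2] zero_le_power2[of \<mu>] by (simp only: power2_abs)
    finally have v_le: "v \<le> A\<^sup>2 * M 2" .
    have v_ge: "\<epsilon>\<^sup>2 / 2 \<le> v"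
    proof -
      \<comment> \<open>Subtracting this cap makes \<open>\<epsilon>\<^sup>2 * p z\<close>
        nonpositive close to the mean, so the variance integrand dominates the difference
        everywhere.\<close>
      let ?i = "\<lambda>z. indicator {\<mu> - \<epsilon>..\<mu> + \<epsilon>} z * (\<epsilon>\<^sup>2 * A\<^sup>2)"
      have int_i: "integrable lborel ?i"
        using \<open>0 < \<epsilon>\<close> by (intro integrable_mult_left integrable_real_indicator) auto
      have "\<epsilon>\<^sup>2 - 2 * \<epsilon> * (\<epsilon>\<^sup>2 * A\<^sup>2) = (LINT z|lborel. \<epsilon>\<^sup>2 * p z) - (LINT z|lborel. ?i z)"
        using \<open>0 < \<epsilon>\<close> by (simp add: p_total)
      also have "\<dots> = (LINT z|lborel. \<epsilon>\<^sup>2 * p z - ?i z)"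
        by (intro Bochner_Integration.integral_diff[symmetric] integrable_mult_right int_p0 int_i)
      also have "\<dots> \<le> v"
        unfolding v_def
      proof (intro integral_mono Bochner_Integration.integrable_diff integrable_mult_right int_p0 int_i int_sq)
        fix z
        show "\<epsilon>\<^sup>2 * p z - ?i z \<le> (z - \<mu>)\<^sup>2 * p z"
        proof (cases "z \<in> {\<mu> - \<epsilon>..\<mu> + \<epsilon>}")
          case True
          then show ?thesis
            using mult_left_mono[OF p_le_A[of z], of "\<epsilon>\<^sup>2"] mult_nonneg_nonneg[OF zero_le_power2 p_nonneg, of "z - \<mu>" z]
            by simp
        next
          case False
          then have "\<epsilon> \<le> \<bar>z - \<mu>\<bar>" by auto
          then have "\<epsilon>\<^sup>2 \<le> (z - \<mu>)\<^sup>2"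
            using \<open>0 < \<epsilon>\<close> power_mono[of \<epsilon> "\<bar>z - \<mu>\<bar>" 2] by simp
          then show ?thesis
            using False p_nonneg[of z] by (simp add: mult_right_mono)
        qed
      qed
      finally show ?thesis
        using \<open>0 < A\<close> by (simp add: \<epsilon>_def field_simps power2_eq_square)
    qed
    define \<sigma> where "\<sigma> = sqrt v"
    have "0 < v"
      using v_ge \<open>0 < \<epsilon>\<close> by (intro less_le_trans[OF _ v_ge]) simp
    then have "0 < \<sigma>" and \<sigma>_sq: "\<sigma>\<^sup>2 = v"
      by (auto simp: \<sigma>_def)
    have \<sigma>_ge: "\<epsilon> / 2 \<le> \<sigma>"
      unfolding \<sigma>_def
    proof (rule real_le_rsqrt)
      have "(\<epsilon> / 2)\<^sup>2 \<le> \<epsilon>\<^sup>2 / 2"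
        by (simp add: power_divide)
      then show "(\<epsilon> / 2)\<^sup>2 \<le> v"
        using v_ge by linarith
    qed
    have \<sigma>_le: "\<sigma> \<le> sqrt (A\<^sup>2 * M 2)"
      unfolding \<sigma>_def using v_le by (rule real_sqrt_le_mono)
    define f where "f = (\<lambda>y. \<sigma> * p (\<mu> + \<sigma> * y))"
    have moments: "(LINT y|lborel. f y * y ^ k) = (LINT z|lborel. p z * ((z - \<mu>) / \<sigma>) ^ k)" for k
    proof -
      have "(LINT z|lborel. p z * ((z - \<mu>) / \<sigma>) ^ k) =
          \<bar>\<sigma>\<bar> *\<^sub>R (LINT y|lborel. p (\<mu> + \<sigma> * y) * ((\<mu> + \<sigma> * y - \<mu>) / \<sigma>) ^ k)"
        using \<open>0 < \<sigma>\<close> by (intro lborel_integral_real_affine) simp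
      also have "\<dots> = \<sigma> * (LINT y|lborel. p (\<mu> + \<sigma> * y) * y ^ k)"
        using \<open>0 < \<sigma>\<close> by simp
      also have "\<dots> = (LINT y|lborel. f y * y ^ k)"
        unfolding f_def integral_mult_right_zero[symmetric] by (simp only: mult.assoc)
      finally show ?thesis ..
    qed
    have env: "f y \<le> C * exp (- \<kappa> * \<bar>y\<bar>)" for y
    proof -
      have "\<sigma> * \<bar>y\<bar> \<le> \<bar>\<mu> + \<sigma> * y\<bar> + \<bar>\<mu>\<bar>"
        using abs_triangle_ineq4[of "\<mu> + \<sigma> * y" \<mu>] \<open>0 < \<sigma>\<close> by (simp add: abs_mult)
      moreover have "\<epsilon> / 2 * \<bar>y\<bar> \<le> \<sigma> * \<bar>y\<bar>"
        using \<sigma>_ge by (rule mult_right_mono) simp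
      ultimately have "\<epsilon> / 2 * \<bar>y\<bar> \<le> \<bar>\<mu> + \<sigma> * y\<bar> + A\<^sup>2 * M 1"
        using \<mu>_le by linarith
      then have "\<epsilon> / 2 * \<bar>y\<bar> / K \<le> (\<bar>\<mu> + \<sigma> * y\<bar> + A\<^sup>2 * M 1) / K"
        using \<open>0 < K\<close> by (intro divide_right_mono) auto
      then have "- (1 / K) * \<bar>\<mu> + \<sigma> * y\<bar> \<le> A\<^sup>2 * M 1 / K + - \<kappa> * \<bar>y\<bar>"
        by (simp add: \<kappa>_def add_divide_distrib)
      then have *: "exp (- (1 / K) * \<bar>\<mu> + \<sigma> * y\<bar>) \<le> exp (A\<^sup>2 * M 1 / K) * exp (- \<kappa> * \<bar>y\<bar>)"
        by (simp only: exp_add[symmetric] exp_le_cancel_iff)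
      have "f y \<le> \<sigma> * (A\<^sup>2 * exp (- (1 / K) * \<bar>\<mu> + \<sigma> * y\<bar>))"
        unfolding f_def using \<open>0 < \<sigma>\<close> by (intro mult_left_mono p_le) simp
      also have "\<dots> \<le> sqrt (A\<^sup>2 * M 2) * (A\<^sup>2 * (exp (A\<^sup>2 * M 1 / K) * exp (- \<kappa> * \<bar>y\<bar>)))"
        using \<sigma>_le * \<open>0 < \<sigma>\<close> M_nonneg[of 2] by (intro mult_mono) auto
      finally show ?thesis
        by (simp add: C_def mult_ac)
    qed
    have "0 \<le> C"
      using M_nonneg by (simp add: C_def)
    have "standard_density f C \<kappa>"
    proof unfold_locales
      show "f \<in> borel_measurable borel"
        unfolding f_def by measurable
      show "0 \<le> f x" for x
        unfolding f_def using p_nonneg \<open>0 < \<sigma>\<close> by simp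
      show "f x \<le> C * exp (- \<kappa> * \<bar>x\<bar>)" for x
        by (rule env)
      show "f x \<le> C" for x
        using \<open>0 \<le> C\<close> \<open>0 < \<kappa>\<close> by (intro order_trans[OF env]) (auto intro!: mult_left_le)
      show "(LINT x|lborel. f x) = 1"
        using moments[of 0] p_total by simp
      have "(LINT x|lborel. f x * x) = (LINT z|lborel. (z * p z - \<mu> * p z) / \<sigma>)"
        using moments[of 1] by (simp add: algebra_simps)
      also have "\<dots> = 0"
        using int_p[of 1] int_p0 by (simp add: p_total \<mu>_def[symmetric])
      finally show "(LINT x|lborel. f x * x) = 0" .
      have "(LINT x|lborel. f x * x\<^sup>2) = (LINT z|lborel. (z - \<mu>)\<^sup>2 * p z / \<sigma>\<^sup>2)"
        using moments[of 2] by (simp add: power_divide mult.commute)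
      also have "\<dots> = 1"
        using \<open>0 < v\<close> by (simp add: \<sigma>_sq v_def[symmetric])
      finally show "(LINT x|lborel. f x * x\<^sup>2) = 1" .
    qed fact
    moreover have "f = (\<lambda>y. \<sigma> * G (\<mu> + \<sigma> * y) / (LINT z|lborel. G z))"
      by (simp add: f_def p_def I_def)
    ultimately show "\<exists>\<mu> \<sigma>. 0 < \<sigma> \<and> standard_density (\<lambda>y. \<sigma> * G (\<mu> + \<sigma> * y) / (LINT z|lborel. G z)) C \<kappa>"
      using \<open>0 < \<sigma>\<close> by blast
  qed
qed

text \<open>The scale \<open>w\<close> is the width of the level set on which \<open>D\<close> is within 1 of its maximum.\<close>

lemma concave_peak:
  fixes D :: "real \<Rightarrow> real"
  assumes cont: "continuous_on {x0..} D" and conc: "convex_on {x0..} (\<lambda>x. - D x)"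
    and lim: "filterlim D at_bot at_top"
    and rise: "D x0 + 1 \<le> D (x0 + 1)" and left: "\<And>x. x \<in> {x0..x0 + 1} \<Longrightarrow> D x \<le> D (x0 + 1)"
  obtains xs \<alpha> w where "x0 + 1 \<le> xs" "0 < w" "x0 \<le> \<alpha>"
    "\<And>x. x0 \<le> x \<Longrightarrow> D x \<le> D xs + 1 - \<bar>x - xs\<bar> / w"
    "\<And>x. x \<in> {\<alpha>..\<alpha> + w} \<Longrightarrow> D xs - 1 \<le> D x"
proof -
  have concD: "(1 - s) * D x + s * D y \<le> D ((1 - s) * x + s * y)"
    if "x0 \<le> x" "x0 \<le> y" "0 \<le> s" "s \<le> 1" for x y s
    using convex_onD[OF conc that(3,4), of x y] that(1,2) by simp
  have "\<forall>\<^sub>F x in at_top. D x \<le> D (x0 + 1) - 2"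
    using lim by (auto simp: filterlim_at_bot)
  then obtain X where X: "\<And>x. X \<le> x \<Longrightarrow> D x \<le> D (x0 + 1) - 2"
    by (auto simp: eventually_at_top_linorder)
  define Y where "Y = max X (x0 + 1)"
  have "\<exists>x\<in>{x0 + 1..Y}. \<forall>y\<in>{x0 + 1..Y}. D y \<le> D x"
    by (rule continuous_attains_sup) (auto simp: Y_def intro: continuous_on_subset[OF cont])
  then obtain xs where xs: "xs \<in> {x0 + 1..Y}" and xs_max: "\<And>y. y \<in> {x0 + 1..Y} \<Longrightarrow> D y \<le> D xs"
    by blast
  have max: "D x \<le> D xs" if "x0 \<le> x" for x
  proof -
    have 1: "D (x0 + 1) \<le> D xs"
      by (rule xs_max) (simp add: Y_def)
    consider "x \<le> x0 + 1" | "x \<in> {x0 + 1..Y}" | "X \<le> x"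
      by (cases "x \<le> x0 + 1"; cases "X \<le> x") (auto simp: Y_def)
    then show ?thesis
      using 1 left[of x] xs_max[of x] X[of x] that by cases auto
  qed
  \<comment> \<open>The assumed rise by 1 on the first unit interval ensures that the level
    \<open>D xs - 1\<close> is reached inside the domain to the left of the peak.\<close>
  have "D x0 \<le> D xs - 1"
    using rise max[of "x0 + 1"] by simp
  moreover have "continuous_on {x0..xs} D"
    by (rule continuous_on_subset[OF cont]) auto
  ultimately have "\<exists>x\<ge>x0. x \<le> xs \<and> D x = D xs - 1"
    using xs by (intro IVT') auto
  then obtain \<alpha> where \<alpha>: "x0 \<le> \<alpha>" "\<alpha> \<le> xs" "D \<alpha> = D xs - 1" by blast
  have "xs \<le> Y + 1" "D (Y + 1) \<le> D xs - 1"
  proof -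
    have "X \<le> Y + 1"
      by (simp add: Y_def max_def)
    then show "D (Y + 1) \<le> D xs - 1"
      using X[of "Y + 1"] max[of "x0 + 1"] by simp
  qed (use xs in simp)
  moreover have "continuous_on {xs..Y + 1} D"
    using xs by (intro continuous_on_subset[OF cont]) auto
  ultimately have "\<exists>x\<ge>xs. x \<le> Y + 1 \<and> D x = D xs - 1"
    by (intro IVT2') auto
  then obtain \<beta> where \<beta>: "xs \<le> \<beta>" "D \<beta> = D xs - 1" by blast
  have "\<alpha> \<noteq> xs" "\<beta> \<noteq> xs"
    using \<alpha>(3) \<beta>(2) by auto
  then have less: "\<alpha> < xs" "xs < \<beta>"
    using \<alpha>(2) \<beta>(1) by auto
  define w where "w = \<beta> - \<alpha>"
  have "0 < w"
    using less by (simp add: w_def)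
  \<comment> \<open>Here \<gamma> stands for \<alpha> or \<beta>, lying between the peak and
    \<open>x\<close>. A drop of 1 within distance \<open>w\<close> of the peak forces, by concavity,
    an average slope of at least 1/w all the way out to \<open>x\<close>.\<close>
  have decay: "D x \<le> D xs - \<bar>x - xs\<bar> / w"
    if "x0 \<le> x" "x0 \<le> \<gamma>" "D \<gamma> = D xs - 1" "\<gamma> = (1 - s) * xs + s * x" "0 < s" "s \<le> 1" "\<bar>\<gamma> - xs\<bar> \<le> w" for x \<gamma> s
  proof -
    have "(1 - s) * D xs + s * D x \<le> D xs - 1"
      using concD[of xs x s] that xs by auto
    then have "1 / s \<le> D xs - D x"
      using \<open>0 < s\<close> by (simp add: field_simps)
    moreover have "\<gamma> - xs = s * (x - xs)"
      by (simp add: that(4) algebra_simps)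
    then have "\<bar>\<gamma> - xs\<bar> = s * \<bar>x - xs\<bar>"
      using \<open>0 < s\<close> by (simp only: abs_mult abs_of_pos)
    then have "s * \<bar>x - xs\<bar> \<le> w"
      using that(7) by simp
    then have "\<bar>x - xs\<bar> / w \<le> 1 / s"
      using \<open>0 < s\<close> \<open>0 < w\<close> by (simp add: field_simps)
    ultimately show ?thesis by linarith
  qed
  have interp: "\<gamma> = (1 - s) * xs + s * x" if "s * (x - xs) = \<gamma> - xs" for \<gamma> s x
    using that by (simp add: algebra_simps)
  show ?thesis
  proof
    show "x0 + 1 \<le> xs" "0 < w" "x0 \<le> \<alpha>"
      using xs \<open>0 < w\<close> \<alpha>(1) by auto
    show "D x \<le> D xs + 1 - \<bar>x - xs\<bar> / w" if "x0 \<le> x" for x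
    proof -
      consider "x < \<alpha>" | "\<alpha> \<le> x" "x \<le> \<beta>" | "\<beta> < x" by linarith
      then show ?thesis
      proof cases
        case 1
        have "D x \<le> D xs - \<bar>x - xs\<bar> / w"
        proof (rule decay[OF that \<alpha>(1,3), of "(\<alpha> - xs) / (x - xs)"])
          show "\<alpha> = (1 - (\<alpha> - xs) / (x - xs)) * xs + (\<alpha> - xs) / (x - xs) * x"
            using 1 less by (intro interp) simp
        qed (use 1 less in \<open>auto simp: w_def divide_le_eq_1 zero_less_divide_iff\<close>)
        then show ?thesis by simp
      next
        \<comment> \<open>Between \<alpha> and \<beta> the distance to the peak is at most
          \<open>w\<close>; the summand 1 in the claim absorbs it.\<close>
        case 2
        then have "\<bar>x - xs\<bar> / w \<le> 1"
          using less \<open>0 < w\<close> by (simp add: w_def)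
        then show ?thesis
          using max[OF that] by linarith
      next
        case 3
        have "D x \<le> D xs - \<bar>x - xs\<bar> / w"
        proof (rule decay[OF that _ \<beta>(2), of "(\<beta> - xs) / (x - xs)"])
          show "\<beta> = (1 - (\<beta> - xs) / (x - xs)) * xs + (\<beta> - xs) / (x - xs) * x"
            using 3 less by (intro interp) simp
        qed (use 3 less \<alpha>(1) in \<open>auto simp: w_def\<close>)
        then show ?thesis by simp
      qed
    qed
    show "D xs - 1 \<le> D x" if "x \<in> {\<alpha>..\<alpha> + w}" for x
    proof -
      define s where "s = (x - \<alpha>) / w"
      have s: "0 \<le> s" "s \<le> 1"
        using that \<open>0 < w\<close> by (auto simp: s_def)
      have "s * w = x - \<alpha>"
        using \<open>0 < w\<close> by (simp add: s_def)
      then have x: "x = (1 - s) * \<alpha> + s * \<beta>"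
        by (simp add: w_def algebra_simps)
      have "(1 - s) * D \<alpha> + s * D \<beta> \<le> D x"
        unfolding x using \<alpha>(1) less s by (intro concD) auto
      then show ?thesis
        by (simp add: \<alpha>(3) \<beta>(2) algebra_simps)
    qed
  qed
qed

section \<open>Exponential tilting\<close>

lemma exp_minus_one_minus_le:
  fixes y :: real
  shows "\<bar>exp y - 1 - y\<bar> \<le> y\<^sup>2 * exp \<bar>y\<bar>"
proof -
  have lower: "1 + z \<le> exp z" for z :: real
    by (rule exp_ge_add_one_self)
  have "exp y - 1 = exp y * (1 - exp (- y))"
    by (simp add: right_diff_distrib flip: exp_add)
  also have "\<dots> \<le> exp y * y"
    using lower[of "- y"] by (intro mult_left_mono) auto
  finally have 1: "exp y - 1 - y \<le> y * (exp y - 1)"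
    by (simp add: algebra_simps)
  have "y * (exp y - 1) \<le> y\<^sup>2 * exp \<bar>y\<bar>"
  proof (cases "0 \<le> y")
    case True
    then have "exp y - 1 \<le> y * exp y"
      using \<open>exp y - 1 = _\<close> \<open>_ \<le> exp y * y\<close> by (simp add: mult.commute)
    then show ?thesis
      using True mult_left_mono[of "exp y - 1" "y * exp y" y] by (simp add: power2_eq_square mult.assoc)
  next
    case False
    then have "y * (exp y - 1) = (- y) * (1 - exp y)"
      by (simp add: algebra_simps)
    also have "\<dots> \<le> (- y) * (- y)"
      using False lower[of y] by (intro mult_left_mono) linarith+
    also have "\<dots> \<le> y\<^sup>2 * exp \<bar>y\<bar>"
      using mult_left_mono[of 1 "exp \<bar>y\<bar>" "y\<^sup>2"] by (simp add: power2_eq_square)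
    finally show ?thesis .
  qed
  with 1 lower[of y] show ?thesis
    by linarith
qed

text \<open>Beyond \<open>x0\<close> the factor exp(q) lies between exp(-1) and exp(1), which is
  where these constants come from, and \<open>h_mono\<close> encodes convexity of \<open>g\<close>
  there. On [0, x0) the available information is positivity and the bound \<open>B\<close>.\<close>

locale convex_tail_density = bounded_density p B
  for p g h :: "real \<Rightarrow> real" and B c x0 :: real +
  assumes zero: "x < 0 \<Longrightarrow> p x = 0"
    and positive: "0 \<le> x \<Longrightarrow> 0 < p x"
    and c_pos: "0 < c" and x0_pos: "0 < x0"
    and tail_lower: "x0 \<le> x \<Longrightarrow> c * exp (- 1) * exp (- g x) \<le> p x"
    and tail_upper: "x0 \<le> x \<Longrightarrow> p x \<le> c * exp 1 * exp (- g x)"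
    and g_deriv: "x0 \<le> x \<Longrightarrow> (g has_real_derivative h x) (at x)"
    and h_mono: "x0 \<le> x \<Longrightarrow> x \<le> y \<Longrightarrow> h x \<le> h y"
    and g_superlinear: "filterlim (\<lambda>x. g x / x) at_top at_top"
begin

lemma g_ge: "\<exists>X\<ge>x0. \<forall>x\<ge>X. r * x \<le> g x"
proof -
  have "\<forall>\<^sub>F x in at_top. r \<le> g x / x"
    using g_superlinear by (auto simp: filterlim_at_top)
  then obtain X where X: "\<And>x. X \<le> x \<Longrightarrow> r \<le> g x / x"
    by (auto simp: eventually_at_top_linorder)
  show ?thesis
  proof (intro exI[of _ "max x0 X"] conjI allI impI)
    fix x assume "max x0 X \<le> x"
    then show "r * x \<le> g x"
      using X[of x] x0_pos by (simp add: pos_le_divide_eq)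
  qed simp
qed

text \<open>Superlinear growth of \<open>g\<close> beats the exponent \<open>r\<close> beyond some
  point, and before it the bound \<open>B\<close> is inflated. Since \<open>r\<close> is arbitrary,
  tilted moments of all orders exist for every real tilt.\<close>

lemma exponential_decay: "\<exists>A. \<forall>x\<ge>0. p x \<le> A * exp (- r * x)"
proof -
  obtain X where X: "x0 \<le> X" "\<And>x. X \<le> x \<Longrightarrow> r * x \<le> g x"
    using g_ge[of r] by blast
  define A where "A = max (c * exp 1) (B * exp (\<bar>r\<bar> * X))"
  show ?thesis
  proof (intro exI[of _ A] allI impI)
    fix x :: real assume "0 \<le> x"
    show "p x \<le> A * exp (- r * x)"
    proof (cases "X \<le> x")
      case True
      have "p x \<le> c * exp 1 * exp (- g x)"
        using True X(1) by (intro tail_upper) simp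
      also have "\<dots> \<le> A * exp (- r * x)"
        using X(2)[OF True] c_pos by (intro mult_mono) (auto simp: A_def intro: le_max_iff_disj[THEN iffD2])
      finally show ?thesis .
    next
      case False
      have "r * x \<le> \<bar>r\<bar> * X"
        using False \<open>0 \<le> x\<close> by (intro mult_mono) auto
      then have "B * 1 \<le> B * (exp (\<bar>r\<bar> * X) * exp (- r * x))"
        using bound_nonneg by (intro mult_left_mono) (auto simp flip: exp_add)
      also have "\<dots> \<le> A * exp (- r * x)"
        unfolding mult.assoc[symmetric] by (intro mult_right_mono) (auto simp: A_def)
      finally show ?thesis
        using bounded[of x] by simp
    qed
  qed
qed

lemma integrable_tilt: "integrable lborel (\<lambda>x. x ^ k * (exp (t * x) * p x))"
proof -
  obtain A where A: "\<And>x. 0 \<le> x \<Longrightarrow> p x \<le> A * exp (- (t + 1) * x)"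
    using exponential_decay[of "t + 1"] by blast
  have "0 \<le> A"
    using A[of 0] nonneg[of 0] by simp
  show ?thesis
  proof (rule Bochner_Integration.integrable_bound)
    show "integrable lborel (\<lambda>x. A * (\<bar>x\<bar> ^ k * exp (- 1 * \<bar>x\<bar>)))"
      by (intro integrable_mult_right integrable_power_exp) simp
    have "\<bar>x\<bar> ^ k * (exp (t * x) * p x) \<le> A * (\<bar>x\<bar> ^ k * exp (- 1 * \<bar>x\<bar>))" for x
    proof (cases "0 \<le> x")
      case True
      have "exp (t * x) * p x \<le> exp (t * x) * (A * exp (- (t + 1) * x))"
        by (intro mult_left_mono A True) simp
      also have "\<dots> = A * exp (t * x + - (t + 1) * x)"
        by (simp only: exp_add mult.left_commute)
      also have "t * x + - (t + 1) * x = - 1 * \<bar>x\<bar>"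
        using True by (simp add: algebra_simps)
      finally have "\<bar>x\<bar> ^ k * (exp (t * x) * p x) \<le> \<bar>x\<bar> ^ k * (A * exp (- 1 * \<bar>x\<bar>))"
        by (rule mult_left_mono) simp
      then show ?thesis
        by (simp add: mult_ac)
    qed (use zero \<open>0 \<le> A\<close> in simp)
    then show "AE x in lborel. norm (x ^ k * (exp (t * x) * p x)) \<le> norm (A * (\<bar>x\<bar> ^ k * exp (- 1 * \<bar>x\<bar>)))"
      using nonneg \<open>0 \<le> A\<close> by (auto simp: abs_mult power_abs)
  qed measurable
qed

definition \<Phi> :: "real \<Rightarrow> real" where
  "\<Phi> t = (LINT x|lborel. exp (t * x) * p x)"

definition first_moment :: "real \<Rightarrow> real" where
  "first_moment t = (LINT x|lborel. x * (exp (t * x) * p x))"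

lemma integrable_tilt0: "integrable lborel (\<lambda>x. exp (t * x) * p x)"
  using integrable_tilt[of 0] by simp

lemma integrable_tilt1: "integrable lborel (\<lambda>x. x * (exp (t * x) * p x))"
  using integrable_tilt[of 1] by simp

text \<open>A vanishing integral would make \<open>u\<close>, and with it \<open>p\<close>, zero
  almost everywhere. The exceptional point \<open>b\<close> admits integrands with a single zero, as
  in the monotonicity proof of the tilted mean.\<close>

lemma integral_pos:
  fixes u :: "real \<Rightarrow> real"
  assumes "integrable lborel u" and nonneg_u: "\<And>x. 0 \<le> u x" and pos_u: "\<And>x. 0 \<le> x \<Longrightarrow> x \<noteq> b \<Longrightarrow> 0 < u x"
  shows "0 < (LINT x|lborel. u x)"
proof (rule ccontr)
  assume "\<not> ?thesis"
  moreover have "0 \<le> (LINT x|lborel. u x)"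
    by (intro integral_nonneg_AE AE_I2 nonneg_u)
  ultimately have "(LINT x|lborel. u x) = 0"
    by simp
  then have "AE x in lborel. u x = 0"
    using integral_nonneg_eq_0_iff_AE[OF assms(1)] nonneg_u by auto
  then have "AE x in lborel. p x = 0"
    using AE_lborel_singleton[of b]
  proof eventually_elim
    case (elim x)
    then show ?case
      using pos_u[of x] zero[of x] by fastforce
  qed
  then have "(LINT x|lborel. p x) = (LINT x|(lborel :: real measure). (0 :: real))"
    by (intro integral_cong_AE) auto
  then show False
    using total by simp
qed

lemma Phi_pos: "0 < \<Phi> t"
  unfolding \<Phi>_def
  by (rule integral_pos[OF integrable_tilt0, of _ 0]) (auto simp: nonneg positive)

text \<open>The second-order remainder of exp is integrated directly. For |s| < 1 and x \<ge> 0 its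
  factor exp |s x| is at most exp x, so the second moment of the tilt at \<open>t + 1\<close> bounds
  the error linearly in |s|.\<close>

lemma Phi_has_derivative: "(\<Phi> has_real_derivative first_moment t) (at t)"
  unfolding DERIV_def
proof (rule Lim_null[THEN iffD2], rule Lim_null_comparison)
  define K where "K = (LINT x|lborel. x ^ 2 * (exp ((t + 1) * x) * p x))"
  have "\<forall>\<^sub>F s in at 0. \<bar>s\<bar> < 1 \<and> s \<noteq> (0::real)"
    unfolding eventually_at by (intro exI[of _ 1]) (auto simp: dist_real_def)
  then show "\<forall>\<^sub>F s in at 0. norm ((\<Phi> (t + s) - \<Phi> t) / s - first_moment t) \<le> \<bar>s\<bar> * K"
  proof eventually_elim
    case (elim s)
    have diff_eq: "(\<Phi> (t + s) - \<Phi> t) - s * first_moment t =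
        (LINT x|lborel. (exp ((t + s) * x) * p x - exp (t * x) * p x) - s * (x * (exp (t * x) * p x)))"
      unfolding \<Phi>_def first_moment_def
      by (simp only: Bochner_Integration.integral_diff Bochner_Integration.integrable_diff integrable_mult_right
          integrable_tilt0 integrable_tilt1 integral_mult_right_zero)
    have "\<bar>(\<Phi> (t + s) - \<Phi> t) - s * first_moment t\<bar> \<le> (LINT x|lborel. s\<^sup>2 * (x ^ 2 * (exp ((t + 1) * x) * p x)))"
      unfolding diff_eq
    proof (rule order_trans[OF integral_abs_bound], rule integral_mono)
      fix x
      show "\<bar>(exp ((t + s) * x) * p x - exp (t * x) * p x) - s * (x * (exp (t * x) * p x))\<bar> \<le> s\<^sup>2 * (x ^ 2 * (exp ((t + 1) * x) * p x))"
      proof (cases "0 \<le> x")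
        case True
        have "(exp ((t + s) * x) * p x - exp (t * x) * p x) - s * (x * (exp (t * x) * p x)) =
            (exp (t * x) * p x) * (exp (s * x) - 1 - s * x)"
          by (simp add: algebra_simps exp_add)
        also have "\<bar>\<dots>\<bar> = (exp (t * x) * p x) * \<bar>exp (s * x) - 1 - s * x\<bar>"
          by (simp add: abs_mult nonneg)
        also have "\<dots> \<le> (exp (t * x) * p x) * ((s * x)\<^sup>2 * exp \<bar>s * x\<bar>)"
          by (intro mult_left_mono exp_minus_one_minus_le) (simp add: nonneg)
        also have "\<dots> \<le> (exp (t * x) * p x) * ((s * x)\<^sup>2 * exp x)"
          using elim True nonneg[of x] by (intro mult_left_mono) (auto simp: abs_mult mult_left_le_one_le)
        also have "\<dots> = s\<^sup>2 * (x ^ 2 * (exp ((t + 1) * x) * p x))"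
        proof -
          have "exp ((t + 1) * x) = exp (t * x) * exp x"
            by (simp add: distrib_right exp_add)
          then show ?thesis
            by (simp only: power_mult_distrib mult_ac)
        qed
        finally show ?thesis .
      qed (use zero in simp)
    qed (intro integrable_abs Bochner_Integration.integrable_diff integrable_mult_right integrable_tilt0 integrable_tilt1 integrable_tilt)+
    also have "\<dots> = s\<^sup>2 * K"
      by (simp add: K_def)
    finally have *: "\<bar>(\<Phi> (t + s) - \<Phi> t) - s * first_moment t\<bar> \<le> s\<^sup>2 * K" .
    have "(\<Phi> (t + s) - \<Phi> t) / s - first_moment t = ((\<Phi> (t + s) - \<Phi> t) - s * first_moment t) / s"
      using elim by (simp add: diff_divide_distrib)
    then have "norm ((\<Phi> (t + s) - \<Phi> t) / s - first_moment t) = \<bar>(\<Phi> (t + s) - \<Phi> t) - s * first_moment t\<bar> / \<bar>s\<bar>"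
      by simp
    also have "\<dots> \<le> s\<^sup>2 * K / \<bar>s\<bar>"
      by (intro divide_right_mono *) simp
    also have "\<dots> = \<bar>s\<bar> * K"
      using elim by (simp add: power2_eq_square abs_if)
    finally show ?case .
  qed
  have "((\<lambda>s. \<bar>s\<bar> * K) \<longlongrightarrow> \<bar>0\<bar> * K) (at 0)"
    by (intro tendsto_intros)
  then show "((\<lambda>s. \<bar>s\<bar> * K) \<longlongrightarrow> 0) (at 0)"
    by simp
qed

lemma mgf_eq: "mgf p t = \<Phi> t"
  unfolding mgf_def \<Phi>_def set_lebesgue_integral_def
  by (intro Bochner_Integration.integral_cong refl) (auto simp: indicator_def zero)

lemma tilted_mean_eq: "tilted_mean p t = first_moment t / \<Phi> t"
  unfolding tilted_mean_def mgf_eq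
  by (rule DERIV_imp_deriv) (auto intro!: derivative_eq_intros Phi_has_derivative Phi_pos)

text \<open>A correlation argument: x - a and exp (d x) - exp (d a) have the same sign, and the
  constant exp (d a) integrates to zero because \<open>a\<close> is the mean of the tilt at
  \<open>t1\<close>. Strictness makes the parameter selected in \<open>tilted_density\<close>
  unique.\<close>

lemma tilted_mean_strict_mono: "strict_mono (tilted_mean p)"
proof (rule strict_monoI)
  fix t1 t2 :: real assume "t1 < t2"
  define d where "d = t2 - t1"
  define a where "a = tilted_mean p t1"
  have "0 < d" using \<open>t1 < t2\<close> by (simp add: d_def)
  let ?u = "\<lambda>x. ((x - a) * (exp (d * x) - exp (d * a))) * (exp (t1 * x) * p x)"
  have u_eq: "?u x = (x * (exp (t2 * x) * p x) - a * (exp (t2 * x) * p x)) - exp (d * a) * (x * (exp (t1 * x) * p x) - a * (exp (t1 * x) * p x))" for x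
  proof -
    have "exp (t2 * x) = exp (d * x) * exp (t1 * x)"
      by (simp add: d_def left_diff_distrib flip: exp_add)
    then show ?thesis by (simp add: algebra_simps)
  qed
  have "0 < (LINT x|lborel. ?u x)"
  proof (rule integral_pos[where b=a])
    show "integrable lborel ?u"
      unfolding u_eq
      by (intro Bochner_Integration.integrable_diff integrable_mult_right integrable_tilt0 integrable_tilt1)
    have sign: "0 < (x - a) * (exp (d * x) - exp (d * a))" if "x \<noteq> a" for x
      using that \<open>0 < d\<close> by (cases "a < x") (auto intro: mult_pos_pos mult_neg_neg)
    then show "0 \<le> ?u x" for x
    proof (cases "x = a")
      case False
      show ?thesis
        by (intro mult_nonneg_nonneg[OF less_imp_le[OF sign[OF False]]] mult_nonneg_nonneg nonneg) simp
    qed simp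
    show "0 < ?u x" if "0 \<le> x" "x \<noteq> a" for x
      using sign[OF that(2)] positive[OF that(1)] by simp
  qed
  also have "(LINT x|lborel. ?u x) = (first_moment t2 - a * \<Phi> t2) - exp (d * a) * (first_moment t1 - a * \<Phi> t1)"
    unfolding u_eq \<Phi>_def first_moment_def
    by (simp only: Bochner_Integration.integral_diff Bochner_Integration.integrable_diff integrable_mult_right
        integrable_tilt0 integrable_tilt1 integral_mult_right_zero)
  also have "first_moment t1 - a * \<Phi> t1 = 0"
    using Phi_pos[of t1] by (simp add: a_def tilted_mean_eq)
  finally show "tilted_mean p t1 < tilted_mean p t2"
    using Phi_pos[of t2] by (simp add: tilted_mean_eq[of t2] a_def[symmetric] pos_less_divide_eq)
qed

lemma tilted_density_eq:
  "tilted_mean p t = a \<Longrightarrow> tilted_density p a x = exp (t * x) * p x / \<Phi> t"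
proof -
  assume "tilted_mean p t = a"
  then have "(THE t. tilted_mean p t = a) = t"
    using strict_mono_eq[OF tilted_mean_strict_mono] by blast
  then show ?thesis
    by (simp add: tilted_density_def mgf_eq)
qed

text \<open>\<open>concave_peak\<close> is applied to D x = t x - g x; space is then rescaled around
  the peak by the width \<open>w\<close>, and height by the peak value
  \<open>E = exp (D xs)\<close>.\<close>

lemma tilt_envelope:
  "\<exists>A K T. 0 < A \<and> 0 < K \<and> (\<forall>t\<ge>T. \<exists>xs w b E. 0 < w \<and> 0 < E \<and>
     (\<forall>z. exp (t * (xs + w * z)) * p (xs + w * z) / E \<le> A * exp (- \<bar>z\<bar> / K)) \<and>
     (\<forall>z\<in>{b..b + 1}. 1 / A \<le> exp (t * (xs + w * z)) * p (xs + w * z) / E))"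
proof -
  \<comment> \<open>The peak satisfies xs - x0 \<ge> 1, so a point x of [0, x0) has |x - xs| \<le>
    xs \<le> K (xs - x0). Decay known at \<open>x0\<close> thus yields decay at x with the rate
    divided by \<open>K\<close>.\<close>
  define K where "K = 1 + x0"
  \<comment> \<open>The three entries serve the upper bound beyond \<open>x0\<close>, the upper
    bound on [0, x0), and the lower bound on the level set.\<close>
  define A where "A = max (c * exp 1 * exp 1) (max (B * exp (g x0) * exp 1) (exp 2 / c))"
  have A: "c * exp 1 * exp 1 \<le> A" "B * exp (g x0) * exp 1 \<le> A" "exp 2 / c \<le> A"
    by (auto simp: A_def)
  have "0 < exp 2 / c"
    using c_pos by simp
  then have "0 < A"
    using A(3) by linarith
  have "0 < K"
    using x0_pos by (simp add: K_def)
  have conv: "convex_on {x0..} g"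
    by (rule convex_on_realI[where f'=h]) (auto intro: g_deriv h_mono)
  have g_cont: "continuous_on {x0..} g"
    by (intro continuous_at_imp_continuous_on ballI DERIV_isCont[OF g_deriv]) auto
  have "\<exists>xs w b E. 0 < w \<and> 0 < E \<and>
     (\<forall>z. exp (t * (xs + w * z)) * p (xs + w * z) / E \<le> A * exp (- \<bar>z\<bar> / K)) \<and>
     (\<forall>z\<in>{b..b + 1}. 1 / A \<le> exp (t * (xs + w * z)) * p (xs + w * z) / E)"
    \<comment> \<open>\<open>t\<close> exceeding \<open>h (x0 + 1)\<close> by 1 gives t x - g x
      slope at least 1 on the unit interval after \<open>x0\<close>, placing the peak to its right;
      \<open>0 \<le> t\<close> makes exp (t x) increasing.\<close>
    if t: "max 0 (h (x0 + 1) + 1) \<le> t" for t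
  proof -
    define D where "D = (\<lambda>x. t * x - g x)"
    have rise: "x0 + 1 - x \<le> D (x0 + 1) - D x" if "x \<in> {x0..x0 + 1}" for x
    proof (cases "x = x0 + 1")
      case False
      then have "x < x0 + 1" using that by simp
      then have "\<exists>z>x. z < x0 + 1 \<and> g (x0 + 1) - g x = (x0 + 1 - x) * h z"
        using that by (intro MVT2) (auto intro: g_deriv)
      then obtain z where z: "x < z" "z < x0 + 1" "g (x0 + 1) - g x = (x0 + 1 - x) * h z" by blast
      have "(x0 + 1 - x) * h z \<le> (x0 + 1 - x) * (t - 1)"
        using h_mono[of z "x0 + 1"] z that t by (intro mult_left_mono) auto
      then show ?thesis
        using z(3) by (simp add: D_def algebra_simps)
    qed simp
    obtain xs \<alpha> w where peak: "x0 + 1 \<le> xs" "0 < w" "x0 \<le> \<alpha>"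
      and D_le: "\<And>x. x0 \<le> x \<Longrightarrow> D x \<le> D xs + 1 - \<bar>x - xs\<bar> / w"
      and D_ge: "\<And>x. x \<in> {\<alpha>..\<alpha> + w} \<Longrightarrow> D xs - 1 \<le> D x"
    proof (rule concave_peak[of x0 D])
      show "continuous_on {x0..} D"
        unfolding D_def by (intro continuous_intros g_cont)
      show "convex_on {x0..} (\<lambda>x. - D x)"
      proof -
        have "convex_on {x0..} (\<lambda>x. (- t) * x)"
          by (intro convex_on_realI[where f'="\<lambda>_. - t"]) (auto intro!: derivative_eq_intros)
        from convex_on_add[OF conv this] show ?thesis
          by (simp add: D_def)
      qed
      show "filterlim D at_bot at_top"
        unfolding filterlim_at_bot
      proof
        fix Z
        obtain X where X: "x0 \<le> X" "\<And>x. X \<le> x \<Longrightarrow> (t + 1) * x \<le> g x"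
          using g_ge[of "t + 1"] by blast
        show "\<forall>\<^sub>F x in at_top. D x \<le> Z"
          using eventually_ge_at_top[of X] eventually_ge_at_top[of "- Z"]
        proof eventually_elim
          case (elim x)
          then show ?case
            using X(2)[of x] by (simp add: D_def algebra_simps)
        qed
      qed
      show "D x0 + 1 \<le> D (x0 + 1)"
        using rise[of x0] by simp
      show "D x \<le> D (x0 + 1)" if "x \<in> {x0..x0 + 1}" for x
        using rise[OF that] that by simp
    qed (use that in blast)
    define E where "E = exp (D xs)"
    have tilt: "exp (t * x) * exp (- g x) = exp (D x)" for x
      by (simp add: D_def flip: exp_add)
    have upper: "exp (t * x) * p x \<le> A * exp (- (\<bar>x - xs\<bar> / w) / K) * E" for x
    proof -
      consider "x < 0" | "0 \<le> x" "x < x0" | "x0 \<le> x" by linarith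
      then show ?thesis
      proof cases
        case 1
        then show ?thesis
          using zero[of x] \<open>0 < A\<close> by (simp add: E_def)
      next
        case 2
        have "\<bar>x - xs\<bar> \<le> K * (xs - x0)"
        proof -
          have "\<bar>x - xs\<bar> \<le> xs"
            using 2 peak(1) by simp
          also have "\<dots> = (xs - x0) + x0 * 1"
            by simp
          also have "\<dots> \<le> (xs - x0) + x0 * (xs - x0)"
            using peak(1) x0_pos by (intro add_left_mono mult_left_mono) auto
          finally show ?thesis
            by (simp add: K_def algebra_simps)
        qed
        then have "\<bar>x - xs\<bar> / w / K \<le> (xs - x0) / w"
          using \<open>0 < K\<close> peak(2) by (simp add: field_simps)
        then have Dx0: "D x0 \<le> D xs + 1 + - (\<bar>x - xs\<bar> / w) / K"
          using D_le[of x0] peak(1) by simp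
        \<comment> \<open>To the left of \<open>x0\<close> the estimate is transferred to
          \<open>x0\<close> itself, where the bound on \<open>D\<close> applies.\<close>
        have "exp (t * x) * p x \<le> exp (t * x0) * B"
        proof (intro mult_mono bounded)
          show "exp (t * x) \<le> exp (t * x0)"
            using 2 t by (simp add: mult_left_mono)
        qed (auto simp: nonneg)
        also have "\<dots> = B * exp (g x0) * exp (D x0)"
          by (simp add: D_def flip: exp_add)
        also have "\<dots> \<le> B * exp (g x0) * exp (D xs + 1 + - (\<bar>x - xs\<bar> / w) / K)"
          using Dx0 bound_nonneg by (intro mult_left_mono) auto
        also have "\<dots> = B * exp (g x0) * exp 1 * exp (- (\<bar>x - xs\<bar> / w) / K) * E"
          by (simp only: E_def exp_add mult_ac)
        also have "\<dots> \<le> A * exp (- (\<bar>x - xs\<bar> / w) / K) * E"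
          using A(2) by (intro mult_right_mono) (auto simp: E_def)
        finally show ?thesis .
      next
        case 3
        have "exp (t * x) * p x \<le> exp (t * x) * (c * exp 1 * exp (- g x))"
          by (intro mult_left_mono tail_upper 3) simp
        also have "\<dots> = c * exp 1 * exp (D x)"
          by (simp flip: tilt)
        also have "\<dots> \<le> c * exp 1 * exp (D xs + 1 + - (\<bar>x - xs\<bar> / w) / K)"
        proof (intro mult_left_mono exp_le_cancel_iff[THEN iffD2])
          have "\<bar>x - xs\<bar> / w / K \<le> \<bar>x - xs\<bar> / w"
            using divide_left_mono[of 1 K "\<bar>x - xs\<bar> / w"] x0_pos peak(2) by (simp add: K_def)
          then show "D x \<le> D xs + 1 + - (\<bar>x - xs\<bar> / w) / K"
            using D_le[OF 3] by simp
        qed (use c_pos in simp)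
        also have "\<dots> = c * exp 1 * exp 1 * exp (- (\<bar>x - xs\<bar> / w) / K) * E"
          by (simp only: E_def exp_add mult_ac)
        also have "\<dots> \<le> A * exp (- (\<bar>x - xs\<bar> / w) / K) * E"
          using A(1) by (intro mult_right_mono) (auto simp: E_def)
        finally show ?thesis .
      qed
    qed
    have lower: "1 / A * E \<le> exp (t * x) * p x" if x: "x \<in> {\<alpha>..\<alpha> + w}" for x
    proof -
      have "1 / A \<le> c / exp 2"
        using A(3) \<open>0 < A\<close> c_pos by (simp add: field_simps)
      then have "1 / A * E \<le> c / exp 2 * E"
        by (intro mult_right_mono) (auto simp: E_def)
      also have "\<dots> = c * exp (- 1) * exp (D xs - 1)"
        by (simp add: E_def exp_minus exp_diff field_simps flip: exp_add)
      also have "\<dots> \<le> c * exp (- 1) * exp (D x)"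
        using D_ge[OF x] c_pos by (intro mult_left_mono) auto
      also have "\<dots> = exp (t * x) * (c * exp (- 1) * exp (- g x))"
        by (simp flip: tilt)
      also have "\<dots> \<le> exp (t * x) * p x"
        using x peak(3) by (intro mult_left_mono tail_lower) auto
      finally show ?thesis .
    qed
    have "0 < E" by (simp add: E_def)
    show ?thesis
    proof (rule exI[of _ xs], rule exI[of _ w], rule exI[of _ "(\<alpha> - xs) / w"], rule exI[of _ E], intro conjI allI ballI)
      show "exp (t * (xs + w * z)) * p (xs + w * z) / E \<le> A * exp (- \<bar>z\<bar> / K)" for z
        using upper[of "xs + w * z"] peak(2) \<open>0 < E\<close> by (simp add: pos_divide_le_eq abs_mult)
      show "1 / A \<le> exp (t * (xs + w * z)) * p (xs + w * z) / E" if "z \<in> {(\<alpha> - xs) / w..(\<alpha> - xs) / w + 1}" for z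
      proof -
        have "xs + w * z \<in> {\<alpha>..\<alpha> + w}"
          using that peak(2) by (auto simp: field_simps)
        from lower[OF this] show ?thesis
          using \<open>0 < E\<close> by (simp add: pos_le_divide_eq)
      qed
    qed (use peak(2) \<open>0 < E\<close> in auto)
  qed
  then show ?thesis
    using \<open>0 < A\<close> \<open>0 < K\<close> by blast
qed

text \<open>Composes the rescaling of \<open>tilt_envelope\<close> with that of
  \<open>standardise_density\<close>. The resulting centre must be \<open>tilted_mean p t\<close>,
  since a standardised density has mean zero; the scale \<open>s\<close> needs no formula.\<close>

lemma standard_density_tilt:
  "\<exists>C \<kappa> T. \<forall>t\<ge>T. \<exists>s>0. standard_density
     (\<lambda>y. s * (exp (t * (tilted_mean p t + s * y)) * p (tilted_mean p t + s * y) / \<Phi> t)) C \<kappa>"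
proof -
  obtain A K T where "0 < A" "0 < K" and env: "\<And>t. T \<le> t \<Longrightarrow> \<exists>xs w b E. 0 < w \<and> 0 < E \<and>
     (\<forall>z. exp (t * (xs + w * z)) * p (xs + w * z) / E \<le> A * exp (- \<bar>z\<bar> / K)) \<and>
     (\<forall>z\<in>{b..b + 1}. 1 / A \<le> exp (t * (xs + w * z)) * p (xs + w * z) / E)"
    using tilt_envelope by blast
  obtain C \<kappa> where std: "\<And>G b. G \<in> borel_measurable borel \<Longrightarrow> (\<forall>z. 0 \<le> G z) \<Longrightarrow> (\<forall>z. G z \<le> A * exp (- \<bar>z\<bar> / K)) \<Longrightarrow>
    (\<forall>z\<in>{b..b + 1}. 1 / A \<le> G z) \<Longrightarrow>
    (\<exists>\<mu> \<sigma>. 0 < \<sigma> \<and> standard_density (\<lambda>y. \<sigma> * G (\<mu> + \<sigma> * y) / (LINT z|lborel. G z)) C \<kappa>)"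
    using standardise_density[OF \<open>0 < A\<close> \<open>0 < K\<close>] by blast
  show ?thesis
  proof (rule exI[of _ C], rule exI[of _ \<kappa>], rule exI[of _ T], intro allI impI)
    fix t assume "T \<le> t"
    obtain xs w b E where "0 < w" "0 < E"
      and *: "\<forall>z. exp (t * (xs + w * z)) * p (xs + w * z) / E \<le> A * exp (- \<bar>z\<bar> / K)"
        "\<forall>z\<in>{b..b + 1}. 1 / A \<le> exp (t * (xs + w * z)) * p (xs + w * z) / E"
      using env[OF \<open>T \<le> t\<close>] by blast
    define F where "F = (\<lambda>x. exp (t * x) * p x)"
    define G where "G = (\<lambda>z. F (xs + w * z) / E)"
    have [measurable]: "F \<in> borel_measurable borel"
      unfolding F_def by measurable
    have "\<exists>\<mu> \<sigma>. 0 < \<sigma> \<and> standard_density (\<lambda>y. \<sigma> * G (\<mu> + \<sigma> * y) / (LINT z|lborel. G z)) C \<kappa>"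
      using * \<open>0 < E\<close> by (intro std) (auto simp: G_def F_def nonneg)
    then obtain \<mu> \<sigma> where "0 < \<sigma>" and sd: "standard_density (\<lambda>y. \<sigma> * G (\<mu> + \<sigma> * y) / (LINT z|lborel. G z)) C \<kappa>"
      by blast
    define s m where "s = w * \<sigma>" and "m = xs + w * \<mu>"
    have "0 < s"
      using \<open>0 < w\<close> \<open>0 < \<sigma>\<close> by (simp add: s_def)
    have "\<Phi> t = \<bar>w\<bar> *\<^sub>R (LINT z|lborel. F (xs + w * z))"
      unfolding \<Phi>_def F_def using \<open>0 < w\<close> by (intro lborel_integral_real_affine) simp
    then have G_int: "(LINT z|lborel. G z) = \<Phi> t / (w * E)"
      using \<open>0 < w\<close> by (simp add: G_def)
    have f_eq: "(\<lambda>y. \<sigma> * G (\<mu> + \<sigma> * y) / (LINT z|lborel. G z)) = (\<lambda>y. s * (F (m + s * y) / \<Phi> t))"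
      using \<open>0 < w\<close> \<open>0 < E\<close> unfolding G_int by (auto simp: G_def s_def m_def algebra_simps)
    interpret sd: standard_density "\<lambda>y. s * (F (m + s * y) / \<Phi> t)" C \<kappa>
      using sd unfolding f_eq .
    have "(LINT x|lborel. F x / \<Phi> t * (x - m)) = \<bar>s\<bar> *\<^sub>R (LINT y|lborel. F (m + s * y) / \<Phi> t * (m + s * y - m))"
      using \<open>0 < s\<close> by (intro lborel_integral_real_affine) simp
    also have "\<dots> = s * (LINT y|lborel. s * (F (m + s * y) / \<Phi> t) * y)"
      using \<open>0 < s\<close> by (simp add: mult_ac)
    also have "\<dots> = 0"
      by (simp only: sd.mean mult_zero_right)
    finally have "(LINT x|lborel. (1 / \<Phi> t) * (x * F x - m * F x)) = 0"
      by (simp add: algebra_simps diff_divide_distrib)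
    then have "(1 / \<Phi> t) * (first_moment t - m * \<Phi> t) = 0"
      unfolding F_def \<Phi>_def[of t] first_moment_def
      by (simp only: Bochner_Integration.integral_diff integrable_mult_right integrable_tilt0 integrable_tilt1 integral_mult_right_zero)
    then have "m = tilted_mean p t"
      using Phi_pos[of t] by (simp add: tilted_mean_eq field_simps)
    then show "\<exists>s>0. standard_density
     (\<lambda>y. s * (exp (t * (tilted_mean p t + s * y)) * p (tilted_mean p t + s * y) / \<Phi> t)) C \<kappa>"
      using sd.standard_density_axioms \<open>0 < s\<close> unfolding F_def by blast
  qed
qed

end

section \<open>Eventual monotonicity in the regularity classes\<close>

text \<open>The logarithm of h x is \<beta> ln x plus the integral of e u / u, with integrand
  (\<beta> + e u) / u in total; this is positive once \<open>e\<close> exceeds - \<beta>, as it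
  eventually does.\<close>

lemma R_reg_eventually_mono:
  assumes "0 < \<beta>" "h \<in> R_reg \<beta>"
  shows "\<exists>x0>0. \<forall>x y. x0 \<le> x \<longrightarrow> x \<le> y \<longrightarrow> h x \<le> h y"
proof -
  obtain l e e1 e2 where rep: "karamata_rep l e e1 e2" and ev: "\<forall>\<^sub>F x in at_top. h x = x powr \<beta> * l x"
    using assms(2) by (auto simp: R_reg_def)
  have e_deriv: "\<And>x. 1 \<le> x \<Longrightarrow> (e has_real_derivative e1 x) (at x within {1..})"
    and e_lim: "(e \<longlongrightarrow> 0) at_top"
    and l_eq: "\<And>x. 1 \<le> x \<Longrightarrow> l x = exp (integral {1..x} (\<lambda>u. e u / u))"
    using rep by (auto simp: karamata_rep_def)
  have "\<forall>\<^sub>F x in at_top. h x = x powr \<beta> * l x \<and> - \<beta> < e x"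
    using ev order_tendstoD(1)[OF e_lim, of "- \<beta>"] assms(1) by (auto simp: eventually_conj_iff)
  then obtain X where X: "\<And>x. X \<le> x \<Longrightarrow> h x = x powr \<beta> * l x" "\<And>x. X \<le> x \<Longrightarrow> - \<beta> < e x"
    by (auto simp: eventually_at_top_linorder)
  have cont: "continuous_on {1..} (\<lambda>u. e u / u)"
    by (intro continuous_intros DERIV_continuous_on[of _ e e1] e_deriv) auto
  have int: "(\<lambda>u. e u / u) integrable_on {a..b}" if "1 \<le> a" for a b
    using that by (intro integrable_continuous_interval continuous_on_subset[OF cont]) auto
  show ?thesis
  proof (intro exI[of _ "max 1 X"] conjI allI impI)
    fix x y assume x: "max 1 X \<le> x" and "x \<le> y"
    then have "1 \<le> x" "X \<le> x" "1 \<le> y" "X \<le> y" by auto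
    have "((\<lambda>u. - \<beta> / u) has_integral (- \<beta> * ln y - - \<beta> * ln x)) {x..y}"
      using \<open>1 \<le> x\<close> \<open>x \<le> y\<close>
      by (intro fundamental_theorem_of_calculus)
         (auto intro!: derivative_eq_intros simp: has_real_derivative_iff_has_vector_derivative[symmetric])
    moreover have "((\<lambda>u. e u / u) has_integral integral {x..y} (\<lambda>u. e u / u)) {x..y}"
      using int[OF \<open>1 \<le> x\<close>] by (rule integrable_integral)
    ultimately have "- \<beta> * ln y - - \<beta> * ln x \<le> integral {x..y} (\<lambda>u. e u / u)"
    proof (rule has_integral_le)
      fix u assume "u \<in> {x..y}"
      then show "- \<beta> / u \<le> e u / u"
        using X(2)[of u] \<open>1 \<le> x\<close> \<open>X \<le> x\<close> by (intro divide_right_mono) auto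
    qed
    moreover have "integral {1..x} (\<lambda>u. e u / u) + integral {x..y} (\<lambda>u. e u / u) = integral {1..y} (\<lambda>u. e u / u)"
      using \<open>1 \<le> x\<close> \<open>x \<le> y\<close> int[of 1] by (intro Henstock_Kurzweil_Integration.integral_combine) auto
    ultimately have "\<beta> * ln x + integral {1..x} (\<lambda>u. e u / u) \<le> \<beta> * ln y + integral {1..y} (\<lambda>u. e u / u)"
      by simp
    then have "exp (\<beta> * ln x + integral {1..x} (\<lambda>u. e u / u)) \<le> exp (\<beta> * ln y + integral {1..y} (\<lambda>u. e u / u))"
      by simp
    then show "h x \<le> h y"
      using \<open>1 \<le> x\<close> \<open>1 \<le> y\<close> by (simp add: X(1) \<open>X \<le> x\<close> \<open>X \<le> y\<close> l_eq powr_def exp_add)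
  qed simp
qed

lemma R_class_eventually_mono:
  assumes "h \<in> R_class"
  shows "\<exists>x0>0. \<forall>x y. x0 \<le> x \<longrightarrow> x \<le> y \<longrightarrow> h x \<le> h y"
proof -
  from assms consider \<beta> where "0 < \<beta>" "h \<in> R_reg \<beta>" | "strict_mono_on {0<..} h"
    by (auto simp: R_class_def R_infinity_def)
  then show ?thesis
  proof cases
    case 2
    then have "h x \<le> h y" if "1 \<le> x" "x \<le> y" for x y
      using strict_mono_onD[OF 2, of x y] that by (cases "x = y") auto
    then show ?thesis
      by (intro exI[of _ 1]) auto
  qed (rule R_reg_eventually_mono)
qed

text \<open>If \<open>h\<close> stayed below \<open>K\<close>, the mean value theorem would make
  \<open>g\<close> grow at most linearly. Together with eventual monotonicity this gives h \<ge> 1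
  from some point on, which turns the hypothesis on \<open>q\<close> into |q| \<le> 1.\<close>

lemma superlinear_deriv_unbounded:
  fixes g h :: "real \<Rightarrow> real"
  assumes deriv: "\<And>x. 0 < x \<Longrightarrow> (g has_real_derivative h x) (at x)"
    and "filterlim (\<lambda>x. g x / x) at_top at_top" and "0 < x0"
  shows "\<exists>x\<ge>x0. K \<le> h x"
proof (rule ccontr)
  assume "\<not> ?thesis"
  then have h_less: "h x < K" if "x0 \<le> x" for x
    using that by (meson not_le)
  have bound: "g x \<le> g x0 + \<bar>K\<bar> * x" if "x0 \<le> x" for x
  proof (cases "x = x0")
    case False
    then have "\<exists>z>x0. z < x \<and> g x - g x0 = (x - x0) * h z"
      using that \<open>0 < x0\<close> by (intro MVT2 deriv) auto
    then obtain z where "x0 < z" "g x - g x0 = (x - x0) * h z" by blast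
    moreover have "(x - x0) * h z \<le> (x - x0) * \<bar>K\<bar>"
      using h_less[of z] \<open>x0 < z\<close> that by (intro mult_left_mono) auto
    moreover have "(x - x0) * \<bar>K\<bar> \<le> x * \<bar>K\<bar>"
      using \<open>0 < x0\<close> by (intro mult_right_mono) auto
    ultimately show ?thesis
      by (simp add: mult.commute)
  qed (use \<open>0 < x0\<close> in simp)
  have "\<forall>\<^sub>F x in at_top. \<bar>g x0\<bar> + \<bar>K\<bar> + 1 \<le> g x / x"
    using assms(2) by (auto simp: filterlim_at_top)
  then obtain Y where Y: "\<And>x. Y \<le> x \<Longrightarrow> \<bar>g x0\<bar> + \<bar>K\<bar> + 1 \<le> g x / x"
    by (auto simp: eventually_at_top_linorder)
  define x where "x = max 1 (max x0 Y)"
  have x: "1 \<le> x" "x0 \<le> x" "Y \<le> x"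
    by (auto simp: x_def)
  then have "(\<bar>g x0\<bar> + \<bar>K\<bar> + 1) * x \<le> g x"
    using Y[of x] by (simp add: pos_le_divide_eq)
  moreover have "\<bar>g x0\<bar> * 1 \<le> \<bar>g x0\<bar> * x"
    using x(1) by (intro mult_left_mono) auto
  ultimately show False
    using bound[OF x(2)] x(1) by (simp add: algebra_simps)
qed

section \<open>Conditioning on the sum\<close>

lemma conv_commute: "conv f g = conv g f"
proof
  fix y
  have "(LINT x|lborel. f (y - x) * g x) = \<bar>-1\<bar> *\<^sub>R (LINT x|lborel. f (y - (y + -1 * x)) * g (y + -1 * x))"
    by (rule lborel_integral_real_affine) simp
  then show "conv f g y = conv g f y"
    by (simp add: conv_def mult.commute)
qed

text \<open>The first index is left free because both the full sum and the sum without
  \<open>X 1\<close> are needed; \<open>j..j + k\<close> has the k + 1 terms that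
  \<open>conv_pow p k\<close> counts.\<close>

lemma (in prob_space) distributed_sum_conv_pow:
  fixes X :: "nat \<Rightarrow> 'a \<Rightarrow> real"
  assumes "bounded_density p B" "indep_vars (\<lambda>_. borel) X {1..}"
    and dist: "\<And>i. 1 \<le> i \<Longrightarrow> distributed M lborel (X i) (\<lambda>x. ennreal (p x))" and "1 \<le> j"
  shows "distributed M lborel (\<lambda>w. \<Sum>i=j..j + k. X i w) (\<lambda>x. ennreal (conv_pow p k x))"
proof (induction k)
  case 0
  then show ?case
    using dist[OF \<open>1 \<le> j\<close>] by simp
next
  case (Suc k)
  have "indep_vars (\<lambda>_. borel) X (insert (j + Suc k) {j..j + k})"
    using assms(2) by (rule indep_vars_subset) (use \<open>1 \<le> j\<close> in auto)
  then have "indep_var borel (X (j + Suc k)) borel (\<lambda>w. \<Sum>i=j..j + k. X i w)"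
    by (intro indep_vars_sum) auto
  from distributed_convolution[OF this dist Suc.IH] \<open>1 \<le> j\<close>
  have "distributed M lborel (\<lambda>w. X (j + Suc k) w + (\<Sum>i=j..j + k. X i w)) (\<lambda>x. ennreal (conv p (conv_pow p k) x))"
    by (simp only: ennreal_conv[OF assms(1) bounded_density_conv_pow[OF assms(1)]])
  then show ?case
    by (simp add: conv_commute[of p] add.commute)
qed

text \<open>Restricting the law of \<open>Y\<close> to \<open>C\<close> gives a finite measure
  \<open>PC\<close>; by independence the event has the mass that the convolution of
  \<open>PC\<close> with the law of \<open>T\<close> assigns to \<open>D\<close>.\<close>

lemma (in prob_space) emeasure_summand_and_sum:
  fixes Y T :: "'a \<Rightarrow> real"
  assumes f: "bounded_density f A" and p: "bounded_density p B"
    and indep: "indep_var borel Y borel T"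
    and T: "distributed M lborel T (\<lambda>x. ennreal (f x))" and Y: "distributed M lborel Y (\<lambda>x. ennreal (p x))"
    and [measurable]: "C \<in> sets borel" "D \<in> sets borel"
  shows "emeasure M {w \<in> space M. Y w \<in> C \<and> Y w + T w \<in> D} =
    (\<integral>\<^sup>+s. ennreal (conv f (\<lambda>x. indicator C x * p x) s) * indicator D s \<partial>lborel)"
proof -
  interpret f: bounded_density f A by (rule f)
  interpret p: bounded_density p B by (rule p)
  define F where "F = density lborel (\<lambda>x. ennreal (f x))"
  define P where "P = density lborel (\<lambda>x. ennreal (p x))"
  define PC where "PC = density lborel (\<lambda>x. ennreal (indicator C x * p x))"
  interpret F: real_distribution F unfolding F_def by (rule f.real_distribution)
  interpret P: real_distribution P unfolding P_def by (rule p.real_distribution)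
  have int_pC: "integrable lborel (\<lambda>x. indicator C x * p x)"
    by (rule Bochner_Integration.integrable_bound[OF p.integrable]) (auto simp: indicator_def)
  have fin_PC: "finite_measure PC"
    unfolding PC_def using int_pC
    by (intro finite_measureI) (auto simp: emeasure_density nn_integral_eq_integral p.nonneg)
  have [measurable]: "T \<in> borel_measurable M" "Y \<in> borel_measurable M"
    using distributed_measurable[OF T] distributed_measurable[OF Y] by auto
  have distrT: "distr M borel T = F" and distrY: "distr M borel Y = P"
    using distributed_distr_eq_density[OF T] distributed_distr_eq_density[OF Y]
    by (simp_all add: F_def P_def cong: distr_cong)
  have joint: "distr M (borel \<Otimes>\<^sub>M borel) (\<lambda>w. (Y w, T w)) = P \<Otimes>\<^sub>M F"
    using indep unfolding indep_var_distribution_eq distrT distrY by simp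
  let ?S = "{z \<in> space (borel \<Otimes>\<^sub>M borel). fst z \<in> C \<and> fst z + snd z \<in> D}"
  have [measurable_cong]: "sets (P \<Otimes>\<^sub>M F) = sets (borel \<Otimes>\<^sub>M borel)"
    by (intro sets_pair_measure_cong) auto
  define k where "k = (\<lambda>x. \<integral>\<^sup>+y. indicator D (x + y) \<partial>F)"
  have [measurable]: "k \<in> borel_measurable borel"
    unfolding k_def by (intro F.borel_measurable_nn_integral) measurable
  have "{w \<in> space M. Y w \<in> C \<and> Y w + T w \<in> D} = (\<lambda>w. (Y w, T w)) -` ?S \<inter> space M"
    by (auto simp: space_pair_measure)
  then have "emeasure M {w \<in> space M. Y w \<in> C \<and> Y w + T w \<in> D} = emeasure (distr M (borel \<Otimes>\<^sub>M borel) (\<lambda>w. (Y w, T w))) ?S"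
    by (simp add: emeasure_distr)
  also have "\<dots> = (\<integral>\<^sup>+x. \<integral>\<^sup>+y. indicator ?S (x, y) \<partial>F \<partial>P)"
    unfolding joint by (rule F.emeasure_pair_measure) measurable
  also have "\<dots> = (\<integral>\<^sup>+x. indicator C x * k x \<partial>P)"
    unfolding k_def
    by (intro nn_integral_cong) (auto simp: indicator_def space_pair_measure)
  also have "\<dots> = (\<integral>\<^sup>+x. k x \<partial>PC)"
    unfolding P_def PC_def
    by (simp add: nn_integral_density, intro nn_integral_cong) (auto simp: indicator_def)
  also have "\<dots> = emeasure (PC \<star> F) D"
    using fin_PC F.finite_measure_axioms unfolding k_def
    by (intro convolution_emeasure'[symmetric]) (auto simp: PC_def)
  also have "(PC \<star> F) = (F \<star> PC)"
    using fin_PC F.finite_measure_axioms by (intro convolution_commutative) (auto simp: PC_def)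
  also have "(F \<star> PC) = density lborel (\<lambda>s. \<integral>\<^sup>+x. ennreal (f (s - x)) * ennreal (indicator C x * p x) \<partial>lborel)"
    unfolding F_def PC_def using fin_PC F.finite_measure_axioms
    by (intro convolution_density) (auto simp: F_def PC_def)
  also have "(\<lambda>s. \<integral>\<^sup>+x. ennreal (f (s - x)) * ennreal (indicator C x * p x) \<partial>lborel) =
      (\<lambda>s. ennreal (conv f (\<lambda>x. indicator C x * p x) s))"
  proof
    fix s
    show "(\<integral>\<^sup>+x. ennreal (f (s - x)) * ennreal (indicator C x * p x) \<partial>lborel) =
        ennreal (conv f (\<lambda>x. indicator C x * p x) s)"
      unfolding conv_def
      by (subst nn_integral_eq_integral[symmetric])
         (auto simp: f.integrable_mult_bounded[OF int_pC] f.nonneg p.nonneg ennreal_mult)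
  qed
  also have "emeasure (density lborel \<dots>) D = (\<integral>\<^sup>+s. ennreal (conv f (\<lambda>x. indicator C x * p x) s) * indicator D s \<partial>lborel)"
    by (rule emeasure_density) (auto intro!: measurable_compose[OF conv_measurable measurable_ennreal])
  finally show ?thesis .
qed

section \<open>Continuity and the density formula at a prescribed conditioning value\<close>

lemma isCont_conv_pow:
  assumes "bounded_density p B" "2 \<le> k"
  shows "isCont (conv_pow p k) y"
proof -
  have "conv_pow p k = inverse_char (\<lambda>u. char (density lborel (\<lambda>x. ennreal (p x))) u ^ Suc k)"
    using conv_pow_inverse_char(2)[OF assms] by blast
  moreover have "integrable lborel (\<lambda>u. char (density lborel (\<lambda>x. ennreal (p x))) u ^ Suc k)"
    using assms by (intro conv_pow_inverse_char(1)) auto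
  ultimately show ?thesis
    by (simp only: isCont_inverse_char)
qed

lemma isCont_conv:
  assumes "bounded_density f A" "\<And>y. isCont f y" "integrable lborel g"
  shows "isCont (conv f g) y"
  unfolding continuous_at_sequentially
proof safe
  interpret f: bounded_density f A by fact
  have [measurable]: "g \<in> borel_measurable borel"
    using assms(3) by (simp add: integrable_iff_bounded)
  fix Z assume Z: "Z \<longlonglongrightarrow> y"
  show "(conv f g \<circ> Z) \<longlonglongrightarrow> conv f g y"
    unfolding comp_def conv_def
  proof (rule integral_dominated_convergence[where w="\<lambda>x. A * \<bar>g x\<bar>"])
    show "integrable lborel (\<lambda>x. A * \<bar>g x\<bar>)"
      using assms(3) by simp
    show "AE x in lborel. (\<lambda>n. f (Z n - x) * g x) \<longlonglongrightarrow> f (y - x) * g x"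
      using assms(2) by (intro AE_I2 tendsto_intros isCont_tendsto_compose[of _ f] Z)
    show "AE x in lborel. norm (f (Z n - x) * g x) \<le> A * \<bar>g x\<bar>" for n
      using f.nonneg f.bounded by (auto simp: abs_mult intro!: mult_right_mono)
  qed measurable
qed

lemma continuous_AE_eq:
  fixes u v :: "real \<Rightarrow> real"
  assumes "open S" "continuous_on S u" "continuous_on S v" "AE x in lborel. u x = v x" "s \<in> S"
  shows "u s = v s"
proof (rule ccontr)
  assume "u s \<noteq> v s"
  have "open (S \<inter> (\<lambda>x. u x - v x) -` (- {0}))"
    using assms by (intro continuous_open_preimage continuous_on_diff) auto
  moreover have "s \<in> S \<inter> (\<lambda>x. u x - v x) -` (- {0})"
    using \<open>s \<in> S\<close> \<open>u s \<noteq> v s\<close> by simp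
  ultimately obtain e where "e > 0" and e: "cball s e \<subseteq> S \<inter> (\<lambda>x. u x - v x) -` (- {0})"
    by (meson open_contains_cball)
  have "AE x in lborel. x \<notin> cball s e"
    using assms(4) by eventually_elim (use e in auto)
  then have "emeasure lborel (cball s e) = 0"
    by (subst (asm) AE_iff_measurable[where N="cball s e"]) auto
  then show False
    using \<open>e > 0\<close> by (simp add: cball_eq_atLeastAtMost)
qed

text \<open>The density formula for the conditional law holds almost everywhere by uniqueness of densities and,
  both sides being continuous, at every positive value of the sum.\<close>

lemma (in prob_space) continuous_conditional_distribution_formula:
  fixes X :: "nat \<Rightarrow> 'a \<Rightarrow> real"
  assumes p: "bounded_density p B" and indep: "indep_vars (\<lambda>_. borel) X {1..}"
    and dist: "\<And>i. 1 \<le> i \<Longrightarrow> distributed M lborel (X i) (\<lambda>x. ennreal (p x))" and "2 \<le> m"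
    and \<kappa>: "continuous_conditional_distribution M (X 1) (\<lambda>w. \<Sum>i=1..m + 2. X i w) \<kappa>"
    and [measurable]: "C \<in> sets borel" and "0 < s"
  shows "measure (\<kappa> s) C * conv_pow p (Suc m) s = (LINT x|lborel. conv_pow p m (s - x) * (indicator C x * p x))"
proof -
  interpret p: bounded_density p B by (rule p)
  interpret f: bounded_density "conv_pow p m" B by (rule bounded_density_conv_pow[OF p])
  interpret fS: bounded_density "conv_pow p (Suc m)" B by (rule bounded_density_conv_pow[OF p])
  have \<kappa>_meas: "\<kappa> \<in> borel \<rightarrow>\<^sub>M prob_algebra borel"
    and \<kappa>_eq: "\<And>D. D \<in> sets borel \<Longrightarrow> measure M {w \<in> space M. X 1 w \<in> C \<and> (\<Sum>i=1..m + 2. X i w) \<in> D} =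
          (LINT s:D|distr M borel (\<lambda>w. \<Sum>i=1..m + 2. X i w). measure (\<kappa> s) C)"
    and \<kappa>_cont: "continuous_on {0<..} (\<lambda>s. measure (\<kappa> s) C)"
    using \<kappa> by (auto simp: continuous_conditional_distribution_def regular_conditional_distribution_def)
  have [measurable]: "(\<lambda>s. measure (\<kappa> s) C) \<in> borel_measurable borel"
    by (rule measurable_compose[OF measurable_prob_algebraD[OF \<kappa>_meas] measurable_measure_subprob_algebra]) simp
  have \<kappa>_le: "measure (\<kappa> s) C \<le> 1" for s
  proof -
    have "\<kappa> s \<in> space (prob_algebra borel)"
      using measurable_space[OF \<kappa>_meas, of s] by simp
    then have "prob_space (\<kappa> s)"
      by (simp add: space_prob_algebra)
    then show ?thesis
      by (rule prob_space.prob_le_1)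
  qed
  \<comment> \<open>There are m + 2 summands: \<open>?T\<close> has m + 1 of them and density
    \<open>conv_pow p m\<close>, while the full sum has density
    \<open>conv_pow p (Suc m)\<close>.\<close>
  let ?T = "\<lambda>w. \<Sum>i=2..m + 2. X i w"
  let ?S = "\<lambda>w. \<Sum>i=1..m + 2. X i w"
  have S_eq: "?S w = X 1 w + ?T w" for w
    by (subst sum.atLeast_Suc_atMost) (auto simp: numeral_2_eq_2)
  have dist_T: "distributed M lborel ?T (\<lambda>x. ennreal (conv_pow p m x))"
    using distributed_sum_conv_pow[OF p indep dist, of 2 m] by (simp add: add.commute)
  have dist_S: "distributed M lborel ?S (\<lambda>x. ennreal (conv_pow p (Suc m) x))"
    using distributed_sum_conv_pow[OF p indep dist, of 1 "Suc m"] by simp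
  have distr_S: "distr M borel ?S = density lborel (\<lambda>x. ennreal (conv_pow p (Suc m) x))"
    using distributed_distr_eq_density[OF dist_S] by (simp cong: distr_cong)
  have "indep_vars (\<lambda>_. borel) X (insert 1 {2..m + 2})"
    using indep by (rule indep_vars_subset) auto
  then have indep_T: "indep_var borel (X 1) borel ?T"
    by (intro indep_vars_sum) auto
  define u where "u = conv (conv_pow p m) (\<lambda>x. indicator C x * p x)"
  define v where "v = (\<lambda>s. measure (\<kappa> s) C * conv_pow p (Suc m) s)"
  have int_pC: "integrable lborel (\<lambda>x. indicator C x * p x)"
    by (rule Bochner_Integration.integrable_bound[OF p.integrable]) (auto simp: indicator_def)
  have [measurable]: "u \<in> borel_measurable borel"
    unfolding u_def by (intro conv_measurable) auto
  have [measurable]: "v \<in> borel_measurable borel"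
    unfolding v_def by measurable
  have u_nonneg: "0 \<le> u s" for s
    unfolding u_def conv_def by (intro integral_nonneg_AE AE_I2 mult_nonneg_nonneg f.nonneg p.nonneg) simp
  have v_nonneg: "0 \<le> v s" for s
    unfolding v_def using fS.nonneg by simp
  have int_v: "integrable lborel (\<lambda>s. indicator D s * v s)" if [measurable]: "D \<in> sets borel" for D
  proof (rule Bochner_Integration.integrable_bound[OF fS.integrable])
    show "AE s in lborel. norm (indicator D s * v s) \<le> norm (conv_pow p (Suc m) s)"
      using fS.nonneg \<kappa>_le by (auto simp: v_def indicator_def abs_mult intro!: mult_left_le_one_le simp del: conv_pow.simps)
  qed measurable
  \<comment> \<open>Both measures give \<open>D\<close> the probability that \<open>X 1\<close> lies
    in \<open>C\<close> and the sum in \<open>D\<close>: \<open>u\<close> by independence,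
    \<open>v\<close> by the defining property of the conditional law.\<close>
  have "density lborel (\<lambda>s. ennreal (u s)) = density lborel (\<lambda>s. ennreal (v s))"
  proof (rule measure_eqI)
    fix D assume "D \<in> sets (density lborel (\<lambda>s. ennreal (u s)))"
    then have [measurable]: "D \<in> sets borel" by simp
    have "emeasure (density lborel (\<lambda>s. ennreal (u s))) D = emeasure M {w \<in> space M. X 1 w \<in> C \<and> X 1 w + ?T w \<in> D}"
      unfolding u_def
      by (subst emeasure_summand_and_sum[OF f.bounded_density_axioms p indep_T dist_T dist])
         (auto intro!: emeasure_density measurable_compose[OF conv_measurable measurable_ennreal])
    also have "\<dots> = ennreal (measure M {w \<in> space M. X 1 w \<in> C \<and> ?S w \<in> D})"
      unfolding S_eq by (rule emeasure_eq_measure)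
    also have "measure M {w \<in> space M. X 1 w \<in> C \<and> ?S w \<in> D} = (LINT s|lborel. indicator D s * v s)"
      unfolding \<kappa>_eq[OF \<open>D \<in> sets borel\<close>] distr_S set_lebesgue_integral_def
      by (subst fS.integral_density) (auto simp: v_def mult_ac simp del: conv_pow.simps)
    also have "ennreal \<dots> = (\<integral>\<^sup>+s. ennreal (indicator D s * v s) \<partial>lborel)"
      by (rule nn_integral_eq_integral[symmetric]) (auto simp: int_v v_nonneg)
    also have "\<dots> = emeasure (density lborel (\<lambda>s. ennreal (v s))) D"
      by (subst emeasure_density) (auto intro!: nn_integral_cong simp: indicator_def)
    finally show "emeasure (density lborel (\<lambda>s. ennreal (u s))) D = emeasure (density lborel (\<lambda>s. ennreal (v s))) D" .
  qed simp
  then have "AE s in lborel. ennreal (v s) = ennreal (u s)"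
    by (intro sigma_finite_measure.density_unique) (auto intro: lborel.sigma_finite_measure_axioms)
  then have AE: "AE s in lborel. v s = u s"
    by eventually_elim (simp add: u_nonneg v_nonneg)
  have "v s = u s"
  proof (rule continuous_AE_eq[OF _ _ _ AE, of "{0<..}"])
    show "continuous_on {0<..} u"
      unfolding u_def using isCont_conv_pow[OF p \<open>2 \<le> m\<close>] int_pC
      by (intro continuous_at_imp_continuous_on ballI isCont_conv[OF f.bounded_density_axioms])
    show "continuous_on {0<..} v"
      unfolding v_def using isCont_conv_pow[OF p, of "Suc m"] \<open>2 \<le> m\<close>
      by (intro continuous_on_mult \<kappa>_cont continuous_at_imp_continuous_on ballI) simp
  qed (use \<open>0 < s\<close> in auto)
  then show ?thesis
    unfolding u_def v_def conv_def .
qed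

section \<open>From the ratio estimate to total variation\<close>

context convex_tail_density
begin

text \<open>\<open>P\<close> equals the integral over \<open>A\<close> of the tilted density times
  the ratio \<open>R\<close>, so the error is at most the integral of |R - 1| against the tilted
  density. The bound does not involve \<open>A\<close>, which gives uniformity over events.\<close>

lemma conditional_close_to_tilt:
  fixes t s :: real and m :: nat
  defines "a \<equiv> tilted_mean p t"
  defines "f \<equiv> (\<lambda>y. s * (exp (t * (a + s * y)) * p (a + s * y) / \<Phi> t))"
  assumes sd: "standard_density f C \<kappa>" and "0 < s"
    and J: "0 < conv_pow f (Suc m) 0"
    and ratio: "\<And>y. \<bar>conv_pow f m (- y) / conv_pow f (Suc m) 0 - 1\<bar> \<le> e * (1 + \<bar>y\<bar>)"
    and [measurable]: "A \<in> sets borel"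
    and P: "P * conv_pow p (Suc m) (real (m + 2) * a) = (LINT x|lborel. conv_pow p m (real (m + 2) * a - x) * (indicator A x * p x))"
  shows "\<bar>P - (LINT x|lborel. indicator A x * (exp (t * x) * p x / \<Phi> t))\<bar> \<le> 2 * e"
proof -
  interpret sd: standard_density f C \<kappa> by (rule sd)
  define \<pi> where "\<pi> = (\<lambda>x. exp (t * x) * p x / \<Phi> t)"
  define n where "n = real (m + 2)"
  \<comment> \<open>The tilting factor of all m + 2 summands when their sum is n a. It is common to
    numerator and denominator and cancels.\<close>
  define E where "E = exp (t * (n * a)) / \<Phi> t ^ Suc (Suc m)"
  define R where "R = (\<lambda>x. conv_pow f m (- ((x - a) / s)) / conv_pow f (Suc m) 0)"
  have "0 < E"
    using Phi_pos by (simp add: E_def)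
  have \<Phi>: "0 < \<Phi> t" by (rule Phi_pos)
  have tilt: "conv_pow \<pi> k y = exp (t * y) * conv_pow p k y / \<Phi> t ^ Suc k" for k y
    unfolding \<pi>_def by (rule conv_pow_tilt)
  have affine: "conv_pow f k y = s * conv_pow \<pi> k (real (Suc k) * a + s * y)" for k y
    using conv_pow_affine[OF \<open>0 < s\<close>, of \<pi> a k y] by (simp add: f_def \<pi>_def del: conv_pow.simps)
  have f_eq: "f = (\<lambda>y. s * \<pi> (a + s * y))"
    by (simp add: f_def \<pi>_def)
  have J_eq: "conv_pow f (Suc m) 0 = s * (E * conv_pow p (Suc m) (n * a))"
    by (simp add: affine tilt E_def n_def del: conv_pow.simps power_Suc)
  \<comment> \<open>The remaining m + 1 summands must add up to n a - x, which exceeds their mean (m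
    + 1) a by a - x; this produces the argument - (x - a) / s.\<close>
  have num_eq: "s * (E * (conv_pow p m (n * a - x) * p x)) = conv_pow f m (- ((x - a) / s)) * \<pi> x" for x
  proof -
    have "s * (- ((x - a) / s)) = a - x"
      using \<open>0 < s\<close> by simp
    then have "real (Suc m) * a + s * (- ((x - a) / s)) = n * a - x"
      by (simp add: n_def algebra_simps del: mult_minus_right)
    then have "conv_pow f m (- ((x - a) / s)) * \<pi> x = s * ((exp (t * (n * a - x)) * conv_pow p m (n * a - x) / \<Phi> t ^ Suc m) * (exp (t * x) * p x / \<Phi> t))"
      by (simp only: affine tilt) (simp add: \<pi>_def)
    also have "exp (t * (n * a - x)) = exp (t * (n * a)) / exp (t * x)"
      by (simp add: right_diff_distrib exp_diff)
    finally show ?thesis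
      by (simp add: E_def)
  qed
  have int_f: "integrable lborel (\<lambda>y. f y * (1 + \<bar>y\<bar>))"
    using sd.integrable sd.integrable_abs_moment[of 1] by (simp add: distrib_left)
  interpret fm: bounded_density "conv_pow f m" C
    by (rule bounded_density_conv_pow[OF sd.bounded_density_axioms])
  have [measurable]: "R \<in> borel_measurable borel" "\<pi> \<in> borel_measurable borel"
    unfolding R_def \<pi>_def by measurable
  have \<pi>_nonneg: "0 \<le> \<pi> x" for x
    using \<Phi> nonneg[of x] by (simp add: \<pi>_def)
  have int_\<pi>: "integrable lborel \<pi>"
    unfolding \<pi>_def using integrable_tilt0 by simp
  have int_A\<pi>: "integrable lborel (\<lambda>x. indicator A x * \<pi> x)"
    by (rule Bochner_Integration.integrable_bound[OF int_\<pi>]) (auto simp: indicator_def)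
  have P_eq: "P = (LINT x|lborel. R x * (indicator A x * \<pi> x))"
  proof -
    have "P * conv_pow f (Suc m) 0 = (s * E) * (P * conv_pow p (Suc m) (n * a))"
      unfolding J_eq by simp
    also have "\<dots> = (LINT x|lborel. (s * E) * (conv_pow p m (n * a - x) * (indicator A x * p x)))"
      unfolding n_def P by simp
    also have "\<dots> = (LINT x|lborel. conv_pow f (Suc m) 0 * (R x * (indicator A x * \<pi> x)))"
    proof (intro Bochner_Integration.integral_cong refl)
      fix x
      have "(s * E) * (conv_pow p m (n * a - x) * (indicator A x * p x)) = indicator A x * (s * (E * (conv_pow p m (n * a - x) * p x)))"
        by simp
      also have "\<dots> = conv_pow f (Suc m) 0 * (R x * (indicator A x * \<pi> x))"
        unfolding num_eq R_def using J by simp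
      finally show "(s * E) * (conv_pow p m (n * a - x) * (indicator A x * p x)) = conv_pow f (Suc m) 0 * (R x * (indicator A x * \<pi> x))" .
    qed
    also have "\<dots> = conv_pow f (Suc m) 0 * (LINT x|lborel. R x * (indicator A x * \<pi> x))"
      by (rule integral_mult_right_zero)
    finally show ?thesis
      using J by simp
  qed
  have int_env: "integrable lborel (\<lambda>x. \<pi> x * (1 + \<bar>(x - a) / s\<bar>))"
    and env: "(LINT x|lborel. \<pi> x * (1 + \<bar>(x - a) / s\<bar>)) = (LINT y|lborel. f y * (1 + \<bar>y\<bar>))"
  proof -
    have "integrable lborel (\<lambda>y. (1 / s) * (f y * (1 + \<bar>y\<bar>)))"
      by (rule integrable_mult_right[OF int_f])
    then have "integrable lborel (\<lambda>y. \<pi> (a + s * y) * (1 + \<bar>y\<bar>))"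
      using \<open>0 < s\<close> by (simp add: f_eq mult.assoc)
    then show "integrable lborel (\<lambda>x. \<pi> x * (1 + \<bar>(x - a) / s\<bar>))"
      using lborel_integrable_real_affine_iff[of s "\<lambda>x. \<pi> x * (1 + \<bar>(x - a) / s\<bar>)" a] \<open>0 < s\<close> by simp
    have "(LINT x|lborel. \<pi> x * (1 + \<bar>(x - a) / s\<bar>)) = \<bar>s\<bar> *\<^sub>R (LINT y|lborel. \<pi> (a + s * y) * (1 + \<bar>(a + s * y - a) / s\<bar>))"
      using \<open>0 < s\<close> by (intro lborel_integral_real_affine) simp
    then show "(LINT x|lborel. \<pi> x * (1 + \<bar>(x - a) / s\<bar>)) = (LINT y|lborel. f y * (1 + \<bar>y\<bar>))"
      using \<open>0 < s\<close> by (simp add: f_eq mult.assoc)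
  qed
  have pointwise: "\<bar>R x * (indicator A x * \<pi> x) - indicator A x * \<pi> x\<bar> \<le> e * (\<pi> x * (1 + \<bar>(x - a) / s\<bar>))" for x
  proof -
    have "\<bar>R x * (indicator A x * \<pi> x) - indicator A x * \<pi> x\<bar> = indicator A x * (\<bar>R x - 1\<bar> * \<pi> x)"
      using \<pi>_nonneg[of x] by (auto simp: indicator_def left_diff_distrib[symmetric] abs_mult
          simp flip: left_diff_distrib[of "R x" 1 "\<pi> x", simplified])
    also have "\<dots> \<le> \<bar>R x - 1\<bar> * \<pi> x"
      using \<pi>_nonneg[of x] by (simp add: indicator_def)
    also have "\<dots> \<le> e * (1 + \<bar>(x - a) / s\<bar>) * \<pi> x"
      unfolding R_def using \<pi>_nonneg[of x] by (intro mult_right_mono ratio)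
    finally show ?thesis
      by (simp only: mult_ac)
  qed
  have e_nonneg: "0 \<le> e"
    using order_trans[OF abs_ge_zero ratio[of 0]] by simp
  have int_R: "integrable lborel (\<lambda>x. R x * (indicator A x * \<pi> x))"
  proof (rule Bochner_Integration.integrable_bound[OF integrable_mult_right[OF int_\<pi>, of "C / conv_pow f (Suc m) 0"]])
    have "\<bar>R x * (indicator A x * \<pi> x)\<bar> \<le> C / conv_pow f (Suc m) 0 * \<pi> x" for x
    proof -
      have R: "0 \<le> R x" "R x \<le> C / conv_pow f (Suc m) 0"
        unfolding R_def using J fm.nonneg fm.bounded by (auto intro!: divide_right_mono divide_nonneg_pos simp del: conv_pow.simps)
      have A\<pi>: "0 \<le> indicator A x * \<pi> x" "indicator A x * \<pi> x \<le> \<pi> x"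
        using \<pi>_nonneg[of x] by (auto simp: indicator_def)
      have "\<bar>R x * (indicator A x * \<pi> x)\<bar> = R x * (indicator A x * \<pi> x)"
        by (rule abs_of_nonneg[OF mult_nonneg_nonneg[OF R(1) A\<pi>(1)]])
      also have "\<dots> \<le> C / conv_pow f (Suc m) 0 * \<pi> x"
        by (rule mult_mono[OF R(2) A\<pi>(2) order_trans[OF R] A\<pi>(1)])
      finally show ?thesis .
    qed
    then show "AE x in lborel. norm (R x * (indicator A x * \<pi> x)) \<le> norm (C / conv_pow f (Suc m) 0 * \<pi> x)"
      by (intro AE_I2) (metis abs_ge_self order_trans real_norm_def)
  qed measurable
  have "\<bar>P - (LINT x|lborel. indicator A x * \<pi> x)\<bar> = \<bar>LINT x|lborel. R x * (indicator A x * \<pi> x) - indicator A x * \<pi> x\<bar>"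
    unfolding P_eq by (simp only: Bochner_Integration.integral_diff[OF int_R int_A\<pi>])
  also have "\<dots> \<le> (LINT x|lborel. e * (\<pi> x * (1 + \<bar>(x - a) / s\<bar>)))"
    by (rule order_trans[OF integral_abs_bound], rule integral_mono)
       (intro integrable_abs Bochner_Integration.integrable_diff int_R int_A\<pi> integrable_mult_right int_env pointwise)+
  also have "\<dots> = e * (LINT y|lborel. f y * (1 + \<bar>y\<bar>))"
    by (simp only: integral_mult_right_zero env)
  also have "(LINT y|lborel. f y * (1 + \<bar>y\<bar>)) = 1 + (LINT y|lborel. f y * \<bar>y\<bar>)"
    using sd.integrable sd.integrable_abs_moment[of 1] sd.total by (simp add: distrib_left)
  also have "e * \<dots> \<le> e * 2"
    using sd.abs_mean_le e_nonneg by (intro mult_left_mono) auto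
  finally show ?thesis
    by (simp add: \<pi>_def mult.commute)
qed

end

theorem theorem5p4:
  fixes M :: "'w measure" and X :: "nat \<Rightarrow> 'w \<Rightarrow> real"
    and p g q h :: "real \<Rightarrow> real" and c \<theta> :: real
    and a t :: "nat \<Rightarrow> real"
    and P :: "nat \<Rightarrow> real \<Rightarrow> real measure"
  assumes "c > 0"
    and "\<forall>x\<ge>0. p x = c * exp (- (g x - q x))"
    and "\<forall>x<0. p x = 0"
    and "p \<in> borel_measurable borel"
    and "(\<integral>\<^sup>+x. ennreal (p x) \<partial>lborel) = 1"
    and "\<exists>B. \<forall>x. p x \<le> B"
    and "\<forall>x\<ge>0. g x > 0"
    and "filterlim (\<lambda>x. g x / x) at_top at_top"
    and "\<forall>x>0. (g has_real_derivative h x) (at x)"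
    and "\<theta> > 0"
    and "\<forall>\<^sub>F x in at_top. \<forall>v\<ge>0. \<bar>v - x\<bar> < \<theta> * x \<longrightarrow> \<bar>q v\<bar> \<le> 1 / sqrt (x * h x)"
    and "h \<in> R_class"
    and "prob_space M"
    and "prob_space.indep_vars M (\<lambda>_. borel) X {1..}"
    and "\<forall>i\<ge>1. distributed M lborel (X i) (\<lambda>x. ennreal (p x))"
    and "filterlim a at_top sequentially"
    and "\<forall>\<^sub>F n in sequentially. tilted_mean p (t n) = a n"
    \<comment> \<open>the quotient in the growth condition is well defined for large \<open>n\<close>\<close>
    and "\<forall>\<^sub>F n in sequentially. gen_inverse h differentiable at (t n) \<and>
           deriv (gen_inverse h) (t n) > 0"
    and "(\<lambda>n. (gen_inverse h (t n))\<^sup>2 / sqrt (real n * deriv (gen_inverse h) (t n)))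
           \<longlonglongrightarrow> 0"
    and "\<forall>n\<ge>2. continuous_conditional_distribution M (X 1) (\<lambda>w. \<Sum>i=1..n. X i w) (P n)"
  shows "(\<lambda>n. SUP C\<in>sets borel.
            \<bar>measure (P n (real n * a n)) C
             - measure (density lborel (\<lambda>x. ennreal (tilted_density p (a n) x))) C\<bar>)
           \<longlonglongrightarrow> 0"
proof -
  interpret prob_space M by fact
  have p_def: "\<And>x. 0 \<le> x \<Longrightarrow> p x = c * exp (- (g x - q x))" and p_zero: "\<And>x. x < 0 \<Longrightarrow> p x = 0"
    using assms(2,3) by auto
  have p_nonneg: "0 \<le> p x" for x
    using p_def[of x] p_zero[of x] \<open>c > 0\<close> by (cases "0 \<le> x") auto
  obtain B where B: "\<And>x. p x \<le> B"
    using assms(6) by blast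
  obtain x1 where "0 < x1" and mono: "\<And>x y. x1 \<le> x \<Longrightarrow> x \<le> y \<Longrightarrow> h x \<le> h y"
    using R_class_eventually_mono[OF \<open>h \<in> R_class\<close>] by blast
  obtain x2 where x2: "x1 \<le> x2" "1 \<le> h x2"
    using superlinear_deriv_unbounded[of g h x1 1] assms(8,9) \<open>0 < x1\<close> by blast
  obtain x3 where x3: "\<And>x v. x3 \<le> x \<Longrightarrow> 0 \<le> v \<Longrightarrow> \<bar>v - x\<bar> < \<theta> * x \<Longrightarrow> \<bar>q v\<bar> \<le> 1 / sqrt (x * h x)"
    using assms(11) by (auto simp: eventually_at_top_linorder)
  \<comment> \<open>The entry 1 together with h \<ge> 1 beyond \<open>x2\<close> makes x h x \<ge>
    1; beyond \<open>x3\<close> the hypothesis on \<open>q\<close> holds and is used at v =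
    x.\<close>
  define x0 where "x0 = max 1 (max x2 x3)"
  have x0: "1 \<le> x0" "x2 \<le> x0" "x3 \<le> x0"
    by (auto simp: x0_def)
  have q_le: "\<bar>q x\<bar> \<le> 1" if "x0 \<le> x" for x
  proof -
    have "1 \<le> h x"
      using mono[of x2 x] x2 x0 that by simp
    then have "1 * 1 \<le> x * h x"
      using x0 that by (intro mult_mono) auto
    then have "1 / sqrt (x * h x) \<le> 1"
      by simp
    moreover have "\<bar>q x\<bar> \<le> 1 / sqrt (x * h x)"
      using x3[of x x] x0 that \<open>\<theta> > 0\<close> by simp
    ultimately show ?thesis by simp
  qed
  have "convex_tail_density p g h B c x0"
  proof unfold_locales
    show "(LINT x|lborel. p x) = 1"
      using assms(4,5) p_nonneg by (subst integral_eq_nn_integral) auto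
    show "0 < p x" if "0 \<le> x" for x
      using p_def[OF that] \<open>c > 0\<close> by simp
    show "c * exp (- 1) * exp (- g x) \<le> p x" if "x0 \<le> x" for x
      using q_le[OF that] that x0 \<open>c > 0\<close> by (simp add: p_def mult.assoc flip: exp_add)
    show "p x \<le> c * exp 1 * exp (- g x)" if "x0 \<le> x" for x
      using q_le[OF that] that x0 \<open>c > 0\<close> by (simp add: p_def mult.assoc flip: exp_add)
    show "h x \<le> h y" if "x0 \<le> x" "x \<le> y" for x y
      using mono[of x y] that x0 x2 by simp
  qed (use assms p_nonneg B x0 in auto)
  then interpret convex_tail_density p g h B c x0 .
  obtain C \<kappa> T where T: "\<And>t. T \<le> t \<Longrightarrow> \<exists>s>0. standard_density
     (\<lambda>y. s * (exp (t * (tilted_mean p t + s * y)) * p (tilted_mean p t + s * y) / \<Phi> t)) C \<kappa>"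
    using standard_density_tilt by blast
  obtain e where e_lim: "e \<longlonglongrightarrow> 0" and e_ev: "\<forall>\<^sub>F m in sequentially. \<forall>f. standard_density f C \<kappa> \<longrightarrow>
     0 < conv_pow f (Suc m) 0 \<and>
     (\<forall>y. \<bar>conv_pow f m (- y) / conv_pow f (Suc m) 0 - 1\<bar> \<le> e m * (1 + \<bar>y\<bar>))"
    using conv_pow_ratio_uniform[of C \<kappa>] by blast
  let ?d = "\<lambda>n A. \<bar>measure (P n (real n * a n)) A - measure (density lborel (\<lambda>x. ennreal (tilted_density p (a n) x))) A\<bar>"
  have shift: "filterlim (\<lambda>n::nat. n - 2) sequentially sequentially"
    by (rule filterlim_minus_const_nat_at_top)
  \<comment> \<open>As \<open>a n\<close> tends to infinity it passes
    \<open>tilted_mean p T\<close>, and strict monotonicity transfers the inequality to the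
    parameters.\<close>
  have t_large: "\<forall>\<^sub>F n in sequentially. T \<le> t n"
  proof -
    have "\<forall>\<^sub>F n in sequentially. tilted_mean p T < a n"
      using assms(16) by (auto simp: filterlim_at_top_dense)
    then show ?thesis
      using assms(17)
    proof eventually_elim
      case (elim n)
      then have "tilted_mean p T < tilted_mean p (t n)" by simp
      then show ?case
        by (simp add: strict_mono_less[OF tilted_mean_strict_mono] less_imp_le)
    qed
  qed
  \<comment> \<open>n \<ge> 4 ensures m = n - 2 \<ge> 2, as the inversion formula requires, and
    \<open>a n > 0\<close> puts the conditioning value in the range where the version of the
    conditional law is continuous.\<close>
  have bound: "\<forall>\<^sub>F n in sequentially. norm (SUP A\<in>sets borel. ?d n A) \<le> 2 * e (n - 2)"
    using t_large assms(17) eventually_compose_filterlim[OF e_ev shift] eventually_ge_at_top[of 4]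
      filterlim_at_top_dense[THEN iffD1, OF assms(16), rule_format, of 0]
  proof eventually_elim
    case (elim n)
    define m where "m = n - 2"
    have n: "n = m + 2" "2 \<le> m"
      using elim(4) by (auto simp: m_def)
    obtain s where "0 < s" and sd: "standard_density
     (\<lambda>y. s * (exp (t n * (tilted_mean p (t n) + s * y)) * p (tilted_mean p (t n) + s * y) / \<Phi> (t n))) C \<kappa>"
      using T[OF elim(1)] by blast
    have le: "?d n A \<le> 2 * e m" if A: "A \<in> sets borel" for A
    proof -
      have [measurable]: "A \<in> sets borel" by (rule A)
      have G: "measure (density lborel (\<lambda>x. ennreal (tilted_density p (a n) x))) A =
          (LINT x|lborel. indicator A x * (exp (t n * x) * p x / \<Phi> (t n)))"
      proof -
        have "integrable lborel (\<lambda>x. indicator A x * (exp (t n * x) * p x / \<Phi> (t n)))"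
          by (rule Bochner_Integration.integrable_bound[OF integrable_divide_zero[OF integrable_tilt0, of "t n" "\<Phi> (t n)"]])
             (auto simp: indicator_def)
        then have "emeasure (density lborel (\<lambda>x. ennreal (tilted_density p (a n) x))) A =
            ennreal (LINT x|lborel. indicator A x * (exp (t n * x) * p x / \<Phi> (t n)))"
          using Phi_pos[of "t n"] nonneg
          by (subst nn_integral_eq_integral[symmetric])
             (auto simp: emeasure_density tilted_density_eq[OF elim(2)] indicator_def intro!: nn_integral_cong)
        then show ?thesis
          using Phi_pos[of "t n"] nonneg
          by (simp add: measure_def integral_nonneg_AE)
      qed
      have "measure (P n (real n * a n)) A * conv_pow p (Suc m) (real n * a n) =
          (LINT x|lborel. conv_pow p m (real n * a n - x) * (indicator A x * p x))"
        unfolding n(1)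
      proof (rule continuous_conditional_distribution_formula[OF bounded_density_axioms assms(14) _ n(2)])
        show "distributed M lborel (X i) (\<lambda>x. ennreal (p x))" if "1 \<le> i" for i
          using assms(15) that by blast
        show "continuous_conditional_distribution M (X 1) (\<lambda>w. \<Sum>i=1..m + 2. X i w) (P (m + 2))"
          by (rule assms(20)[rule_format]) simp
        show "0 < real (m + 2) * a (m + 2)"
          using elim(5) n by simp
      qed (rule A)
      then have "\<bar>measure (P n (real n * a n)) A - (LINT x|lborel. indicator A x * (exp (t n * x) * p x / \<Phi> (t n)))\<bar> \<le> 2 * e m"
        using elim(3) sd unfolding m_def[symmetric] elim(2)[symmetric] n(1)[symmetric]
        by (intro conditional_close_to_tilt[OF sd \<open>0 < s\<close>]) (auto simp: n(1) simp del: conv_pow.simps)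
      then show ?thesis
        by (simp add: G)
    qed
    \<comment> \<open>The empty event shows that the supremum is nonnegative, so its norm is the
      supremum itself.\<close>
    have "0 \<le> ?d n {}" by simp
    also have "\<dots> \<le> (SUP A\<in>sets borel. ?d n A)"
      using le by (intro cSUP_upper bdd_aboveI2[where M="2 * e m"]) auto
    finally have "0 \<le> (SUP A\<in>sets borel. ?d n A)" .
    moreover have "(SUP A\<in>sets borel. ?d n A) \<le> 2 * e m"
      using le by (intro cSUP_least) auto
    ultimately show ?case
      by (simp add: m_def)
  qed
  have "(\<lambda>n. 2 * e (n - 2)) \<longlonglongrightarrow> 2 * 0"
    by (intro tendsto_intros filterlim_compose[OF e_lim shift])
  then have "(\<lambda>n. 2 * e (n - 2)) \<longlonglongrightarrow> 0" by simp
  with bound show ?thesis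
    by (rule Lim_null_comparison)
qed

end
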